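(* Let $X$ be a one-ended proper $CAT(0)$ space. Then $X$ has semistable fundamental group at infinity if and only if any two geodesic rays in $X$ are properly homotopic.
   Context: A metric space is proper if its closed balls are compact. A proper $CAT(0)$ space $X$ is one-ended if it is non-compact and for every compact $K\subseteq X$ the complement $X-K$ has exactly one connected component with non-compact closure in $X$. A proper ray in $X$ is a continuous proper map $c:[0,\infty)\to X$ (preimages of compact sets are compact). Two proper rays $c,c'$ are properly homotopic if there is a proper continuous map $H:[0,\infty)\times[0,1]\to X$ with $H(\cdot,0)=c$ and $H(\cdot,1)=c'$ (no base point condition is imposed). A geodesic ray in $X$ is an isometric embedding $[0,\infty)\to X$; geodesic rays are proper rays. The properness of a homotopy between geodesic rays does not require its intermediate levels to be geodesic rays. A one-ended proper $CAT(0)$ space $X$ has semistable fundamental group at infinity if any two proper rays in $X$ are properly homotopic. *)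

theory Defs
  imports "HOL-Analysis.Analysis"
begin

text \<open>
  A space \<open>X\<close> is a type \<open>'a\<close> of class \<open>metric_space\<close>; its properties are predicates on
  \<open>TYPE('a)\<close>.
\<close>

definition proper_metric :: "'a::metric_space itself \<Rightarrow> bool" where
  "proper_metric _ \<longleftrightarrow> (\<forall>(x::'a) r. compact (cball x r))"

definition isometric_on :: "'a::metric_space set \<Rightarrow> ('a \<Rightarrow> 'b::metric_space) \<Rightarrow> bool" where
  "isometric_on S f \<longleftrightarrow> (\<forall>s\<in>S. \<forall>t\<in>S. dist (f s) (f t) = dist s t)"

definition geodesic_segment :: "'a::metric_space set \<Rightarrow> 'a \<Rightarrow> 'a \<Rightarrow> bool" where
  "geodesic_segment G x y \<longleftrightarrow>
     (\<exists>(c::real \<Rightarrow> 'a) l. 0 \<le> l \<and> isometric_on {0..l} c \<and> c 0 = x \<and> c l = y \<and> G = c ` {0..l})"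

definition comparison_triangle ::
  "'a::metric_space \<Rightarrow> 'a \<Rightarrow> 'a \<Rightarrow> real^2 \<Rightarrow> real^2 \<Rightarrow> real^2 \<Rightarrow> bool" where
  "comparison_triangle p q r p' q' r' \<longleftrightarrow>
     dist p' q' = dist p q \<and> dist q' r' = dist q r \<and> dist r' p' = dist r p"

text \<open>The point \<open>x'\<close> on the side from \<open>a'\<close> to \<open>b'\<close> corresponds to the point \<open>x\<close> on the
  geodesic segment \<open>G\<close> from \<open>a\<close> to \<open>b\<close>.\<close>

definition comparison_point ::
  "'a::metric_space set \<Rightarrow> 'a \<Rightarrow> real^2 \<Rightarrow> real^2 \<Rightarrow> 'a \<Rightarrow> real^2 \<Rightarrow> bool" where
  "comparison_point G a a' b' x x' \<longleftrightarrow>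
     x \<in> G \<and> x' \<in> closed_segment a' b' \<and> dist a' x' = dist a x"

text \<open>
  The standard definition: a geodesic space in which distances between points of any geodesic
  triangle, on the same or on different sides, are at most the distances between comparison
  points in a Euclidean comparison triangle.
\<close>

definition CAT0 :: "'a::metric_space itself \<Rightarrow> bool" where
  "CAT0 _ \<longleftrightarrow>
     (\<forall>x y::'a. \<exists>G. geodesic_segment G x y) \<and>
     (\<forall>(p::'a) q r A B C p' q' r'.
        geodesic_segment A p q \<and> geodesic_segment B q r \<and> geodesic_segment C r p \<and>
        comparison_triangle p q r p' q' r' \<longrightarrow>
        (let R = (\<lambda>x x'. comparison_point A p p' q' x x' \<or>
                         comparison_point B q q' r' x x' \<or>
                         comparison_point C r r' p' x x')
         in \<forall>x x' y y'. R x x' \<and> R y y' \<longrightarrow> dist x y \<le> dist x' y'))"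

definition one_ended :: "'a::metric_space itself \<Rightarrow> bool" where
  "one_ended _ \<longleftrightarrow>
     \<not> compact (UNIV::'a set) \<and>
     (\<forall>K::'a set. compact K \<longrightarrow> (\<exists>!C. C \<in> components (UNIV - K) \<and> \<not> compact (closure C)))"

text \<open>Maps with domain \<open>S\<close> are total functions whose values outside \<open>S\<close> are irrelevant.\<close>

definition proper_continuous_on ::
  "'a::topological_space set \<Rightarrow> ('a \<Rightarrow> 'b::topological_space) \<Rightarrow> bool" where
  "proper_continuous_on S f \<longleftrightarrow>
     continuous_on S f \<and> (\<forall>K. compact K \<longrightarrow> compact {x \<in> S. f x \<in> K})"

definition proper_ray :: "(real \<Rightarrow> 'a::metric_space) \<Rightarrow> bool" where
  "proper_ray c \<longleftrightarrow> proper_continuous_on {0..} c"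

definition geodesic_ray :: "(real \<Rightarrow> 'a::metric_space) \<Rightarrow> bool" where
  "geodesic_ray c \<longleftrightarrow> isometric_on {0..} c"

definition properly_homotopic ::
  "(real \<Rightarrow> 'a::metric_space) \<Rightarrow> (real \<Rightarrow> 'a) \<Rightarrow> bool" where
  "properly_homotopic c c' \<longleftrightarrow>
     (\<exists>H :: real \<times> real \<Rightarrow> 'a. proper_continuous_on ({0..} \<times> {0..1}) H \<and>
        (\<forall>t\<ge>0. H (t, 0) = c t) \<and> (\<forall>t\<ge>0. H (t, 1) = c' t))"

definition semistable_at_infinity :: "'a::metric_space itself \<Rightarrow> bool" where
  "semistable_at_infinity _ \<longleftrightarrow>
     (\<forall>c c' :: real \<Rightarrow> 'a. proper_ray c \<and> proper_ray c' \<longrightarrow> properly_homotopic c c')"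

end

theory Submission
  imports Defs
begin

text \<open>
  Only one direction has content: geodesic rays are proper rays, so semistability gives proper
  homotopies between them.  For the converse, fix a base point \<open>x0\<close>.  The geodesic rays from \<open>x0\<close> form
  the visual boundary \<open>bd\<close>, which is compact because the space is proper and connected because the
  space is one-ended.  The tool for moving between depths is the radial projection \<open>proj s\<close> to the
  ball of radius \<open>s\<close> about \<open>x0\<close>.

  Classically, semistability says that for every \<open>n\<close> the images of the fundamental groups of
  the complements of large balls in that of the complement of the \<open>n\<close>-ball become constant, and it is
  known that a continuum whose points can all be joined by approximative paths has this property
  in shape theory.  The proof below is a version of that argument for rays.  Call \<open>y\<close> and
  \<open>z\<close> in \<open>bd\<close> \<^emph>\<open>linked\<close> at depth \<open>m\<close>, as seen from depth \<open>n \<le> m\<close>, if the points \<open>y m\<close> and \<open>z m\<close> can be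
  joined far out by a path whose projection to depth \<open>n\<close> is homotopic, near depth \<open>n\<close> or further out,
  to the geodesic from \<open>y n\<close> to \<open>z n\<close>.  For nearby boundary points this is an equivalence relation,
  which becomes finer as \<open>m\<close> grows and which contains a neighbourhood of the diagonal that depends on
  \<open>m\<close>.  The heart of the proof is that under the hypothesis on geodesic rays a single neighbourhood
  of the diagonal serves all \<open>m\<close> (\<open>link_uniform\<close>).  This rests on two facts.

  \<^item> A proper homotopy from a fixed ray \<open>x\<close> to \<open>y\<close> leaves a path from \<open>x n\<close> to \<open>y n\<close> as a trace at depth
  \<open>n\<close>, and two boundary points with nearby traces are linked at all depths.  Up to small
  perturbations there are countably many traces, so by Baire's theorem every nonempty closed set of
  boundary points contains a relatively open piece whose points are linked at all depths
  (\<open>link_fragment\<close>).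

  \<^item> For a tower of local equivalence relations on a continuum, such pieces in every
  closed subset already give uniformity (\<open>stable_Z\<close>).  Otherwise Zorn's lemma gives a minimal
  subcontinuum \<open>T\<close> without uniformity.  The set \<open>D\<close> of points of \<open>T\<close> at which uniformity fails locally
  is not all of \<open>T\<close>, so uniformity holds along each component \<open>R\<close> of \<open>D\<close>.  Points near \<open>R\<close>
  can therefore be compared with \<open>R\<close>, level by level.  The set of points of a small
  neighbourhood of \<open>R\<close> that agree with \<open>R\<close> up to one level but not up to a later one is clopen, so it
  reaches the boundary of the neighbourhood, as \<open>T\<close> is connected.  That boundary can be chosen off
  \<open>D\<close>, and compactness leaves only finitely many levels there.  Hence all points near \<open>R\<close> agree with
  \<open>R\<close> at all levels from some level on, and \<open>R\<close> does not meet \<open>D\<close>: a contradiction.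

  Uniform linking implies semistability: a loop that is far out is cut into short pieces whose ends
  are shadowed by boundary points, and each piece is replaced by a link at an arbitrary depth
  (\<open>push_outwards\<close>).  Finally a proper ray \<open>a\<close> is compared with a geodesic ray \<open>x\<close>
  (\<open>proper_ray_homotopic_to_geodesic_ray\<close>).  At a sequence of times, \<open>x\<close> and \<open>a\<close> are joined by
  paths far out; multiplying each path by a suitable loop from infinity makes it homotopic to the
  previous one slid along the two rays, and the resulting strips fit together to a proper homotopy.

  The geometry of the space enters only through the convexity of the distance between geodesics,
  which makes short paths straight-line homotopic and radial projections 2-Lipschitz.
\<close>

section \<open>Connectedness and compactness in metric spaces\<close>

lemma connected_locally_constant:
  assumes "connected S" "a \<in> S" "b \<in> S"
    and "\<And>y. y \<in> S \<Longrightarrow> \<exists>r>0. \<forall>y'\<in>S. dist y y' < r \<longrightarrow> (Q y' \<longleftrightarrow> Q y)"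
  shows "Q a \<longleftrightarrow> Q (b::'b::metric_space)"
proof (rule connected_equivalence_relation[OF assms(1-3), of "\<lambda>y z. Q y \<longleftrightarrow> Q z"])
  fix y assume "y \<in> S"
  then obtain r where r: "r > 0" "\<forall>y'\<in>S. dist y y' < r \<longrightarrow> (Q y' \<longleftrightarrow> Q y)"
    using assms(4) by blast
  show "\<exists>T. openin (top_of_set S) T \<and> y \<in> T \<and> (\<forall>x\<in>T. Q y = Q x)"
  proof (intro exI conjI ballI)
    show "openin (top_of_set S) (S \<inter> ball y r)" by (simp add: openin_open_Int)
    show "y \<in> S \<inter> ball y r" using r(1) \<open>y \<in> S\<close> by simp
    show "Q y = Q x" if "x \<in> S \<inter> ball y r" for x using r(2) that by (metis Int_iff mem_ball)
  qed
qed auto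

lemma compact_infdist_attained:
  fixes K :: "'b::metric_space set"
  assumes "compact K" "K \<noteq> {}"
  shows "\<exists>a\<in>K. infdist y K = dist y a"
proof -
  obtain a where a: "a \<in> K" "\<And>b. b \<in> K \<Longrightarrow> dist y a \<le> dist y b"
    using continuous_attains_inf[OF assms continuous_on_dist[OF continuous_on_const continuous_on_id], of y]
    by blast
  have "dist y a \<le> infdist y K"
    unfolding infdist_def using assms a by (auto intro: cINF_greatest)
  then show ?thesis using a(1) infdist_le[OF a(1), of y] by force
qed

lemma compact_closed_gap:
  fixes K L :: "'b::metric_space set"
  assumes "compact K" "closed L" "K \<inter> L = {}"
  shows "\<exists>\<eta>>0. \<forall>a\<in>K. \<forall>b\<in>L. \<eta> \<le> dist a b"
proof (cases "K = {} \<or> L = {}")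
  case True then show ?thesis by (intro exI[of _ 1]) auto
next
  case False
  then obtain a0 where a0: "a0 \<in> K" "\<And>a. a \<in> K \<Longrightarrow> infdist a0 L \<le> infdist a L"
    using continuous_attains_inf[OF assms(1), of "\<lambda>a. infdist a L"] continuous_on_infdist[OF continuous_on_id]
    by blast
  have "infdist a0 L > 0"
    using a0 False assms in_closed_iff_infdist_zero[of L a0] infdist_nonneg[of a0 L] by force
  moreover have "infdist a0 L \<le> dist a b" if "a \<in> K" "b \<in> L" for a b
    using a0(2)[OF that(1)] infdist_le[OF that(2), of a] by simp
  ultimately show ?thesis by blast
qed

text \<open>
  If no member of the chain were contained in \<open>U\<close>, the compact nonempty sets \<open>S - U\<close> would form
  a chain, and their intersection would be a point of \<open>\<Inter>\<C>\<close> outside \<open>U\<close>.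
\<close>

lemma compact_chain_subset_open:
  fixes U :: "'b::t2_space set"
  assumes "\<C> \<noteq> {}" "\<And>S. S \<in> \<C> \<Longrightarrow> compact S"
    and chain: "\<And>S T. S \<in> \<C> \<Longrightarrow> T \<in> \<C> \<Longrightarrow> S \<subseteq> T \<or> T \<subseteq> S"
    and "open U" "\<Inter>\<C> \<subseteq> U"
  shows "\<exists>S\<in>\<C>. S \<subseteq> U"
proof (rule ccontr)
  assume neg: "\<not> (\<exists>S\<in>\<C>. S \<subseteq> U)"
  obtain S0 where S0: "S0 \<in> \<C>" using assms by blast
  have "(S0 - U) \<inter> \<Inter>((\<lambda>S. S - U) ` \<C>) \<noteq> {}"
  proof (rule compact_imp_fip)
    show "compact (S0 - U)" using S0 assms by (simp add: compact_diff)
    show "closed T" if "T \<in> (\<lambda>S. S - U) ` \<C>" for T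
      using that assms(2) closed_Diff[OF compact_imp_closed \<open>open U\<close>] by blast
    show "(S0 - U) \<inter> \<Inter>\<F> \<noteq> {}" if "finite \<F>" "\<F> \<subseteq> (\<lambda>S. S - U) ` \<C>" for \<F>
    proof -
      have "\<exists>S\<in>\<C>. S - U \<subseteq> (S0 - U) \<inter> \<Inter>\<F>"
        using that
      proof (induction \<F>)
        case empty then show ?case using S0 by auto
      next
        case (insert F \<F>)
        then obtain S S' where *: "S \<in> \<C>" "S - U \<subseteq> (S0 - U) \<inter> \<Inter>\<F>" "F = S' - U" "S' \<in> \<C>" by auto
        show ?case
        proof (cases "S \<subseteq> S'")
          case True
          then show ?thesis using * by (intro bexI[of _ S]) auto
        next
          case False
          then have "S' \<subseteq> S" using chain[of S S'] * by simp
          then show ?thesis using * by (intro bexI[of _ S']) auto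
        qed
      qed
      then obtain S where "S \<in> \<C>" "S - U \<subseteq> (S0 - U) \<inter> \<Inter>\<F>" by (elim bexE)
      moreover have "S - U \<noteq> {}" using neg \<open>S \<in> \<C>\<close> by (auto simp only: Diff_eq_empty_iff)
      ultimately show ?thesis by (metis subset_empty)
    qed
  qed
  then obtain x where "x \<in> S0 - U" "x \<in> \<Inter>((\<lambda>S. S - U) ` \<C>)" by (metis Int_emptyI)
  moreover from this(2) have "x \<in> \<Inter>\<C>" using assms(1) by blast
  ultimately show False using assms(5) by auto
qed

lemma connected_Inter_chain_compact:
  fixes \<C> :: "'b::metric_space set set"
  assumes "\<C> \<noteq> {}" "\<And>S. S \<in> \<C> \<Longrightarrow> compact S" "\<And>S. S \<in> \<C> \<Longrightarrow> connected S"
    and chain: "\<And>S T. S \<in> \<C> \<Longrightarrow> T \<in> \<C> \<Longrightarrow> S \<subseteq> T \<or> T \<subseteq> S"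
  shows "connected (\<Inter>\<C>)"
proof -
  have cl: "closed (\<Inter>\<C>)" using assms(2) by (auto intro: compact_imp_closed)
  show ?thesis unfolding connected_closed_set[OF cl]
  proof (rule notI, elim exE conjE)
    fix A B assume AB: "closed A" "closed B" "A \<noteq> {}" "B \<noteq> {}" "A \<union> B = \<Inter>\<C>" "A \<inter> B = {}"
    obtain V W where VW: "open V" "open W" "A \<subseteq> V" "B \<subseteq> W" "V \<inter> W = {}"
      using t4_space[of A B] AB by metis
    obtain S where S: "S \<in> \<C>" "S \<subseteq> V \<union> W"
      using compact_chain_subset_open[OF assms(1,2) chain, of "V \<union> W"] VW AB by blast
    have "connected S" by (simp add: S assms(3))
    moreover have "S \<inter> V \<noteq> {}" "S \<inter> W \<noteq> {}" using S VW AB by blast+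
    ultimately show False
      using connectedD[OF \<open>connected S\<close> VW(1,2)] S VW by blast
  qed
qed

text \<open>
  In a compact metric space the quasi-component of a point, the intersection of its clopen
  neighbourhoods, is connected: a splitting of it would extend to a splitting of a clopen
  neighbourhood.  Quasi-components have the virtue that they can be separated by a clopen set from any
  compact set that they do not meet, which is the last claim.
\<close>

lemma quasi_component_compact:
  fixes D :: "'b::metric_space set"
  assumes "compact D" "x \<in> D"
  defines "R \<equiv> quasi_component_of_set (top_of_set D) x"
  shows "x \<in> R" "R \<subseteq> D" "compact R" "connected R"
    and "\<And>K'. compact K' \<Longrightarrow> K' \<subseteq> D \<Longrightarrow> K' \<inter> R = {} \<Longrightarrow>
           \<exists>K. R \<subseteq> K \<and> K \<inter> K' = {} \<and> K \<subseteq> D \<and> compact K \<and> compact (D - K)"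
proof -
  show xR: "x \<in> R" and RD: "R \<subseteq> D"
    using assms quasi_component_in_topspace by (force simp: R_def)+
  have qc: "R \<in> quasi_components_of (top_of_set D)"
    unfolding R_def using assms by (simp add: quasi_component_in_quasi_components_of)
  have clR: "closedin (top_of_set D) R"
    using closedin_quasi_components_of[OF qc] .
  then show cR: "compact R" using assms(1) closedin_compact by blast
  show sep: "\<exists>K. R \<subseteq> K \<and> K \<inter> K' = {} \<and> K \<subseteq> D \<and> compact K \<and> compact (D - K)"
    if K': "compact K'" "K' \<subseteq> D" "K' \<inter> R = {}" for K'
  proof -
    have "separated_between (top_of_set D) R K'"
      using separated_between_quasi_component_compact[OF qc, of K'] K'
      by (auto simp: compactin_subtopology disjnt_def)
    then obtain U V where UV: "openin (top_of_set D) U" "openin (top_of_set D) V" "U \<union> V = D"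
      "disjnt U V" "R \<subseteq> U" "K' \<subseteq> V"
      unfolding separated_between_def by auto
    have "closedin (top_of_set D) U" "closedin (top_of_set D) V"
      using UV by (auto simp: closedin_def disjnt_def) 
        (metis Diff_cancel Diff_triv Int_commute Un_Diff sup_bot.right_neutral sup_bot_left)+
    then have "compact U" "compact V" using assms(1) closedin_compact by blast+
    moreover have "D - U = V" using UV by (auto simp: disjnt_def)
    ultimately show ?thesis using UV by (intro exI[of _ U]) (auto simp: disjnt_def)
  qed
  show "connected R" unfolding connected_closed_set[OF compact_imp_closed[OF cR]]
  proof (rule notI, elim exE conjE)
    fix A B assume AB: "closed A" "closed B" "A \<noteq> {}" "B \<noteq> {}" "A \<union> B = R" "A \<inter> B = {}"
    obtain V W where VW: "open V" "open W" "A \<subseteq> V" "B \<subseteq> W" "V \<inter> W = {}"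
      using t4_space[of A B] AB by metis
    obtain K where K: "R \<subseteq> K" "K \<inter> (D - (V \<union> W)) = {}" "K \<subseteq> D" "compact K" "compact (D - K)"
    proof -
      have "compact (D - (V \<union> W))" using assms(1) VW by (intro compact_diff open_Un)
      moreover have "(D - (V \<union> W)) \<inter> R = {}" using VW AB by blast
      ultimately show ?thesis using sep[of "D - (V \<union> W)"] that by blast
    qed
    have *: "y \<in> U" if U: "open U" "open U'" "K \<subseteq> U \<union> U'" "U \<inter> U' = {}" "a \<in> U" "a \<in> R" "y \<in> R" for U U' a y
    proof -
      have 1: "K \<inter> U = D \<inter> (U - (D - K))" "K \<inter> U = D \<inter> (K - U')" using U K by auto
      have "open (U - (D - K))" "closed (K - U')"
        using U K by (auto intro: open_Diff closed_Diff compact_imp_closed)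
      then have "openin (top_of_set D) (K \<inter> U)" "closedin (top_of_set D) (K \<inter> U)"
        using 1 openin_open closedin_closed by metis+
      moreover have "quasi_component_of (top_of_set D) a y"
        using U(6,7) unfolding R_def
        by (metis mem_Collect_eq quasi_component_of_sym quasi_component_of_trans)
      moreover have "a \<in> K \<inter> U" using U K by auto
      ultimately have "y \<in> K \<inter> U" unfolding quasi_component_of by (elim conjE allE[of _ "K \<inter> U"]) simp
      then show ?thesis by simp
    qed
    have "K \<subseteq> V \<union> W" "K \<subseteq> W \<union> V" using K by auto
    then show False using *[of V W] *[of W V] VW AB by blast
  qed
qed

section \<open>Towers of local equivalence relations on a continuum\<close>

text \<open>
  The abstract setting for links between boundary points.  Symmetry and transitivity are required
  only at distances below \<open>\<epsilon>\<close>, because the comparison of two boundary points uses the short geodesic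
  between them.  The neighbourhoods of the diagonal in \<open>near_diagonal\<close> may shrink with \<open>m\<close>; the aim is
  one that serves all \<open>m\<close>.  The condition \<open>fragment\<close> is what Baire's theorem provides.
\<close>

locale local_equivalence_tower =
  fixes Z :: "'b::metric_space set" and E :: "nat \<Rightarrow> 'b \<Rightarrow> 'b \<Rightarrow> bool" and \<epsilon> :: real
  assumes compact_Z: "compact Z" and connected_Z: "connected Z" and eps: "\<epsilon> > 0"
    and sym: "\<lbrakk>y \<in> Z; z \<in> Z; dist y z < \<epsilon>; E m y z\<rbrakk> \<Longrightarrow> E m z y"
    and trans: "\<lbrakk>y \<in> Z; z \<in> Z; w \<in> Z; dist y z < \<epsilon>; dist z w < \<epsilon>; E m y z; E m z w\<rbrakk> \<Longrightarrow> E m y w"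
    and decreasing: "\<lbrakk>y \<in> Z; z \<in> Z; E (Suc m) y z\<rbrakk> \<Longrightarrow> E m y z"
    and near_diagonal: "\<exists>\<delta>>0. \<forall>y\<in>Z. \<forall>z\<in>Z. dist y z < \<delta> \<longrightarrow> E m y z"
    and fragment: "\<lbrakk>closed T; T \<subseteq> Z; T \<noteq> {}\<rbrakk> \<Longrightarrow>
      \<exists>y\<in>T. \<exists>\<eta>>0. \<forall>z\<in>T. \<forall>w\<in>T. dist y z < \<eta> \<longrightarrow> dist y w < \<eta> \<longrightarrow> (\<forall>m. E m z w)"
begin

definition stable :: "'b set \<Rightarrow> bool" where
  "stable T \<longleftrightarrow> (\<exists>\<delta>>0. \<forall>y\<in>T. \<forall>z\<in>T. dist y z < \<delta> \<longrightarrow> (\<forall>m. E m y z))"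

lemma refl: "y \<in> Z \<Longrightarrow> E m y y"
  using near_diagonal[of m] by force

lemma antimono: "\<lbrakk>y \<in> Z; z \<in> Z; E m' y z; m \<le> m'\<rbrakk> \<Longrightarrow> E m y z"
proof (induction "m' - m" arbitrary: m)
  case (Suc k)
  then have "E (Suc m) y z" by auto
  then show ?case using Suc.prems decreasing by blast
qed auto

text \<open>
  This compares a point \<open>y\<close> near \<open>R\<close> with \<open>R\<close>.  If \<open>R\<close> is stable with constant \<open>\<delta>\<close>, the choice of the
  nearby point \<open>d\<close> is immaterial, and being joined to \<open>R\<close> at level \<open>m\<close> is a locally constant
  condition on \<open>y\<close>: the next lemmas prove this.
\<close>

definition joined :: "'b set \<Rightarrow> real \<Rightarrow> nat \<Rightarrow> 'b \<Rightarrow> bool" where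
  "joined R \<delta> m y \<longleftrightarrow> (\<exists>d\<in>R. dist y d < \<delta>/4 \<and> E m y d)"

context
  fixes R N :: "'b set" and \<delta> :: real
  assumes R: "R \<subseteq> Z" "N \<subseteq> Z" "\<delta> > 0" "\<delta> \<le> \<epsilon>"
    and stab: "\<And>y z m. \<lbrakk>y \<in> R; z \<in> R; dist y z < \<delta>\<rbrakk> \<Longrightarrow> E m y z"
    and near: "\<And>y. y \<in> N \<Longrightarrow> \<exists>d\<in>R. dist y d < \<delta>/4"
begin

lemma joinedD:
  assumes "joined R \<delta> m y" "y \<in> N" "d \<in> R" "dist y d < \<delta>/4"
  shows "E m y d"
proof -
  obtain d' where d': "d' \<in> R" "dist y d' < \<delta>/4" "E m y d'" using assms by (auto simp: joined_def)
  have "dist d' d < \<delta>" using dist_triangle[of d' d y] d' assms R by (simp add: dist_commute)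
  then have "E m d' d" using stab d' assms by blast
  then show ?thesis
    by (intro trans[of y d' d]) (use d' R assms \<open>dist d' d < \<delta>\<close> in auto)
qed

lemma joined_transfer:
  assumes "joined R \<delta> m y" "y \<in> N" "y' \<in> N" "dist y' y < \<delta>/4" "E m y' y"
  shows "joined R \<delta> m y'"
proof -
  obtain d where d: "d \<in> R" "dist y d < \<delta>/4" "E m y d" using assms by (auto simp: joined_def)
  obtain d' where d': "d' \<in> R" "dist y' d' < \<delta>/4" using near assms by blast
  have dd: "dist y' d < \<delta>/2" using dist_triangle[of y' d y] d assms by simp
  then have dd': "dist d d' < \<delta>"
    using dist_triangle[of d d' y'] d' R(3) by (simp add: dist_commute)
  have "E m y' d"
    by (rule trans[of y' y d]) (use d assms R in auto)
  then have "E m y' d'"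
    by (intro trans[of y' d d']) (use d d' dd dd' assms R stab in auto)
  then show ?thesis using d' by (auto simp: joined_def)
qed

lemma joined_iff:
  assumes "y \<in> N" "y' \<in> N" "dist y' y < \<delta>/4" "E m y' y"
  shows "joined R \<delta> m y' \<longleftrightarrow> joined R \<delta> m y"
proof -
  have "E m y y'" using sym[of y' y m] assms R by auto
  then show ?thesis using joined_transfer[of m y y'] joined_transfer[of m y' y] assms
    by (metis dist_commute)
qed

lemma joined_locally_constant:
  "\<exists>\<eta>>0. \<forall>y\<in>N. \<forall>y'\<in>N. dist y y' < \<eta> \<longrightarrow> (joined R \<delta> m y' \<longleftrightarrow> joined R \<delta> m y)"
proof -
  obtain \<eta> where \<eta>: "\<eta> > 0" "\<forall>y\<in>Z. \<forall>z\<in>Z. dist y z < \<eta> \<longrightarrow> E m y z" using near_diagonal by blast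
  have "joined R \<delta> m y' \<longleftrightarrow> joined R \<delta> m y" if "y \<in> N" "y' \<in> N" "dist y y' < min \<eta> (\<delta>/4)" for y y'
    by (rule joined_iff) (use that \<eta> R in \<open>auto simp: dist_commute\<close>)
  moreover have "min \<eta> (\<delta>/4) > 0" using \<eta>(1) R(3) by simp
  ultimately show ?thesis by blast
qed

text \<open>
  A connected set close to \<open>R\<close> cannot leave the clopen set of points joined to \<open>R\<close>.
\<close>

lemma joined_all:
  assumes "R \<noteq> {}" "R \<subseteq> N" "connected N" "y \<in> N"
  shows "joined R \<delta> m y"
proof -
  obtain x where x: "x \<in> R" using assms by blast
  then have "joined R \<delta> m x" using R refl unfolding joined_def by (intro bexI[of _ x]) auto
  moreover have "joined R \<delta> m x \<longleftrightarrow> joined R \<delta> m y"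
  proof (rule connected_locally_constant[OF assms(3)])
    show "\<exists>r>0. \<forall>y'\<in>N. dist y y' < r \<longrightarrow> (joined R \<delta> m y' \<longleftrightarrow> joined R \<delta> m y)" if "y \<in> N" for y
      using joined_locally_constant[of m] that by blast
  qed (use x assms in auto)
  ultimately show ?thesis by simp
qed

text \<open>
  Stability spreads from \<open>R\<close> to every connected set in a small neighbourhood.  This is what makes
  instability pass to the intersection of a chain of continua.
\<close>

lemma stable_neighbourhood:
  assumes "R \<noteq> {}" "R \<subseteq> N" "connected N"
  shows "stable N"
proof -
  have "E m y z" if yz: "y \<in> N" "z \<in> N" "dist y z < \<delta>/4" for y z m
  proof -
    obtain d where d: "d \<in> R" "dist y d < \<delta>/4" using near[OF yz(1)] by blast
    obtain e where e: "e \<in> R" "dist z e < \<delta>/4" using near[OF yz(2)] by blast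
    have "E m y d" "E m z e"
      using joinedD[OF joined_all[OF assms yz(1)] yz(1) d] joinedD[OF joined_all[OF assms yz(2)] yz(2) e] .
    have "dist d z < \<delta>/2" using dist_triangle[of d z y] d yz by (simp add: dist_commute)
    then have de: "dist d e < \<delta>" using dist_triangle[of d e z] e R(3) by simp
    have "E m y e" by (rule trans[of y d e]) (use d e de yz R stab \<open>E m y d\<close> in auto)
    moreover have "E m e z" using sym[of z e m] \<open>E m z e\<close> yz e R by auto
    moreover have "dist y e < \<delta>" using dist_triangle[of y e z] e yz R(3) by simp
    ultimately show ?thesis by (intro trans[of y e z]) (use e yz R in \<open>auto simp: dist_commute\<close>)
  qed
  moreover have "\<delta>/4 > 0" using R(3) by simp
  ultimately show ?thesis unfolding stable_def by (intro exI[of _ "\<delta>/4"] conjI ballI impI allI)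
qed

end

lemma stableE:
  assumes "stable R"
  obtains \<delta> where "\<delta> > 0" "\<delta> \<le> \<epsilon>" "\<And>y z m. \<lbrakk>y \<in> R; z \<in> R; dist y z < \<delta>\<rbrakk> \<Longrightarrow> E m y z"
proof -
  obtain \<delta> where \<delta>: "\<delta> > 0" "\<forall>y\<in>R. \<forall>z\<in>R. dist y z < \<delta> \<longrightarrow> (\<forall>m. E m y z)"
    using assms unfolding stable_def by (elim exE conjE)
  show ?thesis
  proof (rule that[of "min \<delta> \<epsilon>"])
    show "E m y z" if "y \<in> R" "z \<in> R" "dist y z < min \<delta> \<epsilon>" for y z m
      using \<delta>(2) that by simp
  qed (use \<delta>(1) eps in auto)
qed

lemma unstable_Inter_chain:
  assumes "\<C> \<noteq> {}" and C: "\<And>S. S \<in> \<C> \<Longrightarrow> compact S \<and> connected S \<and> S \<noteq> {} \<and> S \<subseteq> Z \<and> \<not> stable S"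
    and chain: "\<And>S T. S \<in> \<C> \<Longrightarrow> T \<in> \<C> \<Longrightarrow> S \<subseteq> T \<or> T \<subseteq> S"
  shows "compact (\<Inter>\<C>) \<and> connected (\<Inter>\<C>) \<and> \<Inter>\<C> \<noteq> {} \<and> \<Inter>\<C> \<subseteq> Z \<and> \<not> stable (\<Inter>\<C>)"
proof -
  have ne: "\<Inter>\<C> \<noteq> {}"
    using compact_chain_subset_open[OF assms(1) _ chain, of "{}"] C by blast
  have sub: "\<Inter>\<C> \<subseteq> Z" using assms by blast
  have "\<not> stable (\<Inter>\<C>)"
  proof
    assume "stable (\<Inter>\<C>)"
    then obtain \<delta> where \<delta>: "\<delta> > 0" "\<delta> \<le> \<epsilon>"
      "\<And>y z m. \<lbrakk>y \<in> \<Inter>\<C>; z \<in> \<Inter>\<C>; dist y z < \<delta>\<rbrakk> \<Longrightarrow> E m y z" by (rule stableE) (rule that)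
    have "\<exists>S\<in>\<C>. S \<subseteq> (\<Union>d\<in>\<Inter>\<C>. ball d (\<delta>/4))"
      by (rule compact_chain_subset_open[OF assms(1) _ chain]) (use C \<delta> in \<open>auto intro!: bexI\<close>)
    then obtain S where S: "S \<in> \<C>" "S \<subseteq> (\<Union>d\<in>\<Inter>\<C>. ball d (\<delta>/4))" by blast
    then have "\<exists>d\<in>\<Inter>\<C>. dist y d < \<delta>/4" if "y \<in> S" for y
      using that by (fastforce simp: dist_commute)
    then have "stable S"
      by (intro stable_neighbourhood[of "\<Inter>\<C>" S \<delta>]) (use \<delta> S C ne sub in auto)
    then show False using C S by blast
  qed
  moreover have "compact (\<Inter>\<C>)"
  proof -
    obtain S where S: "S \<in> \<C>" using assms(1) by blast
    have "closed (\<Inter>\<C>)" using C compact_imp_closed by (intro closed_Inter) blast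
    then have "compact (S \<inter> \<Inter>\<C>)" using C[OF S] by (intro compact_Int_closed) auto
    moreover have "S \<inter> \<Inter>\<C> = \<Inter>\<C>" using S by blast
    ultimately show ?thesis by simp
  qed
  moreover have "connected (\<Inter>\<C>)" 
    using connected_Inter_chain_compact[OF assms(1) _ _ chain] C by blast
  ultimately show ?thesis using ne sub by blast
qed

lemma exists_minimal_unstable:
  assumes "\<not> stable Z"
  obtains T where "compact T" "connected T" "T \<noteq> {}" "T \<subseteq> Z" "\<not> stable T"
    "\<And>R. \<lbrakk>compact R; connected R; R \<noteq> {}; R \<subseteq> T; R \<noteq> T\<rbrakk> \<Longrightarrow> stable R"
proof -
  define \<A> where "\<A> = {- S |S. compact S \<and> connected S \<and> S \<noteq> {} \<and> S \<subseteq> Z \<and> \<not> stable S}"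
  have "stable {}" unfolding stable_def by (intro exI[of _ 1]) simp
  then have "Z \<noteq> {}" using assms by metis
  have "\<exists>M\<in>\<A>. \<forall>X\<in>\<A>. M \<subseteq> X \<longrightarrow> X = M"
  proof (rule subset_Zorn_nonempty)
    show "\<A> \<noteq> {}" using assms compact_Z connected_Z \<open>Z \<noteq> {}\<close> by (auto simp: \<A>_def)
    fix \<C> assume C: "\<C> \<noteq> {}" "subset.chain \<A> \<C>"
    then have "\<C> \<subseteq> \<A>" and ch: "\<And>S T. S \<in> \<C> \<Longrightarrow> T \<in> \<C> \<Longrightarrow> S \<subseteq> T \<or> T \<subseteq> S"
      by (auto simp: subset.chain_def)
    have "\<Inter>(uminus ` \<C>) = - \<Union>\<C>" by auto
    moreover have "compact (\<Inter>(uminus ` \<C>)) \<and> connected (\<Inter>(uminus ` \<C>)) \<and> \<Inter>(uminus ` \<C>) \<noteq> {}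
      \<and> \<Inter>(uminus ` \<C>) \<subseteq> Z \<and> \<not> stable (\<Inter>(uminus ` \<C>))"
      by (rule unstable_Inter_chain) (use C(1) ch \<open>\<C> \<subseteq> \<A>\<close> in \<open>auto simp: \<A>_def subset_iff\<close>)
    ultimately show "\<Union>\<C> \<in> \<A>" unfolding \<A>_def by (intro CollectI exI[of _ "- \<Union>\<C>"]) auto
  qed
  then obtain M where M: "M \<in> \<A>" "\<And>X. X \<in> \<A> \<Longrightarrow> M \<subseteq> X \<Longrightarrow> X = M" by blast
  then obtain T where T: "M = - T" "compact T" "connected T" "T \<noteq> {}" "T \<subseteq> Z" "\<not> stable T"
    by (auto simp: \<A>_def)
  have "stable R" if R: "compact R" "connected R" "R \<noteq> {}" "R \<subseteq> T" "R \<noteq> T" for R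
  proof (rule ccontr)
    assume "\<not> stable R"
    then have "- R \<in> \<A>" using R T by (auto simp: \<A>_def)
    then show False using M(2)[of "- R"] R T by auto
  qed
  then show ?thesis using T that by blast
qed

text \<open>
  By minimality the part of \<open>T\<close> on which stability fails locally is contained in the union of proper
  stable subcontinua.  Near such a subcontinuum \<open>R\<close>, the level up to which a point is joined to \<open>R\<close> is
  a locally constant function wherever it is finite, and each value that it takes is taken on the
  boundary of a neighbourhood of \<open>R\<close>.  This leaves finitely many values.
\<close>

lemma no_minimal_unstable:
  assumes T: "compact T" "connected T" "T \<noteq> {}" "T \<subseteq> Z" "\<not> stable T"
    and min: "\<And>R. \<lbrakk>compact R; connected R; R \<noteq> {}; R \<subseteq> T; R \<noteq> T\<rbrakk> \<Longrightarrow> stable R"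
  shows False
proof -
  \<comment> \<open>\<open>ok y \<eta>\<close>: stability holds in the ball of radius \<open>\<eta>\<close> about \<open>y\<close>; \<open>D\<close> is the set of points without such a ball\<close>
  define ok where "ok y \<eta> \<longleftrightarrow> \<eta> > 0 \<and>
    (\<forall>z\<in>T. \<forall>w\<in>T. dist y z < \<eta> \<longrightarrow> dist y w < \<eta> \<longrightarrow> (\<forall>m. E m z w))" for y \<eta>
  define G where "G = {y. \<exists>\<eta>. ok y \<eta>}"
  have "open G" unfolding open_dist
  proof
    fix y assume "y \<in> G"
    then obtain \<eta> where \<eta>: "ok y \<eta>" by (auto simp: G_def)
    have "y' \<in> G" if "dist y' y < \<eta>/2" for y'
    proof -
      have "dist y z < \<eta>" if "dist y' z < \<eta>/2" for z
        using dist_triangle[of y z y'] that \<open>dist y' y < \<eta>/2\<close> by (simp add: dist_commute)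
      then have "ok y' (\<eta>/2)" using \<eta> by (auto simp: ok_def)
      then show ?thesis by (auto simp: G_def)
    qed
    then show "\<exists>e>0. \<forall>y'. dist y' y < e \<longrightarrow> y' \<in> G"
      using \<eta> unfolding ok_def by (intro exI[of _ "\<eta>/2"]) simp
  qed
  define D where "D = T - G"
  have "compact D" unfolding D_def using \<open>open G\<close> T by (simp add: compact_diff)
  have "D \<noteq> {}"
  proof
    assume "D = {}"
    have "T \<subseteq> \<Union>{ball y \<eta> |y \<eta>. ok y \<eta>}"
    proof
      fix y assume "y \<in> T"
      then obtain \<eta> where "ok y \<eta>" using \<open>D = {}\<close> unfolding D_def G_def by blast
      moreover from this have "y \<in> ball y \<eta>" unfolding ok_def by simp
      ultimately show "y \<in> \<Union>{ball y \<eta> |y \<eta>. ok y \<eta>}" by blast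
    qed
    then obtain e where e: "0 < e" "\<And>x. x \<in> T \<Longrightarrow> \<exists>G\<in>{ball y \<eta> |y \<eta>. ok y \<eta>}. ball x e \<subseteq> G"
    proof (rule Heine_Borel_lemma[OF T(1)])
      show "open A" if "A \<in> {ball y \<eta> |y \<eta>. ok y \<eta>}" for A using that by auto
    qed (rule that)
    have "stable T" unfolding stable_def
    proof (intro exI[of _ e] conjI ballI impI allI)
      fix y z m assume yz: "y \<in> T" "z \<in> T" "dist y z < e"
      obtain x \<eta> where x: "ok x \<eta>" "ball y e \<subseteq> ball x \<eta>" using e(2)[OF yz(1)] by blast
      have "y \<in> ball x \<eta>" "z \<in> ball x \<eta>" using subsetD[OF x(2)] yz(3) e(1) by simp_all
      then show "E m y z" using x yz by (auto simp: ok_def)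
    qed (use e in auto)
    then show False using T by blast
  qed
  then obtain x where x: "x \<in> D" by blast
  have "D \<noteq> T"
  proof -
    obtain y \<eta> where "y \<in> T" "ok y \<eta>"
      using fragment[OF compact_imp_closed[OF T(1)] T(4,3)] unfolding ok_def by blast
    then show ?thesis unfolding D_def G_def by blast
  qed
  define R where "R = quasi_component_of_set (top_of_set D) x"
  note Rq = quasi_component_compact[OF \<open>compact D\<close> x, folded R_def]
  have "stable R"
    by (rule min) (use Rq \<open>D \<noteq> T\<close> D_def in auto)
  then obtain \<delta> where \<delta>: "\<delta> > 0" "\<delta> \<le> \<epsilon>"
      "\<And>y z m. \<lbrakk>y \<in> R; z \<in> R; dist y z < \<delta>\<rbrakk> \<Longrightarrow> E m y z" by (rule stableE) (rule that)
  have "compact (D - (\<Union>d\<in>R. ball d (\<delta>/8)))" using \<open>compact D\<close> by (auto intro: compact_diff)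
  moreover have "(D - (\<Union>d\<in>R. ball d (\<delta>/8))) \<inter> R = {}" using \<delta>(1) by force
  \<comment> \<open>Since \<open>K\<close> is clopen in \<open>D\<close>, a thin neighbourhood \<open>N\<close> of \<open>K\<close> in \<open>T\<close> has a boundary \<open>B\<close> off \<open>D\<close>.\<close>
  ultimately obtain K where K: "R \<subseteq> K" "K \<inter> (D - (\<Union>d\<in>R. ball d (\<delta>/8))) = {}" "K \<subseteq> D"
    "compact K" "compact (D - K)" using Rq(5)[of "D - (\<Union>d\<in>R. ball d (\<delta>/8))"] by auto
  have Kne: "K \<noteq> {}" using K Rq by blast
  obtain \<eta>0 where \<eta>0: "\<eta>0 > 0" "\<And>a b. a \<in> K \<Longrightarrow> b \<in> D - K \<Longrightarrow> \<eta>0 \<le> dist a b"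
    using compact_closed_gap[OF K(4) compact_imp_closed[OF K(5)]] by blast
  define \<eta> where "\<eta> = min (\<eta>0/2) (\<delta>/8)"
  have \<eta>: "\<eta> > 0" "\<eta> \<le> \<delta>/8" "\<eta> < \<eta>0" using \<eta>0 \<delta> by (auto simp: \<eta>_def)
  define N where "N = {y\<in>T. infdist y K \<le> \<eta>}"
  define B where "B = {y\<in>T. infdist y K = \<eta>}"
  have near: "\<exists>d\<in>R. dist y d < \<delta>/4" if "y \<in> N" for y
  proof -
    obtain a where a: "a \<in> K" "infdist y K = dist y a"
      using compact_infdist_attained[OF K(4) Kne] by metis
    have "a \<in> (\<Union>d\<in>R. ball d (\<delta>/8))" using K(2,3) a(1) by blast
    then obtain d where d: "d \<in> R" "dist a d < \<delta>/8" by (auto simp: dist_commute)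
    have "dist y d < \<delta>/4" using dist_triangle[of y d a] a d that \<eta> by (simp add: N_def)
    then show ?thesis using d by blast
  qed
  have NT: "N \<subseteq> T" "N \<subseteq> Z" "R \<subseteq> Z" using T Rq D_def by (auto simp: N_def)
  note J = joinedD[OF NT(3,2) \<delta> near] joined_iff[OF NT(3,2) \<delta> near]
    joined_locally_constant[OF NT(3,2) \<delta> near]
  have BG: "B \<subseteq> G"
  proof
    fix y assume y: "y \<in> B"
    show "y \<in> G"
    proof (rule ccontr)
      assume "y \<notin> G"
      then have yD: "y \<in> D" using y by (auto simp: B_def D_def)
      show False
      proof (cases "y \<in> K")
        case True then show ?thesis using y \<eta> by (auto simp: B_def)
      next
        case False
        then have "\<eta>0 \<le> dist a y" if "a \<in> K" for a using \<eta>0 yD that by auto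
        moreover obtain a where a: "a \<in> K" "infdist y K = dist y a"
          using compact_infdist_attained[OF K(4) Kne] by metis
        ultimately show ?thesis using y \<eta> by (force simp: B_def dist_commute)
      qed
    qed
  qed
  have "B = T \<inter> (\<lambda>y. infdist y K) -` {\<eta>}" by (auto simp: B_def)
  then have "compact B" using T
    by (auto intro!: compact_Int_closed closed_vimage continuous_intros)
  \<comment> \<open>On \<open>B\<close> finitely many points decide whether a point is joined to \<open>R\<close>, and for each of them the answer
    depends on \<open>m\<close> monotonically.\<close>
  have "\<exists>m0. \<forall>z\<in>B. \<forall>m\<ge>m0. joined R \<delta> m z \<longleftrightarrow> joined R \<delta> m0 z"
  proof -
    have "\<forall>y\<in>B. \<exists>\<eta>. ok y \<eta>" using BG by (auto simp: G_def)
    then obtain h where h: "\<And>y. y \<in> B \<Longrightarrow> ok y (h y)" by metis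
    define r where "r y = min (h y) (\<delta>/4)" for y
    have r: "r y > 0" if "y \<in> B" for y using h[OF that] \<delta> by (auto simp: r_def ok_def)
    obtain C where C: "C \<subseteq> B" "finite C" "B \<subseteq> (\<Union>y\<in>C. ball y (r y))"
    proof (rule compactE_image[OF \<open>compact B\<close>, of B "\<lambda>y. ball y (r y)"])
      show "B \<subseteq> (\<Union>y\<in>B. ball y (r y))" using r by (meson UN_I centre_in_ball subsetI)
    qed (use that in auto)
    have same: "joined R \<delta> m z \<longleftrightarrow> joined R \<delta> m y" if "y \<in> C" "z \<in> B" "z \<in> ball y (r y)" for y z m
    proof -
      have "E m z y" using h[of y] that C by (auto simp: ok_def r_def B_def)
      then show ?thesis
        by (intro J(2)) (use that C in \<open>auto simp: B_def N_def r_def dist_commute\<close>)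
    qed
    have "\<exists>k. \<forall>m\<ge>k. joined R \<delta> m y \<longleftrightarrow> joined R \<delta> k y" if "y \<in> C" for y
    proof (cases "\<forall>m. joined R \<delta> m y")
      case False
      then obtain k where k: "\<not> joined R \<delta> k y" by blast
      have yZ: "y \<in> Z" using that C T by (auto simp: B_def)
      have "\<not> joined R \<delta> m y" if "m \<ge> k" for m
        using k that antimono[OF yZ] NT unfolding joined_def by blast
      then show ?thesis using k by blast
    qed auto
    then obtain k where k: "\<And>y m. y \<in> C \<Longrightarrow> m \<ge> k y \<Longrightarrow> joined R \<delta> m y \<longleftrightarrow> joined R \<delta> (k y) y" by metis
    define m0 where "m0 = Max (insert 0 (k ` C))"
    have m0: "k y \<le> m0" if "y \<in> C" for y using C that by (auto simp: m0_def)
    show ?thesis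
    proof (intro exI[of _ m0] ballI allI impI)
      fix z m assume z: "z \<in> B" "m0 \<le> m"
      then obtain y where y: "y \<in> C" "z \<in> ball y (r y)" using C by blast
      have "joined R \<delta> m y \<longleftrightarrow> joined R \<delta> m0 y" 
        using k[OF y(1), of m] k[OF y(1), of m0] m0[OF y(1)] z by linarith
      then show "joined R \<delta> m z \<longleftrightarrow> joined R \<delta> m0 z" using same y z by blast
    qed
  qed
  then obtain m0 where m0: "\<And>z m. z \<in> B \<Longrightarrow> m \<ge> m0 \<Longrightarrow> joined R \<delta> m z \<longleftrightarrow> joined R \<delta> m0 z" by blast
  have joinR: "joined R \<delta> m x" for m
    using Rq(1) NT refl \<delta> by (auto simp: joined_def intro!: bexI[of _ x])
  have xN: "x \<in> N" using K Rq(1) \<eta> x by (auto simp: N_def D_def)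
  \<comment> \<open>The points joined at level \<open>m0\<close> but not at level \<open>m\<close> form a clopen subset of \<open>T\<close> that misses \<open>x\<close>.\<close>
  have claim: "joined R \<delta> m y" if "m \<ge> m0" "y \<in> N" "joined R \<delta> m0 y" for m y
  proof -
    define Q where "Q z \<longleftrightarrow> z \<in> N \<and> joined R \<delta> m0 z \<and> \<not> joined R \<delta> m z" for z
    have "Q y \<longleftrightarrow> Q x"
    proof (rule connected_locally_constant[OF T(2)])
      fix z assume z: "z \<in> T"
      obtain r1 where r1: "r1 > 0" "\<forall>y\<in>N. \<forall>y'\<in>N. dist y y' < r1 \<longrightarrow> (joined R \<delta> m y' \<longleftrightarrow> joined R \<delta> m y)"
        using J(3)[of m] by blast
      obtain r2 where r2: "r2 > 0" "\<forall>y\<in>N. \<forall>y'\<in>N. dist y y' < r2 \<longrightarrow> (joined R \<delta> m0 y' \<longleftrightarrow> joined R \<delta> m0 y)"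
        using J(3)[of m0] by blast
      define r3 where "r3 = (if infdist z K = \<eta> then 1 else \<bar>infdist z K - \<eta>\<bar>)"
      have r3: "r3 > 0" by (auto simp: r3_def)
      show "\<exists>r>0. \<forall>y'\<in>T. dist z y' < r \<longrightarrow> (Q y' \<longleftrightarrow> Q z)"
      proof (intro exI[of _ "min r1 (min r2 r3)"] conjI ballI impI)
        fix y' assume y': "y' \<in> T" "dist z y' < min r1 (min r2 r3)"
        have d: "infdist y' K \<le> infdist z K + dist z y'" "infdist z K \<le> infdist y' K + dist z y'"
          using infdist_triangle[of y' K z] infdist_triangle[of z K y'] by (auto simp: dist_commute)
        consider "z \<in> N" "y' \<in> N" | "z \<notin> N" "y' \<notin> N" | "z \<in> B" "y' \<notin> N"
          using d y' z unfolding N_def B_def r3_def by (fastforce split: if_splits simp: abs_if)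
        then show "Q y' \<longleftrightarrow> Q z"
        proof cases
          case 1
          then have "joined R \<delta> m y' = joined R \<delta> m z" "joined R \<delta> m0 y' = joined R \<delta> m0 z"
            using r1(2) r2(2) y'(2) by (metis min_less_iff_conj)+
          then show ?thesis using 1 unfolding Q_def by metis
        next
          case 2
          then show ?thesis unfolding Q_def by metis
        next
          case 3
          then show ?thesis using m0[of z m] that(1) unfolding Q_def by metis
        qed
      qed (use r1 r2 r3 in auto)
    qed (use that NT xN in auto)
    then show ?thesis using joinR that by (auto simp: Q_def)
  qed
  obtain r2 where r2: "r2 > 0" "\<forall>y\<in>N. \<forall>y'\<in>N. dist y y' < r2 \<longrightarrow> (joined R \<delta> m0 y' \<longleftrightarrow> joined R \<delta> m0 y)"
    using J(3)[of m0] by blast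
  define \<eta>' where "\<eta>' = min \<eta> r2"
  have ex: "E m z x" if z: "z \<in> T" "dist x z < \<eta>'" for z m
  proof -
    have "infdist z K \<le> \<eta>" using infdist_le[of x K z] K Rq(1) z \<eta>'_def by (auto simp: dist_commute)
    then have zN: "z \<in> N" using z by (auto simp: N_def)
    moreover have "dist x z < r2" using z(2) unfolding \<eta>'_def by simp
    ultimately have "joined R \<delta> m0 z" using r2(2) xN joinR by blast
    then have "joined R \<delta> (max m m0) z" using claim zN by auto
    moreover have "dist z x < \<delta>/4" using z \<eta> \<delta> by (auto simp: \<eta>'_def dist_commute)
    ultimately have "E (max m m0) z x" using J(1) zN Rq(1) by blast
    then show ?thesis by (rule antimono[rotated 2]) (use z T x D_def in auto)
  qed
  have "ok x \<eta>'" unfolding ok_def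
  proof (intro conjI ballI impI allI)
    fix z w m assume zw: "z \<in> T" "w \<in> T" "dist x z < \<eta>'" "dist x w < \<eta>'"
    have *: "z \<in> Z" "w \<in> Z" "x \<in> Z" "dist x z < \<epsilon>" "dist x w < \<epsilon>" "dist z x < \<epsilon>" "dist w x < \<epsilon>"
      using zw x T D_def \<eta> \<delta> by (auto simp: \<eta>'_def dist_commute)
    have "E m x w" using sym[of w x m] ex zw * by blast
    then show "E m z w" using trans[of z x w m] ex zw * by blast
  qed (use \<eta> r2 in \<open>auto simp: \<eta>'_def\<close>)
  then show False using x by (auto simp: D_def G_def)
qed

theorem stable_Z: "stable Z"
  using exists_minimal_unstable no_minimal_unstable by metis

end

section \<open>Homotopies of paths in topological spaces\<close>

text \<open>
  The elementary identities for homotopy classes of paths (units, inverses) all follow from this one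
  fact: reparametrizations of a path with equal ends are homotopic, since the unit interval is convex.
\<close>

lemma homotopic_paths_compose_real:
  fixes u v :: "real \<Rightarrow> real"
  assumes "path p" "path_image p \<subseteq> S" "path u" "path v"
    "path_image u \<subseteq> {0..1}" "path_image v \<subseteq> {0..1}"
    "pathstart u = pathstart v" "pathfinish u = pathfinish v"
  shows "homotopic_paths S (p \<circ> u) (p \<circ> v)"
proof (rule homotopic_paths_continuous_image)
  show "homotopic_paths {0..1} u v"
  proof (rule homotopic_paths_linear)
    show "closed_segment (u t) (v t) \<subseteq> {0..1}" if "t \<in> {0..1}" for t
      using that assms(5,6) by (intro closed_segment_subset) (auto simp: path_image_def image_subset_iff)
  qed (use assms in auto)
qed (use assms in \<open>auto simp: path_def path_image_def\<close>)

lemma homotopic_paths_join_const: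
  assumes "path p" "path_image p \<subseteq> S" "c = pathfinish p"
  shows "homotopic_paths S (p +++ (\<lambda>_. c)) p"
proof -
  have "homotopic_paths S (p \<circ> (linepath 0 1 +++ linepath 1 1)) (p \<circ> linepath 0 1)"
    by (rule homotopic_paths_compose_real[OF assms(1,2)])
      (auto simp: path_image_join closed_segment_eq_real_ivl)
  moreover have "p \<circ> (linepath 0 1 +++ linepath 1 1) = p +++ (\<lambda>_. c)"
    using assms by (auto simp: joinpaths_def pathfinish_def linepath_def)
  ultimately show ?thesis by (simp add: o_def linepath_def)
qed

lemma homotopic_paths_const_join:
  assumes "path p" "path_image p \<subseteq> S" "c = pathstart p"
  shows "homotopic_paths S ((\<lambda>_. c) +++ p) p"
proof -
  have "homotopic_paths S (p \<circ> (linepath 0 0 +++ linepath 0 1)) (p \<circ> linepath 0 1)"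
    by (rule homotopic_paths_compose_real[OF assms(1,2)])
      (auto simp: path_image_join closed_segment_eq_real_ivl)
  moreover have "p \<circ> (linepath 0 0 +++ linepath 0 1) = (\<lambda>_. c) +++ p"
    using assms by (auto simp: joinpaths_def pathstart_def linepath_def)
  ultimately show ?thesis by (simp add: o_def linepath_def)
qed

lemma homotopic_paths_join_reversepath:
  assumes "path p" "path_image p \<subseteq> S" "c = pathstart p"
  shows "homotopic_paths S (p +++ reversepath p) (\<lambda>_. c)"
proof -
  have "homotopic_paths S (p \<circ> (linepath 0 1 +++ linepath 1 0)) (p \<circ> linepath 0 0)"
    by (rule homotopic_paths_compose_real[OF assms(1,2)])
      (auto simp: path_image_join closed_segment_eq_real_ivl)
  moreover have "p \<circ> (linepath 0 1 +++ linepath 1 0) = p +++ reversepath p"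
    by (auto simp: joinpaths_def reversepath_def linepath_def)
  ultimately show ?thesis using assms by (simp add: o_def pathstart_def linepath_def)
qed

lemma homotopic_paths_reversepath_join:
  assumes "path p" "path_image p \<subseteq> S" "c = pathfinish p"
  shows "homotopic_paths S (reversepath p +++ p) (\<lambda>_. c)"
  using homotopic_paths_join_reversepath[of "reversepath p" S c] assms by simp

text \<open>
  The image of the straight-line homotopy in the unit square between its left side and its three
  other sides.
\<close>

lemma homotopic_paths_square:
  fixes h :: "real \<times> real \<Rightarrow> 'b::topological_space"
  assumes "continuous_on ({0..1} \<times> {0..1}) h" "h ` ({0..1} \<times> {0..1}) \<subseteq> S"
  shows "homotopic_paths S (\<lambda>t. h (0, t))
    ((\<lambda>s. h (s, 0)) +++ ((\<lambda>t. h (1, t)) +++ reversepath (\<lambda>s. h (s, 1))))"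
proof -
  let ?p = "linepath (0::real,0::real) (0,1)"
  let ?q = "linepath (0::real,0::real) (1,0) +++ (linepath (1,0) (1,1) +++ linepath (1,1) (0,1))"
  have sub: "closed_segment a b \<subseteq> {0..1} \<times> {0..1}"
    if "a \<in> {0..1} \<times> {0..1}" "b \<in> {0..1} \<times> {0..1}" for a b :: "real \<times> real"
    using that by (intro closed_segment_subset convex_Times) auto
  have q: "path_image ?q \<subseteq> {0..1} \<times> {0..1}"
    by (simp add: path_image_join sub)
  have "homotopic_paths ({0..1} \<times> {0..1}) ?p ?q"
  proof (rule homotopic_paths_linear)
    show "closed_segment (?p t) (?q t) \<subseteq> {0..1} \<times> {0..1}" if "t \<in> {0..1}" for t
    proof (rule sub)
      show "?p t \<in> {0..1} \<times> {0..1}" using that by (auto simp: linepath_def)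
      show "?q t \<in> {0..1} \<times> {0..1}" using q that by (auto simp: path_image_def image_subset_iff)
    qed
  qed auto
  then have "homotopic_paths S (h \<circ> ?p) (h \<circ> ?q)"
    by (rule homotopic_paths_continuous_image) (use assms in auto)
  moreover have "h \<circ> ?p = (\<lambda>t. h (0, t))" by (auto simp: linepath_def)
  moreover have "h \<circ> ?q = (\<lambda>s. h (s, 0)) +++ ((\<lambda>t. h (1, t)) +++ reversepath (\<lambda>s. h (s, 1)))"
    by (auto simp: linepath_def joinpaths_def reversepath_def algebra_simps)
  ultimately show ?thesis by simp
qed

section \<open>Geodesics in CAT(0) spaces\<close>

text \<open>
  The vertices are \<open>(0, 0)\<close>, \<open>(a, 0)\<close> and \<open>(x, sqrt (c\<^sup>2 - x\<^sup>2))\<close>, where the law of cosines gives \<open>x\<close>;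
  the triangle inequality gives \<open>x\<^sup>2 \<le> c\<^sup>2\<close>.
\<close>

lemma comparison_triangle_exists: "\<exists>p' q' r'. comparison_triangle p q r p' q' r'"
proof -
  define a b c where abc: "a = dist p q" "b = dist q r" "c = dist r p"
  have tri: "a \<le> b + c" "b \<le> a + c" "c \<le> a + b" "a \<ge> 0" "b \<ge> 0" "c \<ge> 0"
    unfolding abc using dist_triangle[of p q r] dist_triangle[of q r p] dist_triangle[of r p q]
    by (auto simp: dist_commute)
  have d2: "dist u v = sqrt ((u$1 - v$1)\<^sup>2 + (u$2 - v$2)\<^sup>2)" for u v :: "real^2"
    by (simp add: dist_norm norm_vec_def L2_set_def sum_2)
  show ?thesis
  proof (cases "a = 0")
    case True
    then have "b = c" using tri by auto
    then show ?thesis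
      by (intro exI[of _ 0] exI[of _ 0] exI[of _ "vector [c, 0]"])
        (use True abc in \<open>auto simp: comparison_triangle_def d2 zero_index vector_2\<close>)
  next
    case False
    define x where "x = (a\<^sup>2 + c\<^sup>2 - b\<^sup>2) / (2 * a)"
    have ax: "2 * a * x = a\<^sup>2 + c\<^sup>2 - b\<^sup>2" using False by (simp add: x_def)
    have "(a - c)\<^sup>2 \<le> b\<^sup>2" using tri by (intro abs_le_square_iff[THEN iffD1]) auto
    moreover have "b\<^sup>2 \<le> (a + c)\<^sup>2" using tri by (intro power_mono) auto
    ultimately have "a * x \<le> a * c" "a * (-c) \<le> a * x" using ax
      by (auto simp: power2_eq_square algebra_simps)
    then have "x \<le> c" "-c \<le> x" using False tri
      by (auto intro: mult_left_le_imp_le[of a] simp: less_le)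
    then have "x\<^sup>2 \<le> c\<^sup>2" using abs_le_square_iff[of x c] tri by auto
    then have y: "(sqrt (c\<^sup>2 - x\<^sup>2))\<^sup>2 = c\<^sup>2 - x\<^sup>2" by simp
    have "(a - x)\<^sup>2 + (c\<^sup>2 - x\<^sup>2) = b\<^sup>2"
      using ax by (simp add: power2_eq_square algebra_simps)
    then show ?thesis
      by (intro exI[of _ 0] exI[of _ "vector [a, 0]"] exI[of _ "vector [x, sqrt (c\<^sup>2 - x\<^sup>2)]"])
        (use tri y in \<open>auto simp: comparison_triangle_def d2 zero_index vector_2 simp flip: abc\<close>)
  qed
qed

locale pointed_cat0 =
  fixes x0 :: "'a::metric_space"
  assumes CAT0: "CAT0 TYPE('a)" and proper: "proper_metric TYPE('a)"
begin

definition is_geod :: "'a \<Rightarrow> 'a \<Rightarrow> (real \<Rightarrow> 'a) \<Rightarrow> bool" where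
  "is_geod p q f \<longleftrightarrow> f 0 = p \<and> f 1 = q \<and>
     (\<forall>s\<in>{0..1}. \<forall>t\<in>{0..1}. dist (f s) (f t) = \<bar>s - t\<bar> * dist p q)"

definition geod :: "'a \<Rightarrow> 'a \<Rightarrow> real \<Rightarrow> 'a" where
  "geod p q = (SOME f. is_geod p q f)"

lemma is_geod_geod: "is_geod p q (geod p q)"
proof -
  obtain G where "geodesic_segment G p q" using CAT0 unfolding CAT0_def by blast
  then obtain c :: "real \<Rightarrow> 'a" and l where c: "0 \<le> l" "isometric_on {0..l} c" "c 0 = p" "c l = q"
    unfolding geodesic_segment_def by blast
  have iso: "dist (c s) (c t) = dist s t" if "s \<in> {0..l}" "t \<in> {0..l}" for s t
    using c(2) that unfolding isometric_on_def by blast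
  have l: "dist p q = l" using iso[of 0 l] c(1,3,4) by (simp add: dist_real_def)
  have "is_geod p q (\<lambda>t. c (t * l))" unfolding is_geod_def
  proof (intro conjI ballI)
    fix s t :: real assume st: "s \<in> {0..1}" "t \<in> {0..1}"
    have "u * l \<in> {0..l}" if "u \<in> {0..1}" for u using that c(1) by (simp add: mult_left_le_one_le)
    then have "dist (c (s * l)) (c (t * l)) = dist (s * l) (t * l)" using iso st by blast
    also have "\<dots> = \<bar>(s - t) * l\<bar>" by (simp add: dist_real_def left_diff_distrib)
    also have "\<dots> = \<bar>s - t\<bar> * dist p q" using c(1) l by (simp add: abs_mult)
    finally show "dist (c (s * l)) (c (t * l)) = \<bar>s - t\<bar> * dist p q" .
  qed (simp_all add: c(3,4))
  then show ?thesis unfolding geod_def by (metis someI)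
qed

lemma geod_0 [simp]: "geod p q 0 = p" and geod_1 [simp]: "geod p q 1 = q"
  using is_geod_geod[of p q] unfolding is_geod_def by blast+

lemma dist_geod: "s \<in> {0..1} \<Longrightarrow> t \<in> {0..1} \<Longrightarrow> dist (geod p q s) (geod p q t) = \<bar>s - t\<bar> * dist p q"
  using is_geod_geod[of p q] unfolding is_geod_def by blast

lemma dist_geod_start: "t \<in> {0..1} \<Longrightarrow> dist p (geod p q t) = t * dist p q"
  using dist_geod[of 0 t p q] by simp

lemma dist_geod_end: "t \<in> {0..1} \<Longrightarrow> dist q (geod p q t) = (1 - t) * dist p q"
  using dist_geod[of 1 t p q] by simp

lemma geodesic_segment_geod:
  "geodesic_segment (geod p q ` {0..1}) p q" "geodesic_segment (geod p q ` {0..1}) q p"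
proof -
  let ?l = "dist p q"
  have "geodesic_segment (geod p q ` {0..1}) p q \<and> geodesic_segment (geod p q ` {0..1}) q p"
  proof (cases "?l = 0")
    case True
    then have pq: "p = q" by simp
    have "geod p q t = p" if "t \<in> {0..1}" for t using dist_geod_start[OF that, of p q] pq by simp
    then have "geod p q ` {0..1} = (\<lambda>_. p) ` {0..1::real}" by (rule image_cong[OF HOL.refl])
    then have "geod p q ` {0..1} = {p}" by (simp only: image_constant_conv) simp
    then show ?thesis unfolding geodesic_segment_def pq
      by (auto simp: isometric_on_def intro!: exI[of _ "\<lambda>_. q"] exI[of _ 0])
  next
    case False
    then have l: "?l > 0" by simp
    have im: "(\<lambda>t. t / ?l) ` {0..?l} = {0..1}"
    proof (intro equalityI subsetI)
      fix u :: real assume "u \<in> {0..1}"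
      then have "u = (u * ?l) / ?l" "u * ?l \<in> {0..?l}" using l by (auto simp: mult_left_le_one_le)
      then show "u \<in> (\<lambda>t. t / ?l) ` {0..?l}" by (rule image_eqI)
    qed (use l in auto)
    have im': "(\<lambda>t. 1 - t / ?l) ` {0..?l} = {0..1}"
    proof (intro equalityI subsetI)
      fix u :: real assume "u \<in> {0..1}"
      then have "u = 1 - ((1 - u) * ?l) / ?l" "(1 - u) * ?l \<in> {0..?l}" using l by (auto simp: mult_left_le_one_le)
      then show "u \<in> (\<lambda>t. 1 - t / ?l) ` {0..?l}" by (rule image_eqI)
    qed (use l in auto)
    have "isometric_on {0..?l} (\<lambda>t. geod p q (t / ?l))"
      using l by (auto simp: isometric_on_def dist_geod dist_real_def simp flip: diff_divide_distrib)
    moreover have "isometric_on {0..?l} (\<lambda>t. geod p q (1 - t / ?l))"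
      using l by (auto simp: isometric_on_def dist_geod dist_real_def abs_minus_commute
          simp flip: diff_divide_distrib)
    moreover have "geod p q ` {0..1} = (\<lambda>t. geod p q (t / ?l)) ` {0..?l}"
      using im by (metis image_image)
    moreover have "geod p q ` {0..1} = (\<lambda>t. geod p q (1 - t / ?l)) ` {0..?l}"
      using im' by (metis image_image)
    ultimately show ?thesis using l unfolding geodesic_segment_def
      by (intro conjI exI[of _ "\<lambda>t. geod p q (t / ?l)"] exI[of _ "\<lambda>t. geod p q (1 - t / ?l)"] exI[of _ ?l]) auto
  qed
  then show "geodesic_segment (geod p q ` {0..1}) p q" "geodesic_segment (geod p q ` {0..1}) q p" by auto
qed

lemma CAT0_comparison:
  assumes "geodesic_segment A p q" "geodesic_segment B q r" "geodesic_segment C r p"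
    "comparison_triangle p q r p' q' r'"
    "comparison_point A p p' q' x x' \<or> comparison_point B q q' r' x x' \<or> comparison_point C r r' p' x x'"
    "comparison_point A p p' q' y y' \<or> comparison_point B q q' r' y y' \<or> comparison_point C r r' p' y y'"
  shows "dist x (y::'a) \<le> dist x' y'"
  using CAT0 assms unfolding CAT0_def Let_def by blast

lemma affine_dist:
  fixes p' q' :: "real^2"
  assumes "t \<in> {0..1}"
  shows "dist p' (p' + t *\<^sub>R (q' - p')) = t * dist p' q'"
    "dist q' (p' + t *\<^sub>R (q' - p')) = (1 - t) * dist p' q'"
    "p' + t *\<^sub>R (q' - p') \<in> closed_segment p' q'"
proof -
  have "q' - (p' + t *\<^sub>R (q' - p')) = (1 - t) *\<^sub>R (q' - p')" by (simp add: algebra_simps)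
  then show "dist q' (p' + t *\<^sub>R (q' - p')) = (1 - t) * dist p' q'"
    using assms by (simp add: dist_norm norm_minus_commute)
  show "dist p' (p' + t *\<^sub>R (q' - p')) = t * dist p' q'"
    using assms by (simp add: dist_norm norm_minus_commute)
  show "p' + t *\<^sub>R (q' - p') \<in> closed_segment p' q'"
    using assms by (auto simp: in_segment algebra_simps intro!: exI[of _ t])
qed

text \<open>
  The comparison triangle, applied to two points at the same proportion on two sides.
\<close>

lemma geod_common_start:
  assumes "t \<in> {0..1}"
  shows "dist (geod p q t) (geod p r t) \<le> t * dist q r"
proof -
  obtain p' q' r' where c: "comparison_triangle p q r p' q' r'" using comparison_triangle_exists by blast
  then have d: "dist p' q' = dist p q" "dist q' r' = dist q r" "dist r' p' = dist r p"
    by (auto simp: comparison_triangle_def)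
  let ?x = "p' + t *\<^sub>R (q' - p')" and ?y = "p' + t *\<^sub>R (r' - p')"
  have x: "comparison_point (geod p q ` {0..1}) p p' q' (geod p q t) ?x"
    unfolding comparison_point_def using affine_dist[OF assms, of p' q'] d assms dist_geod_start by auto
  have y: "comparison_point (geod p r ` {0..1}) r r' p' (geod p r t) ?y"
  proof -
    have "dist r' ?y = dist r (geod p r t)"
      using affine_dist(2)[OF assms, where p' = p' and q' = r'] d(3) dist_geod_end[OF assms, of r p]
      by (metis dist_commute)
    moreover have "?y \<in> closed_segment r' p'"
      using affine_dist(3)[OF assms, of p' r'] by (simp only: closed_segment_commute)
    ultimately show ?thesis unfolding comparison_point_def using assms by auto
  qed
  have "dist (geod p q t) (geod p r t) \<le> dist ?x ?y"
    by (rule CAT0_comparison[OF geodesic_segment_geod(1) geodesic_segment_geod(1)[of q r] geodesic_segment_geod(2) c])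
      (use x y in blast)+
  also have "\<dots> = t * dist q' r'"
    using assms by (simp add: dist_norm flip: scaleR_diff_right)
  finally show ?thesis using d by simp
qed

text \<open>
  The comparison triangle of \<open>p\<close>, \<open>q\<close>, \<open>z\<close> is degenerate, so that \<open>z\<close> and the point on the geodesic from
  \<open>p\<close> to \<open>q\<close> have the same comparison point.
\<close>

lemma geod_unique:
  assumes "t \<in> {0..1}" "dist p z = t * dist p q" "dist z q = (1 - t) * dist p q"
  shows "z = geod p q t"
proof -
  obtain p' q' r' where c: "comparison_triangle p q q p' q' r'" using comparison_triangle_exists by blast
  define z' where "z' = p' + t *\<^sub>R (q' - p')"
  have d: "dist p' q' = dist p q" using c unfolding comparison_triangle_def by blast
  have z': "dist p' z' = t * dist p q" "dist q' z' = (1 - t) * dist p q" "z' \<in> closed_segment p' q'"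
    using affine_dist[OF assms(1), where p' = p' and q' = q'] unfolding d z'_def[symmetric] by blast+
  have c': "comparison_triangle p q z p' q' z'"
    using z' assms d by (simp add: comparison_triangle_def dist_commute)
  have x: "comparison_point (geod p q ` {0..1}) p p' q' (geod p q t) z'"
    unfolding comparison_point_def using z' assms dist_geod_start by auto
  have y: "comparison_point (geod q z ` {0..1}) q q' z' z z'"
    unfolding comparison_point_def using z' assms
    by (auto simp: dist_commute image_iff intro!: bexI[of _ 1])
  have "dist (geod p q t) z \<le> dist z' z'"
    by (rule CAT0_comparison[OF geodesic_segment_geod(1) geodesic_segment_geod(1) geodesic_segment_geod(1) c'])
      (use x y in blast)+
  then show ?thesis by simp
qed

lemma geod_reverse: "t \<in> {0..1} \<Longrightarrow> geod q p t = geod p q (1 - t)"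
  by (rule geod_unique[symmetric])
    (use dist_geod_end[of "1 - t" q p] dist_geod_start[of "1 - t" p q] in \<open>auto simp: dist_commute\<close>)

text \<open>
  A quadrilateral is cut into two triangles by the geodesic from \<open>p\<close> to \<open>q'\<close>.
\<close>

lemma geod_convex:
  assumes "t \<in> {0..1}"
  shows "dist (geod p q t) (geod p' q' t) \<le> (1 - t) * dist p p' + t * dist q q'"
proof -
  have "dist (geod p q' t) (geod p' q' t) \<le> (1 - t) * dist p p'"
    using geod_common_start[of "1 - t" q' p p'] geod_reverse[of "1 - t" q'] assms by simp
  then show ?thesis
    using geod_common_start[OF assms, of p q q'] dist_triangle[of "geod p q t" "geod p' q' t" "geod p q' t"]
    by linarith
qed

lemma geod_same [simp]: "t \<in> {0..1} \<Longrightarrow> geod z z t = z"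
  using dist_geod_start[of t z z] by simp

lemma geod_ball:
  assumes "t \<in> {0..1}" "a \<in> ball z R" "b \<in> ball z R"
  shows "geod a b t \<in> ball z R"
proof -
  have "dist (geod a b t) z \<le> (1 - t) * dist a z + t * dist b z"
    using geod_convex[OF assms(1), of a b z z] assms by simp
  also have "\<dots> < R"
    by (rule convex_bound_lt) (use assms in \<open>auto simp: dist_commute\<close>)
  finally show ?thesis by (simp add: dist_commute)
qed

lemma continuous_on_geod [continuous_intros]:
  assumes "continuous_on S f" "continuous_on S g" "continuous_on S h" "\<And>x. x \<in> S \<Longrightarrow> h x \<in> {0..1}"
  shows "continuous_on S (\<lambda>x. geod (f x) (g x) (h x))"
  unfolding continuous_on_def
proof
  fix a assume a: "a \<in> S"
  let ?b = "\<lambda>x. dist (f x) (f a) + dist (g x) (g a) + \<bar>h x - h a\<bar> * dist (f a) (g a)"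
  have f: "(f \<longlongrightarrow> f a) (at a within S)" "(g \<longlongrightarrow> g a) (at a within S)" "(h \<longlongrightarrow> h a) (at a within S)"
    using assms a by (auto simp: continuous_on_def)
  have le: "dist (geod (f x) (g x) (h x)) (geod (f a) (g a) (h a)) \<le> ?b x" if "x \<in> S" for x
  proof -
    have "dist (geod (f x) (g x) (h x)) (geod (f a) (g a) (h x)) \<le> (1 - h x) * dist (f x) (f a) + h x * dist (g x) (g a)"
      using geod_convex assms(4)[OF that] by blast
    also have "\<dots> \<le> 1 * dist (f x) (f a) + 1 * dist (g x) (g a)"
      using assms(4)[OF that] by (intro add_mono mult_right_mono) auto
    finally show ?thesis
      using dist_geod[OF assms(4)[OF that] assms(4)[OF a], of "f a" "g a"]
        dist_triangle[of "geod (f x) (g x) (h x)" "geod (f a) (g a) (h a)" "geod (f a) (g a) (h x)"] by linarith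
  qed
  have "(?b \<longlongrightarrow> dist (f a) (f a) + dist (g a) (g a) + \<bar>h a - h a\<bar> * dist (f a) (g a)) (at a within S)"
    by (intro tendsto_intros f)
  then have lim: "(?b \<longlongrightarrow> 0) (at a within S)" by simp
  have "\<forall>\<^sub>F x in at a within S. dist (geod (f x) (g x) (h x)) (geod (f a) (g a) (h a)) \<le> ?b x"
    unfolding eventually_at_filter by (rule always_eventually) (use le in blast)
  then show "((\<lambda>x. geod (f x) (g x) (h x)) \<longlongrightarrow> geod (f a) (g a) (h a)) (at a within S)"
    unfolding tendsto_dist_iff[of "\<lambda>x. geod (f x) (g x) (h x)"]
    by (rule tendsto_sandwich[OF always_eventually[OF allI[OF zero_le_dist]] _ tendsto_const lim])
qed

text \<open>
  Balls are convex, so the geodesics between corresponding points of \<open>P\<close> and \<open>Q\<close> stay in the balls.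
  This is the source of all short homotopies below.
\<close>

lemma homotopic_paths_close:
  fixes P Q :: "real \<Rightarrow> 'a"
  assumes "path P" "path Q" "pathstart P = pathstart Q" "pathfinish P = pathfinish Q"
    and "\<And>t. t \<in> {0..1} \<Longrightarrow> \<exists>z. P t \<in> ball z R \<and> Q t \<in> ball z R \<and> ball z R \<subseteq> S"
  shows "homotopic_paths S P Q"
  unfolding homotopic_paths
proof (intro exI conjI ballI)
  let ?h = "\<lambda>x. geod (P (snd x)) (Q (snd x)) (fst x)"
  have c: "continuous_on ({0..1} \<times> {0..1}) (\<lambda>x::real\<times>real. P (snd x))"
    "continuous_on ({0..1} \<times> {0..1}) (\<lambda>x::real\<times>real. Q (snd x))"
    using assms(1,2) unfolding path_def
    by (auto intro: continuous_on_compose2[OF _ continuous_on_snd[OF continuous_on_id]])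
  show "continuous_on ({0..1} \<times> {0..1}) ?h"
    by (intro continuous_intros c) auto
  show "?h \<in> {0..1} \<times> {0..1} \<rightarrow> S"
  proof
    fix x :: "real \<times> real" assume x: "x \<in> {0..1} \<times> {0..1}"
    then obtain z where "P (snd x) \<in> ball z R" "Q (snd x) \<in> ball z R" "ball z R \<subseteq> S"
      using assms(5)[of "snd x"] by auto
    then have "?h x \<in> ball z R" using x by (intro geod_ball) auto
    then show "?h x \<in> S" using \<open>ball z R \<subseteq> S\<close> by (rule rev_subsetD)
  qed
  show "pathstart (?h \<circ> Pair t) = pathstart P" if "t \<in> {0..1}" for t
    using assms(3) that by (simp add: pathstart_def)
  show "pathfinish (?h \<circ> Pair t) = pathfinish P" if "t \<in> {0..1}" for t
    using assms(4) that by (simp add: pathfinish_def)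
qed auto

lemma path_geod: "path (geod p q)"
  unfolding path_def by (intro continuous_intros) auto

lemma geod_ends [simp]: "pathstart (geod p q) = p" "pathfinish (geod p q) = q"
  by (auto simp: pathstart_def pathfinish_def)

definition rad :: "'a \<Rightarrow> real" where "rad w = dist x0 w"

text \<open>
  The radial projection to the ball of radius \<open>s\<close> about \<open>x0\<close>.  For \<open>w = x0\<close> the quotient is
  \<open>s / 0 = 0\<close>, which gives the right value \<open>x0\<close>.
\<close>

definition proj :: "real \<Rightarrow> 'a \<Rightarrow> 'a" where "proj s w = geod x0 w (min 1 (s / rad w))"

lemma rad_nonneg [simp]: "rad w \<ge> 0" by (simp add: rad_def)

lemma rad_diff: "\<bar>rad w - rad v\<bar> \<le> dist w v"
  unfolding rad_def using abs_dist_diff_le[of w x0 v] by (simp add: dist_commute) 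

lemma proj_frac: "s \<ge> 0 \<Longrightarrow> min 1 (s / rad w) \<in> {0..1}" "s \<ge> 0 \<Longrightarrow> min 1 (s / rad w) * rad w = min s (rad w)"
proof -
  assume s: "s \<ge> 0"
  show "min 1 (s / rad w) \<in> {0..1}" using s by auto
  show "min 1 (s / rad w) * rad w = min s (rad w)"
  proof (cases "rad w = 0")
    case False
    then have "rad w > 0" using rad_nonneg[of w] by linarith
    then show ?thesis by (auto simp: min_def field_simps)
  qed (use s in auto)
qed

lemma rad_proj: "s \<ge> 0 \<Longrightarrow> rad (proj s w) = min s (rad w)"
  unfolding proj_def using dist_geod_start[OF proj_frac(1)] proj_frac(2) unfolding rad_def by metis

lemma dist_proj: "s \<ge> 0 \<Longrightarrow> t \<ge> 0 \<Longrightarrow> dist (proj s w) (proj t w) = \<bar>min s (rad w) - min t (rad w)\<bar>"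
proof -
  assume st: "s \<ge> 0" "t \<ge> 0"
  have "dist (proj s w) (proj t w) = \<bar>min 1 (s / rad w) - min 1 (t / rad w)\<bar> * rad w"
    unfolding proj_def rad_def[symmetric] using dist_geod[OF proj_frac(1)[OF st(1)] proj_frac(1)[OF st(2)]] rad_def by simp
  also have "\<dots> = \<bar>(min 1 (s / rad w) - min 1 (t / rad w)) * rad w\<bar>" by (simp add: abs_mult)
  also have "\<dots> = \<bar>min s (rad w) - min t (rad w)\<bar>"
    using proj_frac(2)[OF st(1), of w] proj_frac(2)[OF st(2), of w] by (simp add: left_diff_distrib)
  finally show ?thesis .
qed

lemma proj_id: "rad w \<le> s \<Longrightarrow> proj s w = w"
proof (cases "rad w = 0")
  case True
  then have "proj s w = x0" by (simp add: proj_def)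
  moreover have "w = x0" using True by (simp add: rad_def)
  ultimately show ?thesis by simp
next
  case False
  assume "rad w \<le> s"
  moreover have "rad w > 0" using False rad_nonneg[of w] by linarith
  ultimately have "min 1 (s / rad w) = 1" by (simp add: min_def field_simps)
  then show ?thesis by (simp add: proj_def)
qed

lemma dist_proj_self: "s \<ge> 0 \<Longrightarrow> dist (proj s w) w = rad w - min s (rad w)"
  using dist_proj[of s "rad w" w] proj_id[of w "rad w"] by simp

lemma proj_unique:
  assumes "s \<ge> 0" "rad z = min s (rad w)" "dist z w \<le> rad w - min s (rad w)"
  shows "z = proj s w"
proof -
  have "dist z w = rad w - min s (rad w)" using assms rad_diff[of w z] by (simp add: dist_commute)
  then show ?thesis unfolding proj_def
    by (intro geod_unique) (use assms proj_frac[OF assms(1), of w] in \<open>auto simp: left_diff_distrib simp flip: rad_def\<close>)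
qed

lemma proj_proj:
  assumes "s \<ge> 0" "t \<ge> 0"
  shows "proj s (proj t w) = proj (min s t) w"
proof (rule proj_unique)
  show "rad (proj s (proj t w)) = min (min s t) (rad w)" using assms by (simp add: rad_proj)
  show "dist (proj s (proj t w)) w \<le> rad w - min (min s t) (rad w)"
    using dist_triangle[of "proj s (proj t w)" w "proj t w"] dist_proj_self[OF assms(1), of "proj t w"]
      dist_proj_self[OF assms(2), of w] assms rad_proj[of t w] by simp
qed (use assms in auto)

text \<open>
  If both points lie outside the ball, the farther one is first moved in to the radius of the nearer
  one, which costs at most their distance, and then convexity applies.
\<close>

lemma proj_Lipschitz:
  assumes "s \<ge> 0"
  shows "dist (proj s w) (proj s v) \<le> 2 * dist w v"
proof -
  have *: "dist (proj s w) (proj s v) \<le> 2 * dist w v" if le: "rad v \<le> rad w" for v w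
  proof -
    have d: "rad w - rad v \<le> dist w v" using rad_diff[of w v] by simp
    consider "rad w \<le> s" | "rad v \<le> s" "s < rad w" | "s < rad v" using le by linarith
    then show ?thesis
    proof cases
      case 1 then show ?thesis using le by (simp add: proj_id)
    next
      case 2
      then have "dist (proj s w) w = rad w - s" using dist_proj_self[OF assms, of w] by simp
      then show ?thesis using 2 d dist_triangle[of "proj s w" v w] by (simp add: proj_id)
    next
      case 3
      define w' where "w' = proj (rad v) w"
      have r: "rad w' = rad v" "rad v > 0" using le 3 assms by (auto simp: w'_def rad_proj)
      have "proj s w = proj s w'" using proj_proj[of s "rad v" w] 3 assms by (simp add: w'_def)
      moreover have "dist (proj s w') (proj s v) \<le> min 1 (s / rad v) * dist w' v"
        unfolding proj_def r using geod_common_start proj_frac(1)[OF assms] by blast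
      moreover have "min 1 (s / rad v) * dist w' v \<le> 1 * dist w' v" by (intro mult_right_mono) auto
      moreover have "dist w' w = rad w - rad v"
        using dist_proj_self[of "rad v" w] le by (simp add: w'_def)
      ultimately show ?thesis using d dist_triangle[of w' v w] by (simp only: mult_1)
    qed
  qed
  show ?thesis
    using *[of v w] *[of w v] by (cases "rad v \<le> rad w") (auto simp: dist_commute)
qed

lemma continuous_on_proj [continuous_intros]:
  assumes "continuous_on S f" "continuous_on S g" "\<And>x. x \<in> S \<Longrightarrow> f x \<ge> 0"
  shows "continuous_on S (\<lambda>x. proj (f x) (g x))"
  unfolding continuous_on_def
proof
  fix a assume a: "a \<in> S"
  have f: "(f \<longlongrightarrow> f a) (at a within S)" "(g \<longlongrightarrow> g a) (at a within S)"
    using assms a by (auto simp: continuous_on_def)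
  let ?b = "\<lambda>x. \<bar>f x - f a\<bar> + 2 * dist (g x) (g a)"
  have le: "dist (proj (f x) (g x)) (proj (f a) (g a)) \<le> ?b x" if "x \<in> S" for x
    using proj_Lipschitz[OF assms(3)[OF a], of "g x" "g a"] dist_proj[OF assms(3)[OF that] assms(3)[OF a], of "g x"]
      dist_triangle[of "proj (f x) (g x)" "proj (f a) (g a)" "proj (f a) (g x)"]
    by (auto simp: min_def abs_if split: if_splits)
  have "(?b \<longlongrightarrow> \<bar>f a - f a\<bar> + 2 * dist (g a) (g a)) (at a within S)" by (intro tendsto_intros f)
  then have lim: "(?b \<longlongrightarrow> 0) (at a within S)" by simp
  have "\<forall>\<^sub>F x in at a within S. dist (proj (f x) (g x)) (proj (f a) (g a)) \<le> ?b x"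
    unfolding eventually_at_filter by (rule always_eventually) (use le in blast)
  then show "((\<lambda>x. proj (f x) (g x)) \<longlongrightarrow> proj (f a) (g a)) (at a within S)"
    unfolding tendsto_dist_iff[of "\<lambda>x. proj (f x) (g x)"]
    by (rule tendsto_sandwich[OF always_eventually[OF allI[OF zero_le_dist]] _ tendsto_const lim])
qed

lemma continuous_on_rad [continuous_intros]: "continuous_on S f \<Longrightarrow> continuous_on S (\<lambda>x. rad (f x))"
  unfolding rad_def by (intro continuous_intros)

definition far :: "real \<Rightarrow> 'a set" where "far s = {w. s < rad w}"

lemma mem_far: "w \<in> far s \<longleftrightarrow> s < rad w" by (simp add: far_def)

lemma far_mono: "s \<le> t \<Longrightarrow> far t \<subseteq> far s" by (auto simp: far_def)

lemma open_far: "open (far s)"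
proof -
  have "far s = - cball x0 s" by (auto simp: far_def rad_def)
  then show ?thesis by (simp add: open_Compl)
qed

lemma ball_subset_far: "n \<le> rad z \<Longrightarrow> ball z 1 \<subseteq> far (n - 1)"
proof
  fix w assume "n \<le> rad z" "w \<in> ball z 1"
  then show "w \<in> far (n - 1)" using rad_diff[of z w] by (auto simp: far_def)
qed

lemma path_proj: "path p \<Longrightarrow> s \<ge> 0 \<Longrightarrow> path (proj s \<circ> p)"
  unfolding path_def comp_def by (intro continuous_intros) auto

text \<open>
  Balls are path-connected through geodesics from their centres.
\<close>

lemma connected_path_in_open:
  assumes "open S" "connected C" "C \<subseteq> S" "a \<in> C" "b \<in> C"
  shows "path_component S a (b::'a)"
proof (rule connected_equivalence_relation[OF assms(2,4,5)])
  fix x assume x: "x \<in> C"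
  then obtain e where e: "e > 0" "ball x e \<subseteq> S" using assms(1,3) open_contains_ball by blast
  show "\<exists>T. openin (top_of_set C) T \<and> x \<in> T \<and> (\<forall>y\<in>T. path_component S x y)"
  proof (intro exI conjI ballI)
    show "openin (top_of_set C) (C \<inter> ball x e)" by (simp add: openin_open_Int)
    show "x \<in> C \<inter> ball x e" using x e by simp
    fix y assume y: "y \<in> C \<inter> ball x e"
    have "geod x y t \<in> ball x e" if "t \<in> {0..1}" for t
      by (rule geod_ball[OF that]) (use y e(1) in auto)
    then have "path_image (geod x y) \<subseteq> S" unfolding path_image_def using e(2) by blast
    then show "path_component S x y" unfolding path_component_def
      by (intro exI[of _ "geod x y"]) (simp add: path_geod)
  qed
qed (use path_component_sym path_component_trans in blast)+

end

section \<open>The visual boundary\<close>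

lemma dist_fun_component:
  fixes x y :: "nat \<Rightarrow> 'b::metric_space"
  shows "(1/2) ^ to_nat i * min (dist (x i) (y i)) 1 \<le> dist x y"
proof -
  let ?f = "\<lambda>n. (1/2) ^ n * min (dist (x (from_nat n)) (y (from_nat n))) 1"
  have "summable ?f"
    by (rule summable_comparison_test'[of "\<lambda>n. (1/2)^n"]) (auto simp: summable_geometric_iff)
  then have "sum ?f {to_nat i} \<le> suminf ?f" by (rule sum_le_suminf) auto
  then show ?thesis by (simp add: dist_fun_def)
qed

lemma dist_fun_imp_component:
  fixes i :: nat
  assumes "e > 0"
  shows "\<exists>\<delta>>0. \<forall>x y::nat \<Rightarrow> 'b::metric_space. dist x y < \<delta> \<longrightarrow> dist (x i) (y i) < e"
proof (intro exI conjI allI impI)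
  let ?\<delta> = "(1/2) ^ to_nat i * min e 1 :: real"
  show "?\<delta> > 0" using assms by simp
  fix x y :: "nat \<Rightarrow> 'b" assume "dist x y < ?\<delta>"
  then have "(1/2) ^ to_nat i * min (dist (x i) (y i)) 1 < ?\<delta>"
    using dist_fun_component[of i x y] by linarith
  then have "min (dist (x i) (y i)) 1 < min e 1" by simp
  then show "dist (x i) (y i) < e" by linarith
qed

lemma dist_fun_small:
  assumes "\<delta> > 0"
  shows "\<exists>k. \<forall>x y::nat \<Rightarrow> 'b::metric_space. (\<forall>i\<le>k. dist (x i) (y i) < \<delta>/4) \<longrightarrow> dist x y < \<delta>"
proof -
  obtain N where N: "(1/2::real) ^ N < \<delta>/2"
    using real_arch_pow_inv[of "\<delta>/2" "1/2"] assms by auto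
  define k :: nat where "k = Max (from_nat ` {..N})"
  have k: "(from_nat n::nat) \<le> k" if "n \<le> N" for n using that unfolding k_def by (intro Max_ge) auto
  have "dist x y < \<delta>" if xy: "\<forall>i\<le>k. dist (x i) (y i) < \<delta>/4" for x y :: "nat \<Rightarrow> 'b"
  proof -
    have "Max {dist (x (from_nat n)) (y (from_nat n)) |n. n \<le> N} < \<delta>/4"
      using xy k by (subst Max_less_iff) auto
    then show ?thesis using dist_fun_le_dist_first_terms[of x y N] N by linarith
  qed
  then show ?thesis by blast
qed

context pointed_cat0
begin

text \<open>
  A geodesic ray from \<open>x0\<close> is determined by its values at the natural numbers.  Recording these
  values makes the visual boundary a subset of a countable product of metric spaces, which
  carries a metric for the product topology.
\<close>

definition bd :: "(nat \<Rightarrow> 'a) set" where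
  "bd = {y. y 0 = x0 \<and> (\<forall>i j. dist (y i) (y j) = \<bar>real i - real j\<bar>)}"

lemma bd_dist: "y \<in> bd \<Longrightarrow> dist (y i) (y j) = \<bar>real i - real j\<bar>"
  unfolding bd_def by blast

lemma bd_rad [simp]: "y \<in> bd \<Longrightarrow> rad (y i) = real i"
  using bd_dist[of y 0 i] unfolding bd_def rad_def by simp

lemma bd_proj: "y \<in> bd \<Longrightarrow> i \<le> j \<Longrightarrow> proj (real i) (y j) = y i"
  by (rule proj_unique[symmetric]) (simp_all add: bd_dist)

lemma bd_dist_mono: "y \<in> bd \<Longrightarrow> z \<in> bd \<Longrightarrow> i \<le> j \<Longrightarrow> dist (y i) (z i) \<le> 2 * dist (y j) (z j)"
  using proj_Lipschitz[of "real i" "y j" "z j"] by (simp add: bd_proj)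

text \<open>
  Closeness in \<open>bd\<close> is closeness at a single depth, since radial projections are Lipschitz.
\<close>

lemma bd_close:
  assumes "\<delta> > 0"
  shows "\<exists>k\<ge>n. \<exists>\<eta>>0. \<forall>y\<in>bd. \<forall>z\<in>bd. dist (y k) (z k) < \<eta> \<longrightarrow> dist y z < \<delta>"
proof -
  obtain k where k: "\<forall>x y::nat \<Rightarrow> 'a. (\<forall>i\<le>k. dist (x i) (y i) < \<delta>/4) \<longrightarrow> dist x y < \<delta>"
    using dist_fun_small[OF assms] by blast
  have "dist y z < \<delta>" if "y \<in> bd" "z \<in> bd" "dist (y (max k n)) (z (max k n)) < \<delta>/8" for y z
  proof -
    have "dist (y i) (z i) < \<delta>/4" if "i \<le> k" for i
    proof -
      have "i \<le> max k n" using that by simp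
      from bd_dist_mono[OF \<open>y \<in> bd\<close> \<open>z \<in> bd\<close> this] show ?thesis
        using \<open>dist (y (max k n)) (z (max k n)) < \<delta>/8\<close> by linarith
    qed
    then show ?thesis using k by blast
  qed
  then show ?thesis using assms by (intro exI[of _ "max k n"] conjI exI[of _ "\<delta>/8"]) auto
qed

text \<open>
  Tychonoff's theorem, for the closed balls of a proper space.
\<close>

lemma compact_radial_sequences: "compact {u. \<forall>i. u i \<in> cball x0 (real i)}"
proof -
  have "compactin (product_topology (\<lambda>i. euclidean) UNIV) (PiE UNIV (\<lambda>i::nat. cball x0 (real i)))"
    unfolding compactin_PiE using proper by (auto simp: proper_metric_def)
  moreover have "PiE UNIV (\<lambda>i::nat. cball x0 (real i)) = {u. \<forall>i. u i \<in> cball x0 (real i)}"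
    by (auto simp: PiE_def Pi_def)
  ultimately show ?thesis by (simp add: euclidean_product_topology)
qed

lemma tendsto_component: "(u \<longlongrightarrow> y) F \<Longrightarrow> ((\<lambda>n. u n i) \<longlongrightarrow> (y i::'b::topological_space)) F"
  using continuous_on_tendsto_compose[OF continuous_on_product_coordinates[of i], of u y F] by simp

lemma compact_bd: "compact bd"
proof -
  have eq: "bd = {u. \<forall>i. u i \<in> cball x0 (real i)} \<inter> bd"
  proof -
    have "dist x0 (y i) \<le> real i" if "y \<in> bd" for y i
      using bd_rad[OF that, of i] by (simp add: rad_def)
    then show ?thesis by auto
  qed
  have "closed bd"
  proof -
    have eq: "bd = {y. y 0 = x0} \<inter> (\<Inter>i. \<Inter>j. {y. dist (y i) (y j) = \<bar>real i - real j\<bar>})"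
      by (auto simp: bd_def)
    have c1: "closed {y::nat \<Rightarrow> 'a. dist (y i) (y j) = \<bar>real i - real j\<bar>}" for i j
      by (intro closed_Collect_eq continuous_intros continuous_on_product_coordinates)
    have c2: "closed {y::nat \<Rightarrow> 'a. y 0 = x0}"
      by (intro closed_Collect_eq continuous_intros continuous_on_product_coordinates)
    show ?thesis unfolding eq by (intro closed_Int closed_INT ballI c1 c2)
  qed
  then show ?thesis by (subst eq) (rule compact_Int_closed[OF compact_radial_sequences])
qed

text \<open>
  The space may have points that lie on no geodesic ray from \<open>x0\<close>.  Still, the initial part of the
  geodesic from \<open>x0\<close> to a point far out is close to a geodesic ray, as a limit of longer and longer
  geodesics is a ray.
\<close>

lemma shadow:
  assumes "\<delta> > 0"
  shows "\<exists>m\<ge>k. \<forall>w. real m \<le> rad w \<longrightarrow> (\<exists>y\<in>bd. dist (proj (real k) w) (y k) < \<delta>)"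
proof (rule ccontr)
  assume "\<not> ?thesis"
  then have "\<forall>m. \<exists>w. m \<ge> k \<longrightarrow> real m \<le> rad w \<and> (\<forall>y\<in>bd. \<not> dist (proj (real k) w) (y k) < \<delta>)" by blast
  then obtain w where w: "\<And>m. m \<ge> k \<Longrightarrow> real m \<le> rad (w m)"
    "\<And>m y. m \<ge> k \<Longrightarrow> y \<in> bd \<Longrightarrow> \<not> dist (proj (real k) (w m)) (y k) < \<delta>" by metis
  \<comment> \<open>A limit of the sequences of projections of \<open>w m\<close> is a boundary point that shadows infinitely many \<open>w m\<close>.\<close>
  define u where "u m = (\<lambda>i::nat. proj (real i) (w m))" for m
  have "\<forall>m. u m \<in> {u. \<forall>i. u i \<in> cball x0 (real i)}"
    using rad_proj by (auto simp: u_def simp flip: rad_def)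
  moreover have "seq_compact {u. \<forall>i. u i \<in> cball x0 (real i)}"
    using compact_radial_sequences by (simp add: compact_eq_seq_compact_metric)
  ultimately obtain y r where r: "strict_mono (r::nat \<Rightarrow> nat)" "(u \<circ> r) \<longlonglongrightarrow> y"
    unfolding seq_compact_def by meson
  have lim: "(\<lambda>l. proj (real i) (w (r l))) \<longlonglongrightarrow> y i" for i
    using tendsto_component[OF r(2), of i] by (simp add: u_def)
  have big: "real l \<le> rad (w (r l))" if "l \<ge> k" for l
  proof -
    have "l \<le> r l" using r(1) by (rule seq_suble)
    then show ?thesis using w(1)[of "r l"] that by linarith
  qed
  have "dist (y i) (y j) = \<bar>real i - real j\<bar>" for i j
  proof (rule LIMSEQ_unique)
    show "(\<lambda>l. dist (proj (real i) (w (r l))) (proj (real j) (w (r l)))) \<longlonglongrightarrow> dist (y i) (y j)"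
      by (intro tendsto_intros lim)
    show "(\<lambda>l. dist (proj (real i) (w (r l))) (proj (real j) (w (r l)))) \<longlonglongrightarrow> \<bar>real i - real j\<bar>"
    proof (rule tendsto_eventually, rule eventually_sequentiallyI)
      fix l assume "max k (max i j) \<le> l"
      then show "dist (proj (real i) (w (r l))) (proj (real j) (w (r l))) = \<bar>real i - real j\<bar>"
        using big[of l] dist_proj[of "real i" "real j" "w (r l)"] by simp
    qed
  qed
  moreover have "y 0 = x0"
  proof -
    have "proj 0 v = x0" for v using rad_proj[of 0 v] by (simp add: rad_def)
    then show ?thesis using lim[of 0] by (simp add: LIMSEQ_const_iff)
  qed
  ultimately have "y \<in> bd" by (simp add: bd_def)
  have "\<forall>\<^sub>F l in sequentially. dist (proj (real k) (w (r l))) (y k) < \<delta>"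
    using lim[of k] assms by (rule tendstoD)
  then obtain L where L: "\<And>l. l \<ge> L \<Longrightarrow> dist (proj (real k) (w (r l))) (y k) < \<delta>"
    by (auto simp: eventually_sequentially)
  have "max L k \<le> r (max L k)" using r(1) by (rule seq_suble)
  then show False using L[of "max L k"] w(2)[OF _ \<open>y \<in> bd\<close>, of "r (max L k)"] by simp
qed

definition ray :: "(nat \<Rightarrow> 'a) \<Rightarrow> real \<Rightarrow> 'a" where "ray y t = proj t (y (nat \<lceil>t\<rceil>))"

lemma ray_eq: "y \<in> bd \<Longrightarrow> 0 \<le> t \<Longrightarrow> t \<le> real k \<Longrightarrow> ray y t = proj t (y k)"
proof -
  assume y: "y \<in> bd" "0 \<le> t" "t \<le> real k"
  have le: "nat \<lceil>t\<rceil> \<le> k" "t \<le> real (nat \<lceil>t\<rceil>)" using y(2,3) by linarith+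
  have "proj t (y k) = proj (min t (real (nat \<lceil>t\<rceil>))) (y k)" using le by simp
  also have "\<dots> = proj t (proj (real (nat \<lceil>t\<rceil>)) (y k))" using y(2) by (simp add: proj_proj)
  finally show ?thesis using bd_proj[OF y(1) le(1)] by (simp add: ray_def)
qed

lemma ray_nat [simp]: "y \<in> bd \<Longrightarrow> ray y (real k) = y k"
  using ray_eq[of y "real k" k] bd_proj[of y k k] by simp

lemma dist_ray: "y \<in> bd \<Longrightarrow> 0 \<le> s \<Longrightarrow> 0 \<le> t \<Longrightarrow> dist (ray y s) (ray y t) = \<bar>s - t\<bar>"
proof -
  assume y: "y \<in> bd" "0 \<le> s" "0 \<le> t"
  obtain k where k: "max s t \<le> real k" using real_arch_simple by blast
  then show ?thesis using y ray_eq[OF y(1), of s k] ray_eq[OF y(1), of t k] dist_proj[of s t "y k"] by simp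
qed

lemma rad_ray [simp]: "y \<in> bd \<Longrightarrow> 0 \<le> t \<Longrightarrow> rad (ray y t) = t"
  using dist_ray[of y 0 t] ray_nat[of y 0] by (simp add: rad_def bd_def)

lemma proj_ray:
  assumes "y \<in> bd" "0 \<le> s" "s \<le> t" shows "proj s (ray y t) = ray y s"
proof -
  obtain k where "t \<le> real k" using real_arch_simple by blast
  then show ?thesis using assms ray_eq[of y s k] ray_eq[of y t k] proj_proj[of s t "y k"] by simp
qed

lemma geodesic_ray_ray: "y \<in> bd \<Longrightarrow> geodesic_ray (ray y)"
  by (simp add: geodesic_ray_def isometric_on_def dist_ray dist_real_def)

lemma continuous_on_ray: "y \<in> bd \<Longrightarrow> continuous_on {0..} (ray y)"
  unfolding continuous_on_iff by (auto simp: dist_ray dist_real_def intro!: exI)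

end

locale one_ended_cat0 = pointed_cat0 x0 for x0 :: "'a::metric_space" +
  assumes one_ended: "one_ended TYPE('a)"
begin

lemma unbounded: "\<exists>w. m \<le> rad w"
proof (rule ccontr)
  assume "\<not> ?thesis"
  then have "dist x0 w \<le> m" for w unfolding rad_def by (meson linear)
  then have "UNIV = cball x0 m" by auto
  then have "compact (UNIV::'a set)" using proper unfolding proper_metric_def by metis
  then show False using one_ended by (simp add: one_ended_def)
qed

lemma bd_nonempty: "bd \<noteq> {}"
  using shadow[of 1 0] unbounded by (metis empty_iff zero_less_one)

text \<open>
  Each of the two sets lies in a component of the complement of a ball with noncompact closure,
  and one-endedness allows one such component.
\<close>

lemma unbounded_connected_sets_share_component:
  assumes A: "connected A" "A \<subseteq> far m" "\<And>R. \<exists>a\<in>A. R < rad a"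
    and B: "connected B" "B \<subseteq> far m" "\<And>R. \<exists>b\<in>B. R < rad b"
  shows "\<exists>C. connected C \<and> C \<subseteq> far m \<and> A \<subseteq> C \<and> B \<subseteq> C"
proof -
  have far: "far m = UNIV - cball x0 m" by (auto simp: far_def rad_def)
  have comp: "\<exists>C. C \<in> components (far m) \<and> A \<subseteq> C \<and> \<not> compact (closure C)"
    if A: "connected A" "A \<subseteq> far m" "\<And>R. \<exists>a\<in>A. R < rad a" for A
  proof -
    have "A \<noteq> {}" using A(3)[of 0] by blast
    then have "far m \<noteq> {}" using A(2) by blast
    then obtain C where C: "C \<in> components (far m)" "A \<subseteq> C"
      using exists_component_superset[OF A(2) _ A(1)] by blast
    have "\<not> compact (closure C)"
    proof
      assume "compact (closure C)"
      then have "bounded C" using bounded_closure_image compact_imp_bounded bounded_subset closure_subset by blast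
      then obtain R where "\<forall>c\<in>C. dist x0 c \<le> R" using bounded_any_center[of C x0] by blast
      then show False using A(3)[of R] C(2) by (force simp: rad_def)
    qed
    then show ?thesis using C by blast
  qed
  have "\<exists>!C. C \<in> components (far m) \<and> \<not> compact (closure C)"
    using one_ended proper unfolding one_ended_def far proper_metric_def by blast
  then obtain C where "C \<in> components (far m)" "A \<subseteq> C" "B \<subseteq> C"
    using comp[OF A] comp[OF B] by metis
  then show ?thesis using in_components_connected in_components_subset by blast
qed

lemma ray_tail:
  assumes "y \<in> bd" "0 \<le> m"
  shows "connected (ray y ` {m<..})" "ray y ` {m<..} \<subseteq> far m" "\<exists>a\<in>ray y ` {m<..}. R < rad a"
proof -
  show "connected (ray y ` {m<..})"
  proof (rule connected_continuous_image)
    show "continuous_on {m<..} (ray y)"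
      by (rule continuous_on_subset[OF continuous_on_ray[OF assms(1)]]) (use assms(2) in auto)
  qed simp
  show "ray y ` {m<..} \<subseteq> far m" using assms by (auto simp: mem_far)
  have "rad (ray y (max m R + 1)) = max m R + 1" using assms by (intro rad_ray) auto
  then show "\<exists>a\<in>ray y ` {m<..}. R < rad a" by (intro bexI[of _ "ray y (max m R + 1)"]) auto
qed

text \<open>
  A separation of the boundary into two closed sets would separate the boundary points at some depth
  \<open>k\<close>.  As every point far out is shadowed by a boundary point, the unbounded component of the
  complement of a large ball would be separated too.
\<close>

lemma connected_bd: "connected bd"
  unfolding connected_closed_set[OF compact_imp_closed[OF compact_bd]]
proof (rule notI, elim exE conjE)
  fix A B assume AB: "closed A" "closed B" "A \<noteq> {}" "B \<noteq> {}" "A \<union> B = bd" "A \<inter> B = {}"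
  have "compact A" using AB compact_bd by (metis Int_absorb1 Un_upper1 compact_Int_closed)
  then obtain \<eta> where \<eta>: "\<eta> > 0" "\<And>a b. a \<in> A \<Longrightarrow> b \<in> B \<Longrightarrow> \<eta> \<le> dist a b"
    using compact_closed_gap AB by metis
  obtain k \<eta>' where k: "\<eta>' > 0" "\<And>y z. y \<in> bd \<Longrightarrow> z \<in> bd \<Longrightarrow> dist (y k) (z k) < \<eta>' \<Longrightarrow> dist y z < \<eta>"
    using bd_close[OF \<eta>(1), of 0] by metis
  have gap: "\<eta>' \<le> dist (a k) (b k)" if "a \<in> A" "b \<in> B" for a b
    using k(2)[of a b] \<eta>(2)[OF that] AB(5) that by force
  obtain m where m: "m \<ge> k" "\<And>w. real m \<le> rad w \<Longrightarrow> \<exists>y\<in>bd. dist (proj (real k) w) (y k) < \<eta>'/8"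
    using shadow[of "\<eta>'/8" k] k(1) by auto
  obtain a b where ab: "a \<in> A" "b \<in> B" using AB by blast
  then have abd: "a \<in> bd" "b \<in> bd" using AB by auto
  obtain C where C: "connected C" "C \<subseteq> far m" "ray a ` {real m<..} \<subseteq> C" "ray b ` {real m<..} \<subseteq> C"
    using unbounded_connected_sets_share_component[OF ray_tail[OF abd(1)] ray_tail[OF abd(2)], of "real m"] by auto
  define Q where "Q w \<longleftrightarrow> (\<exists>y\<in>A. dist (proj (real k) w) (y k) < \<eta>'/4)" for w
  have move: "Q w'" if "Q w" "w' \<in> C" "dist w w' < \<eta>'/16" for w w'
  proof -
    obtain y where y: "y \<in> A" "dist (proj (real k) w) (y k) < \<eta>'/4" using \<open>Q w\<close> by (auto simp: Q_def)
    obtain y' where y': "y' \<in> bd" "dist (proj (real k) w') (y' k) < \<eta>'/8"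
    proof -
      have "real m < rad w'" using C(2) \<open>w' \<in> C\<close> mem_far by blast
      then show ?thesis using m(2)[of w'] that by (meson less_imp_le)
    qed
    have "dist (proj (real k) w) (proj (real k) w') < \<eta>'/8"
      using proj_Lipschitz[of "real k" w w'] that(3) by simp
    then have "dist (y k) (y' k) < \<eta>'"
      using dist_triangle[of "y k" "y' k" "proj (real k) w"] dist_triangle[of "proj (real k) w" "y' k" "proj (real k) w'"]
        y y' k(1) by (simp add: dist_commute)
    then have "y' \<in> A" using gap[of y y'] y(1) y'(1) AB(5) by force
    then show ?thesis using y' k(1) unfolding Q_def by (intro bexI[of _ y']) auto
  qed
  have "Q (ray a (real (m + 1))) \<longleftrightarrow> Q (ray b (real (m + 1)))"
  proof (rule connected_locally_constant[OF C(1)])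
    show "ray a (real (m + 1)) \<in> C" "ray b (real (m + 1)) \<in> C" using C by auto
    show "\<exists>r>0. \<forall>w'\<in>C. dist w w' < r \<longrightarrow> Q w' = Q w" if "w \<in> C" for w
      using move that k(1) by (intro exI[of _ "\<eta>'/16"]) (metis dist_commute zero_less_divide_iff zero_less_numeral)
  qed
  moreover have "Q (ray a (real (m + 1)))"
    unfolding Q_def using ab abd m(1) k(1) by (intro bexI[of _ a]) (simp_all only: ray_nat bd_proj, auto)
  ultimately obtain y where "y \<in> A" "dist (b k) (y k) < \<eta>'/4"
    unfolding Q_def using abd m(1) by (auto simp only: ray_nat bd_proj)
  then show False using gap[of y b] ab k(1) by (simp add: dist_commute)
qed

end

section \<open>Linking boundary points outside large balls\<close>

context pointed_cat0
begin

text \<open>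
  In a proper space a map is proper if and only if it leaves every ball about \<open>x0\<close>, uniformly in the
  homotopy parameter.
\<close>

lemma proper_iff:
  fixes H :: "real \<times> real \<Rightarrow> 'a"
  shows "proper_continuous_on ({0..} \<times> {0..1}) H \<longleftrightarrow>
     continuous_on ({0..} \<times> {0..1}) H \<and> (\<forall>M. \<exists>T\<ge>0. \<forall>t\<ge>T. \<forall>s\<in>{0..1}. M < rad (H (t, s)))"
proof (intro iffI conjI allI)
  let ?S = "{0..} \<times> {0..1} :: (real \<times> real) set"
  assume p: "proper_continuous_on ?S H"
  then show "continuous_on ?S H" by (simp add: proper_continuous_on_def)
  fix M
  have "compact {x \<in> ?S. H x \<in> cball x0 M}"
    using p proper unfolding proper_continuous_on_def proper_metric_def by blast
  then have "bounded {x \<in> ?S. H x \<in> cball x0 M}" by (rule compact_imp_bounded)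
  then obtain B where B: "\<And>x. x \<in> ?S \<Longrightarrow> H x \<in> cball x0 M \<Longrightarrow> norm x \<le> B" unfolding bounded_iff by blast
  have "M < rad (H (t, s))" if "t \<ge> \<bar>B\<bar> + 1" "s \<in> {0..1}" for t s
  proof (rule ccontr)
    assume "\<not> ?thesis"
    then have "H (t, s) \<in> cball x0 M" by (simp add: rad_def)
    then have "norm (t, s) \<le> B" using B[of "(t, s)"] that by auto
    moreover have "t \<le> norm (t, s)" using norm_fst_le[of t s] by simp
    ultimately show False using that by linarith
  qed
  then show "\<exists>T\<ge>0. \<forall>t\<ge>T. \<forall>s\<in>{0..1}. M < rad (H (t, s))" by (intro exI[of _ "\<bar>B\<bar> + 1"]) auto
next
  let ?S = "{0..} \<times> {0..1} :: (real \<times> real) set"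
  assume a: "continuous_on ?S H \<and> (\<forall>M. \<exists>T\<ge>0. \<forall>t\<ge>T. \<forall>s\<in>{0..1}. M < rad (H (t, s)))"
  have "compact {x \<in> ?S. H x \<in> K}" if "compact K" for K
  proof -
    obtain M where M: "\<And>k. k \<in> K \<Longrightarrow> rad k \<le> M"
      using compact_imp_bounded[OF \<open>compact K\<close>] bounded_any_center[of K x0] unfolding rad_def by blast
    obtain T where T: "T \<ge> 0" "\<And>t s. t \<ge> T \<Longrightarrow> s \<in> {0..1} \<Longrightarrow> M < rad (H (t, s))" using a by meson
    have sub: "{x \<in> ?S. H x \<in> K} = {x \<in> {0..T} \<times> {0..1}. H x \<in> K}"
    proof -
      have "t \<le> T" if "s \<in> {0..1}" "H (t, s) \<in> K" for t s
        using T(2)[of t s] M[OF that(2)] that by force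
      then show ?thesis by auto
    qed
    have cont: "continuous_on ({0..T} \<times> {0..1}) H"
      using a by (auto intro: continuous_on_subset)
    have "closed ({x \<in> {0..T} \<times> {0..1}. H x \<in> K})"
      using continuous_closed_preimage[OF cont _ compact_imp_closed[OF that]]
      by (simp add: closed_Times vimage_def Int_def)
    moreover have "compact ({0..T} \<times> {0..1::real})" by (intro compact_Times) auto
    ultimately have "compact (({0..T} \<times> {0..1}) \<inter> {x \<in> {0..T} \<times> {0..1}. H x \<in> K})"
      by (intro compact_Int_closed)
    moreover have "({0..T} \<times> {0..1}) \<inter> {x \<in> {0..T} \<times> {0..1}. H x \<in> K} = {x \<in> {0..T} \<times> {0..1}. H x \<in> K}"
      by blast
    ultimately show ?thesis unfolding sub by (simp only:)
  qed
  then show "proper_continuous_on ?S H" using conjunct1[OF a] unfolding proper_continuous_on_def by blast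
qed

lemma homotopic_in_ball:
  assumes "real n \<le> rad z" "path P" "path Q" "pathstart P = pathstart Q" "pathfinish P = pathfinish Q"
    "path_image P \<subseteq> ball z 1" "path_image Q \<subseteq> ball z 1"
  shows "homotopic_paths (far (real n - 1)) P Q"
proof (rule homotopic_paths_close[OF assms(2-5)])
  show "\<exists>c. P t \<in> ball c 1 \<and> Q t \<in> ball c 1 \<and> ball c 1 \<subseteq> far (real n - 1)" if "t \<in> {0..1}" for t
    by (rule exI[of _ z]) (use that assms(6,7) ball_subset_far[OF assms(1)] in \<open>auto simp: path_image_def image_subset_iff\<close>)
qed

lemma path_image_geod_ball: "a \<in> ball z R \<Longrightarrow> b \<in> ball z R \<Longrightarrow> path_image (geod a b) \<subseteq> ball z R"
  unfolding path_image_def using geod_ball by blast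

text \<open>
  The projection to depth \<open>n\<close> makes links at different depths \<open>m\<close> comparable, since it fixes the
  geodesic rays: it maps \<open>y m\<close> to \<open>y n\<close>.  The sets \<open>far (real m - 1)\<close>, rather than \<open>far (real m)\<close>, leave
  room for short geodesics between points at depth \<open>m\<close>.
\<close>

definition link :: "nat \<Rightarrow> nat \<Rightarrow> (nat \<Rightarrow> 'a) \<Rightarrow> (nat \<Rightarrow> 'a) \<Rightarrow> bool" where
  "link n m y z \<longleftrightarrow> (\<exists>\<gamma>. path \<gamma> \<and> path_image \<gamma> \<subseteq> far (real m - 1) \<and> pathstart \<gamma> = y m \<and> pathfinish \<gamma> = z m \<and>
     homotopic_paths (far (real n - 1)) (proj (real n) \<circ> \<gamma>) (geod (y n) (z n)))"

lemma linkI: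
  assumes "path \<gamma>" "path_image \<gamma> \<subseteq> far (real m - 1)" "pathstart \<gamma> = y m" "pathfinish \<gamma> = z m"
    "homotopic_paths (far (real n - 1)) (proj (real n) \<circ> \<gamma>) (geod (y n) (z n))"
  shows "link n m y z"
  using assms unfolding link_def by blast

lemma linkE:
  assumes "link n m y z"
  obtains \<gamma> where "path \<gamma>" "path_image \<gamma> \<subseteq> far (real m - 1)" "pathstart \<gamma> = y m" "pathfinish \<gamma> = z m"
    "homotopic_paths (far (real n - 1)) (proj (real n) \<circ> \<gamma>) (geod (y n) (z n))"
  using assms unfolding link_def by blast

lemma path_image_proj:
  assumes "n \<le> m" "path_image \<gamma> \<subseteq> far (real m - 1)"
  shows "path_image (proj (real n) \<circ> \<gamma>) \<subseteq> far (real n - 1)"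
  using assms by (auto simp: path_image_def mem_far rad_proj image_subset_iff)

text \<open>
  The geodesic between \<open>y m\<close> and \<open>z m\<close> is a link: its projection stays within distance 1 of \<open>y n\<close>.
\<close>

lemma link_near:
  assumes "y \<in> bd" "z \<in> bd" "n \<le> m" "dist (y m) (z m) < 1/2"
  shows "link n m y z"
proof (rule linkI[of "geod (y m) (z m)"])
  have im: "path_image (geod (y m) (z m)) \<subseteq> ball (y m) (1/2)"
    by (rule path_image_geod_ball) (use assms in auto)
  then have "path_image (geod (y m) (z m)) \<subseteq> ball (y m) 1" by (rule order_trans) auto
  then show "path_image (geod (y m) (z m)) \<subseteq> far (real m - 1)"
    using ball_subset_far[of "real m" "y m"] assms(1) by auto
  show "homotopic_paths (far (real n - 1)) (proj (real n) \<circ> geod (y m) (z m)) (geod (y n) (z n))"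
  proof (rule homotopic_in_ball[of n "y n"])
    have "dist (y n) (proj (real n) w) < 1" if "w \<in> ball (y m) (1/2)" for w
      using proj_Lipschitz[of "real n" "y m" w] that bd_proj[OF assms(1,3)] by simp
    then show "path_image (proj (real n) \<circ> geod (y m) (z m)) \<subseteq> ball (y n) 1"
      using im by (force simp: path_image_compose)
    show "path_image (geod (y n) (z n)) \<subseteq> ball (y n) 1"
      by (rule path_image_geod_ball) (use bd_dist_mono[OF assms(1-3)] assms(4) in auto)
  qed (use assms bd_proj in \<open>auto simp: path_proj path_geod pathstart_compose pathfinish_compose\<close>)
qed (auto simp: path_geod)

lemma link_sym:
  assumes "y \<in> bd" "z \<in> bd" "dist (y n) (z n) < 1" "link n m y z"
  shows "link n m z y"
proof -
  obtain \<gamma> where g: "path \<gamma>" "path_image \<gamma> \<subseteq> far (real m - 1)" "pathstart \<gamma> = y m" "pathfinish \<gamma> = z m"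
    "homotopic_paths (far (real n - 1)) (proj (real n) \<circ> \<gamma>) (geod (y n) (z n))"
    using assms(4) by (rule linkE)
  show ?thesis
  proof (rule linkI[of "reversepath \<gamma>"])
    have "proj (real n) \<circ> reversepath \<gamma> = reversepath (proj (real n) \<circ> \<gamma>)"
      by (auto simp: reversepath_def)
    moreover have "homotopic_paths (far (real n - 1)) (reversepath (proj (real n) \<circ> \<gamma>)) (reversepath (geod (y n) (z n)))"
      using g(5) by (simp add: homotopic_paths_reversepath)
    moreover have "homotopic_paths (far (real n - 1)) (reversepath (geod (y n) (z n))) (geod (z n) (y n))"
    proof (rule homotopic_in_ball[of n "y n"])
      show "path_image (reversepath (geod (y n) (z n))) \<subseteq> ball (y n) 1"
        "path_image (geod (z n) (y n)) \<subseteq> ball (y n) 1"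
        using assms(3) by (simp_all add: path_image_geod_ball)
    qed (use assms in \<open>auto simp: path_geod\<close>)
    ultimately show "homotopic_paths (far (real n - 1)) (proj (real n) \<circ> reversepath \<gamma>) (geod (z n) (y n))"
      using homotopic_paths_trans by metis
  qed (use g in auto)
qed

lemma link_trans:
  assumes "y \<in> bd" "z \<in> bd" "w \<in> bd" "dist (y n) (z n) < 1" "dist (z n) (w n) < 1" "link n m y z" "link n m z w"
  shows "link n m y w"
proof -
  obtain \<gamma> where g: "path \<gamma>" "path_image \<gamma> \<subseteq> far (real m - 1)" "pathstart \<gamma> = y m" "pathfinish \<gamma> = z m"
    "homotopic_paths (far (real n - 1)) (proj (real n) \<circ> \<gamma>) (geod (y n) (z n))"
    using assms(6) by (rule linkE)
  obtain \<gamma>' where g': "path \<gamma>'" "path_image \<gamma>' \<subseteq> far (real m - 1)" "pathstart \<gamma>' = z m" "pathfinish \<gamma>' = w m"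
    "homotopic_paths (far (real n - 1)) (proj (real n) \<circ> \<gamma>') (geod (z n) (w n))"
    using assms(7) by (rule linkE)
  show ?thesis
  proof (rule linkI[of "\<gamma> +++ \<gamma>'"])
    have "homotopic_paths (far (real n - 1)) (proj (real n) \<circ> (\<gamma> +++ \<gamma>')) (geod (y n) (z n) +++ geod (z n) (w n))"
      unfolding path_compose_join using g g' by (intro homotopic_paths_join) (auto simp: pathstart_compose pathfinish_compose)
    moreover have "homotopic_paths (far (real n - 1)) (geod (y n) (z n) +++ geod (z n) (w n)) (geod (y n) (w n))"
    proof (rule homotopic_in_ball[of n "z n"])
      have b: "y n \<in> ball (z n) 1" "z n \<in> ball (z n) 1" "w n \<in> ball (z n) 1"
        using assms(4,5) by (auto simp: dist_commute)
      show "path_image (geod (y n) (z n) +++ geod (z n) (w n)) \<subseteq> ball (z n) 1"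
        using path_image_geod_ball[OF b(1,2)] path_image_geod_ball[OF b(2,3)] by (simp add: path_image_join)
      show "path_image (geod (y n) (w n)) \<subseteq> ball (z n) 1" using path_image_geod_ball[OF b(1,3)] .
    qed (use assms in \<open>auto simp: path_geod\<close>)
    ultimately show "homotopic_paths (far (real n - 1)) (proj (real n) \<circ> (\<gamma> +++ \<gamma>')) (geod (y n) (w n))"
      by (rule homotopic_paths_trans)
  qed (use g g' in \<open>auto simp: path_image_join\<close>)
qed

lemma link_decreasing:
  assumes "y \<in> bd" "z \<in> bd" "n \<le> m" "link n (Suc m) y z"
  shows "link n m y z"
proof -
  obtain \<gamma> where g: "path \<gamma>" "path_image \<gamma> \<subseteq> far (real (Suc m) - 1)" "pathstart \<gamma> = y (Suc m)" "pathfinish \<gamma> = z (Suc m)"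
    "homotopic_paths (far (real n - 1)) (proj (real n) \<circ> \<gamma>) (geod (y n) (z n))"
    using assms(4) by (rule linkE)
  show ?thesis
  proof (rule linkI[of "proj (real m) \<circ> \<gamma>"])
    have "proj (real n) \<circ> (proj (real m) \<circ> \<gamma>) = proj (real n) \<circ> \<gamma>"
      using assms(3) by (auto simp: proj_proj)
    then show "homotopic_paths (far (real n - 1)) (proj (real n) \<circ> (proj (real m) \<circ> \<gamma>)) (geod (y n) (z n))"
      using g(5) by simp
    show "path_image (proj (real m) \<circ> \<gamma>) \<subseteq> far (real m - 1)"
      using path_image_proj[of m "Suc m"] g(2) by simp
  qed (use g assms bd_proj[of _ m "Suc m"] in \<open>auto simp: path_proj pathstart_compose pathfinish_compose\<close>)
qed

end

section \<open>Proper homotopies force uniform linking\<close>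

context pointed_cat0
begin

text \<open>
  The trace that a proper homotopy from \<open>ray x\<close> to \<open>ray y\<close> leaves at depth \<open>n\<close>: a path on the sphere of
  radius \<open>n\<close>, which is up to homotopy the projection of a path at any greater depth.
\<close>

definition thread :: "nat \<Rightarrow> (nat \<Rightarrow> 'a) \<Rightarrow> (nat \<Rightarrow> 'a) \<Rightarrow> (real \<Rightarrow> 'a) \<Rightarrow> bool" where
  "thread n x y \<omega> \<longleftrightarrow> path \<omega> \<and> (\<forall>t\<in>{0..1}. rad (\<omega> t) = real n) \<and> pathstart \<omega> = x n \<and> pathfinish \<omega> = y n \<and>
     (\<forall>m\<ge>n. \<exists>\<gamma>. path \<gamma> \<and> path_image \<gamma> \<subseteq> far (real m - 1) \<and> pathstart \<gamma> = x m \<and> pathfinish \<gamma> = y m \<and>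
        homotopic_paths (far (real n - 1)) (proj (real n) \<circ> \<gamma>) \<omega>)"

text \<open>
  The trace is the projection of a level path \<open>H (t0, _)\<close> of the homotopy \<open>H\<close> with \<open>t0\<close> large.  Later
  levels have homotopic projections, by the homotopy \<open>H\<close> itself; the ends do not move because the
  projection fixes geodesic rays.
\<close>

lemma thread_exists:
  assumes "x \<in> bd" "y \<in> bd" "properly_homotopic (ray x) (ray y)"
  shows "\<exists>\<omega>. thread n x y \<omega>"
proof -
  obtain H :: "real \<times> real \<Rightarrow> 'a" where H: "proper_continuous_on ({0..} \<times> {0..1}) H"
    "\<forall>t\<ge>0. H (t, 0) = ray x t" "\<forall>t\<ge>0. H (t, 1) = ray y t"
    using assms(3) unfolding properly_homotopic_def by (elim exE conjE) (rule that)
  have cont: "continuous_on ({0..} \<times> {0..1}) H"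
    and diverge: "\<forall>M. \<exists>T\<ge>0. \<forall>t\<ge>T. \<forall>s\<in>{0..1}. M < rad (H (t, s))"
    using H(1) unfolding proper_iff by blast+
  have time: "\<exists>T\<ge>max 0 M. \<forall>t\<ge>T. \<forall>s\<in>{0..1}. M < rad (H (t, s))" for M
  proof -
    obtain T where T: "T \<ge> 0" "\<forall>t\<ge>T. \<forall>s\<in>{0..1}. M < rad (H (t, s))"
      using spec[OF diverge, of M] by (elim exE conjE)
    have "M < rad (H (t, s))" if "t \<ge> max T M" "s \<in> {0..1}" for t s
      using T(2) that by (meson max.boundedE)
    moreover have "max T M \<ge> max 0 M" using T(1) by simp
    ultimately show ?thesis by blast
  qed
  obtain t0 where t0: "t0 \<ge> real n" "\<And>t s. t \<ge> t0 \<Longrightarrow> s \<in> {0..1} \<Longrightarrow> real n < rad (H (t, s))"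
    using time[of "real n"] unfolding max.bounded_iff by blast
  define \<omega> where "\<omega> s = proj (real n) (H (t0, s))" for s
  have slice: "continuous_on {0..1} (\<lambda>s. H (t, s))" if "t \<ge> 0" for t
    by (rule continuous_on_compose2[OF cont]) (use that in \<open>auto intro!: continuous_intros\<close>)
  have ends: "proj (real k) (H (t, 0)) = x k" "proj (real k) (H (t, 1)) = y k" if "t \<ge> real k" for t k
  proof -
    have "t \<ge> 0" using that by (rule order_trans[rotated]) simp
    then show "proj (real k) (H (t, 0)) = x k" "proj (real k) (H (t, 1)) = y k"
      using that H(2,3) assms by (simp_all add: proj_ray)
  qed
  have "t0 \<ge> 0" using t0(1) by (rule order_trans[rotated]) simp
  have "\<exists>\<gamma>. path \<gamma> \<and> path_image \<gamma> \<subseteq> far (real m - 1) \<and> pathstart \<gamma> = x m \<and> pathfinish \<gamma> = y m \<and>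
        homotopic_paths (far (real n - 1)) (proj (real n) \<circ> \<gamma>) \<omega>" if "n \<le> m" for m
  proof -
    obtain T where T: "T \<ge> real m" "\<And>t s. t \<ge> T \<Longrightarrow> s \<in> {0..1} \<Longrightarrow> real m < rad (H (t, s))"
      using time[of "real m"] unfolding max.bounded_iff by blast
    define t1 where "t1 = max T t0"
    have t1: "t1 \<ge> real m" "t1 \<ge> t0" "t1 \<ge> 0" using T(1) \<open>t0 \<ge> 0\<close> by (auto simp: t1_def)
    define \<gamma> where "\<gamma> s = proj (real m) (H (t1, s))" for s
    have "path \<gamma>" unfolding path_def \<gamma>_def by (intro continuous_intros slice t1) auto
    moreover have "path_image \<gamma> \<subseteq> far (real m - 1)"
    proof -
      have "real m < rad (H (t1, s))" if "s \<in> {0..1}" for s using T(2)[of t1 s] that by (simp add: t1_def)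
      then have "rad (\<gamma> s) = real m" if "s \<in> {0..1}" for s
        using that unfolding \<gamma>_def by (simp add: rad_proj min_def less_imp_le)
      then show ?thesis unfolding path_image_def by (simp add: image_subset_iff mem_far)
    qed
    moreover have "pathstart \<gamma> = x m" "pathfinish \<gamma> = y m"
      using ends[OF t1(1)] by (auto simp: pathstart_def pathfinish_def \<gamma>_def)
    moreover have "homotopic_paths (far (real n - 1)) (proj (real n) \<circ> \<gamma>) \<omega>"
    proof -
      have tt: "t0 \<le> t1 + u * (t0 - t1)" if "u \<in> {0..1}" for u
      proof -
        have "(1 - u) * (t1 - t0) \<ge> 0" using that t1 by simp
        then show ?thesis by (simp add: algebra_simps)
      qed
      let ?h = "\<lambda>p. proj (real n) (H (t1 + fst p * (t0 - t1), snd p))"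
      have "continuous_on ({0..1} \<times> {0..1}) ?h"
      proof (intro continuous_intros continuous_on_compose2[OF cont])
        have "0 \<le> t1 + u * (t0 - t1)" if "u \<in> {0..1}" for u using tt[OF that] \<open>t0 \<ge> 0\<close> by linarith
        then show "(\<lambda>p. (t1 + fst p * (t0 - t1), snd p)) ` ({0..1} \<times> {0..1}) \<subseteq> {0..} \<times> {0..1}" by auto
      qed auto
      moreover have "?h \<in> {0..1} \<times> {0..1} \<rightarrow> far (real n - 1)"
      proof
        fix p :: "real \<times> real" assume p: "p \<in> {0..1} \<times> {0..1}"
        then have "real n < rad (H (t1 + fst p * (t0 - t1), snd p))" by (intro t0(2) tt) auto
        then show "?h p \<in> far (real n - 1)" by (simp add: mem_far rad_proj)
      qed
      moreover have "?h (0, s) = (proj (real n) \<circ> \<gamma>) s" for s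
        using that by (simp add: \<gamma>_def proj_proj)
      moreover have "?h (1, s) = \<omega> s" for s by (simp add: \<omega>_def)
      moreover have "pathstart (?h \<circ> Pair u) = pathstart (proj (real n) \<circ> \<gamma>) \<and>
        pathfinish (?h \<circ> Pair u) = pathfinish (proj (real n) \<circ> \<gamma>)" if u: "u \<in> {0..1}" for u
      proof -
        have "real n \<le> t1 + u * (t0 - t1)" using tt[OF u] t0(1) by linarith
        then show ?thesis using \<open>pathstart \<gamma> = x m\<close> \<open>pathfinish \<gamma> = y m\<close> ends[of n]  bd_proj assms(1,2) \<open>n \<le> m\<close>
          by (simp add: pathstart_compose pathfinish_compose) (simp add: pathstart_def pathfinish_def)
      qed
      ultimately show ?thesis unfolding homotopic_paths by (intro exI[of _ ?h]) blast
    qed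
    ultimately show ?thesis by blast
  qed
  moreover have "path \<omega>" unfolding path_def \<omega>_def by (intro continuous_intros slice \<open>t0 \<ge> 0\<close>) auto
  moreover have "rad (\<omega> s) = real n" if "s \<in> {0..1}" for s
    using t0(2)[of t0 s] that by (simp add: \<omega>_def rad_proj)
  moreover have "pathstart \<omega> = x n" "pathfinish \<omega> = y n"
    using ends[OF t0(1)] by (auto simp: pathstart_def pathfinish_def \<omega>_def)
  ultimately show ?thesis unfolding thread_def by blast
qed

text \<open>
  Going back along one thread and out along the other gives a path that links \<open>y\<close> to \<open>z\<close>.
\<close>

lemma thread_link:
  assumes "y \<in> bd" "z \<in> bd" "thread n x y \<omega>" "thread n x z \<omega>'" "n \<le> m"
    and close: "\<And>t. t \<in> {0..1} \<Longrightarrow> dist (\<omega> t) (\<omega>' t) < 1"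
  shows "link n m y z"
proof -
  let ?F = "far (real n - 1)" and ?g = "geod (y n) (z n)"
  obtain \<gamma> where g: "path \<gamma>" "path_image \<gamma> \<subseteq> far (real m - 1)" "pathstart \<gamma> = x m" "pathfinish \<gamma> = y m"
    "homotopic_paths ?F (proj (real n) \<circ> \<gamma>) \<omega>"
    using assms(3,5) unfolding thread_def by blast
  obtain \<gamma>' where g': "path \<gamma>'" "path_image \<gamma>' \<subseteq> far (real m - 1)" "pathstart \<gamma>' = x m" "pathfinish \<gamma>' = z m"
    "homotopic_paths ?F (proj (real n) \<circ> \<gamma>') \<omega>'"
    using assms(4,5) unfolding thread_def by blast
  have w: "path \<omega>" "path_image \<omega> \<subseteq> ?F" "pathstart \<omega> = x n" "pathfinish \<omega> = y n" "\<And>t. t \<in> {0..1} \<Longrightarrow> rad (\<omega> t) = real n"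
    using assms(3) unfolding thread_def by (auto simp: path_image_def mem_far)
  have w': "path \<omega>'" "path_image \<omega>' \<subseteq> ?F" "pathstart \<omega>' = x n" "pathfinish \<omega>' = z n"
    using assms(4) unfolding thread_def by (auto simp: path_image_def mem_far)
  have yz: "dist (y n) (z n) < 1" using close[of 1] w(4) w'(4) by (simp add: pathfinish_def)
  have gi: "path_image ?g \<subseteq> ball (y n) 1" by (rule path_image_geod_ball) (use yz in auto)
  then have gF: "path_image ?g \<subseteq> ?F" using ball_subset_far[of "real n" "y n"] assms(1) by auto
  have "homotopic_paths ?F (\<omega> +++ ?g) (\<omega>' +++ (\<lambda>_. z n))"
  proof (rule homotopic_paths_close)
    show "path (\<omega> +++ ?g)" "path (\<omega>' +++ (\<lambda>_. z n))"
      using w w' by (auto intro!: path_join_imp simp: path_geod pathstart_def) (simp add: path_def)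
    show "pathstart (\<omega> +++ ?g) = pathstart (\<omega>' +++ (\<lambda>_. z n))" using w w' by simp
    show "pathfinish (\<omega> +++ ?g) = pathfinish (\<omega>' +++ (\<lambda>_. z n))" by (simp add: pathfinish_join) (simp add: pathfinish_def)
    show "\<exists>c. (\<omega> +++ ?g) t \<in> ball c 1 \<and> (\<omega>' +++ (\<lambda>_. z n)) t \<in> ball c 1 \<and> ball c 1 \<subseteq> ?F" if t: "t \<in> {0..1}" for t
    proof (cases "t \<le> 1/2")
      case True
      then have "2 * t \<in> {0..1}" using t by auto
      then show ?thesis using True close[of "2 * t"] ball_subset_far[of "real n" "\<omega> (2 * t)"] w(5)[of "2 * t"]
        by (intro exI[of _ "\<omega> (2 * t)"]) (simp add: joinpaths_def)
    next
      case False
      then have "2 * t - 1 \<in> {0..1}" using t by auto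
      then have "?g (2 * t - 1) \<in> ball (y n) 1" using gi by (auto simp: path_image_def image_subset_iff)
      then show ?thesis using False yz ball_subset_far[of "real n" "y n"] assms(1)
        by (intro exI[of _ "y n"]) (simp add: joinpaths_def)
    qed
  qed
  also have "homotopic_paths ?F (\<omega>' +++ (\<lambda>_. z n)) \<omega>'"
    by (rule homotopic_paths_join_const) (use w' in auto)
  finally have 1: "homotopic_paths ?F \<omega>' (\<omega> +++ ?g)" by (rule homotopic_paths_sym)
  show ?thesis
  proof (rule linkI[of "reversepath \<gamma> +++ \<gamma>'"])
    have "proj (real n) \<circ> (reversepath \<gamma> +++ \<gamma>') = reversepath (proj (real n) \<circ> \<gamma>) +++ (proj (real n) \<circ> \<gamma>')"
      unfolding path_compose_join by (simp add: reversepath_def comp_def)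
    moreover have "homotopic_paths ?F (reversepath (proj (real n) \<circ> \<gamma>) +++ (proj (real n) \<circ> \<gamma>')) (reversepath \<omega> +++ \<omega>')"
      by (rule homotopic_paths_join) (use g g' in \<open>auto simp: homotopic_paths_reversepath pathstart_compose\<close>)
    moreover have "homotopic_paths ?F (reversepath \<omega> +++ \<omega>') (reversepath \<omega> +++ (\<omega> +++ ?g))"
      by (rule homotopic_paths_join) (use w w' 1 in auto)
    moreover have "homotopic_paths ?F (reversepath \<omega> +++ (\<omega> +++ ?g)) ((reversepath \<omega> +++ \<omega>) +++ ?g)"
      by (rule homotopic_paths_assoc) (use w gF in \<open>auto simp: path_geod\<close>)
    moreover have "homotopic_paths ?F ((reversepath \<omega> +++ \<omega>) +++ ?g) ((\<lambda>_. y n) +++ ?g)"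
      by (rule homotopic_paths_join[OF homotopic_paths_reversepath_join]) (use w gF in \<open>auto simp: path_geod\<close>)
    moreover have "homotopic_paths ?F ((\<lambda>_. y n) +++ ?g) ?g"
      by (rule homotopic_paths_const_join) (use gF in \<open>auto simp: path_geod\<close>)
    ultimately show "homotopic_paths ?F (proj (real n) \<circ> (reversepath \<gamma> +++ \<gamma>')) ?g"
      by (metis homotopic_paths_trans)
  qed (use g g' in \<open>auto simp: path_image_join\<close>)
qed

lemma exists_uniform_subdivision:
  assumes "path (p :: real \<Rightarrow> 'a)" "e > 0"
  shows "\<exists>N>0::nat. \<forall>s\<in>{0..1}. \<forall>t\<in>{0..1}. \<bar>s - t\<bar> \<le> 1 / real N \<longrightarrow> dist (p s) (p t) < e"
proof -
  have "uniformly_continuous_on {0..1} p"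
    using assms(1) by (simp add: path_def compact_uniformly_continuous)
  then obtain \<delta> where \<delta>: "\<delta> > 0" "\<And>s t. s \<in> {0..1} \<Longrightarrow> t \<in> {0..1} \<Longrightarrow> dist s t < \<delta> \<Longrightarrow> dist (p s) (p t) < e"
    using assms(2) unfolding uniformly_continuous_on_def by metis
  obtain N :: nat where N: "1 / \<delta> < real N" using reals_Archimedean2 by blast
  have N0: "0 < real N" using N \<delta>(1) by (meson less_trans zero_less_divide_1_iff)
  have "1 / real N < \<delta>" using N N0 \<delta>(1) by (simp add: field_simps)
  then have "dist (p s) (p t) < e" if "s \<in> {0..1}" "t \<in> {0..1}" "\<bar>s - t\<bar> \<le> 1 / real N" for s t
    using \<delta>(2) that by (simp add: dist_real_def)
  then show ?thesis using N0 by (intro exI[of _ N]) simp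
qed

text \<open>
  Up to an error of 1/2, \<open>\<omega>\<close> is described by finitely many points: \<open>L\<close> is a list of \<open>N + 1\<close> points, and
  the \<open>i\<close>-th point is close to \<open>\<omega>\<close> on the interval from \<open>i / N\<close> to \<open>(i + 1) / N\<close>.
\<close>

definition follows :: "(real \<Rightarrow> 'a) \<Rightarrow> 'a list \<Rightarrow> bool" where
  "follows \<omega> L \<longleftrightarrow> (\<forall>t\<in>{0..1}. dist (\<omega> t) (L ! nat \<lfloor>t * (real (length L) - 1)\<rfloor>) < 1/2)"

lemma follows_exists:
  assumes "path \<omega>" "path_image \<omega> \<subseteq> (\<Union>f\<in>F. ball f (1/4))"
  shows "\<exists>L\<in>lists F. follows \<omega> L"
proof -
  obtain N :: nat where N: "N > 0"
    "\<And>s t. s \<in> {0..1} \<Longrightarrow> t \<in> {0..1} \<Longrightarrow> \<bar>s - t\<bar> \<le> 1 / real N \<Longrightarrow> dist (\<omega> s) (\<omega> t) < 1/4"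
    using exists_uniform_subdivision[OF assms(1), of "1/4"] by auto
  have N0: "0 < real N" using N(1) by simp
  have "\<exists>f\<in>F. dist (\<omega> (real i / real N)) f < 1/4" if "i \<le> N" for i
  proof -
    have "real i / real N \<in> {0..1}" using that N0 by simp
    then have "\<omega> (real i / real N) \<in> path_image \<omega>" by (simp add: path_image_def)
    then show ?thesis using assms(2) by (force simp: dist_commute)
  qed
  then obtain f where f: "\<And>i. i \<le> N \<Longrightarrow> f i \<in> F \<and> dist (\<omega> (real i / real N)) (f i) < 1/4" by metis
  define L where "L = map f [0..<N+1]"
  have len: "real (length L) - 1 = real N" by (simp add: L_def)
  have "dist (\<omega> t) (L ! nat \<lfloor>t * (real (length L) - 1)\<rfloor>) < 1/2" if t: "t \<in> {0..1}" for t
  proof -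
    define i where "i = nat \<lfloor>t * real N\<rfloor>"
    have "0 \<le> t * real N" "t * real N \<le> real N" using t N0 by (auto simp: mult_left_le_one_le)
    then have i: "real i \<le> t * real N" "t * real N < real i + 1" "i \<le> N"
      unfolding i_def by linarith+
    have "real i / real N \<le> t" "t < real i / real N + 1 / real N"
      using i N0 by (auto simp: field_simps)
    then have "\<bar>real i / real N - t\<bar> \<le> 1 / real N" by linarith
    then have "dist (\<omega> (real i / real N)) (\<omega> t) < 1/4"
      using t i(3) N0 by (intro N(2)) auto
    moreover have "dist (\<omega> (real i / real N)) (f i) < 1/4" using f i(3) by blast
    moreover have "L ! i = f i" using i(3) unfolding L_def by (subst nth_map) (auto simp del: upt_Suc)
    ultimately show ?thesis unfolding len i_def[symmetric]
      using dist_triangle[of "\<omega> t" "f i" "\<omega> (real i / real N)"] by (simp add: dist_commute)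
  qed
  moreover have "L \<in> lists F" using f by (auto simp: L_def)
  ultimately show ?thesis unfolding follows_def by blast
qed

lemma compact_finite_net:
  assumes "compact (K::'a set)" "e > 0"
  shows "\<exists>F. finite F \<and> K \<subseteq> (\<Union>f\<in>F. ball f e)"
proof -
  have "K \<subseteq> (\<Union>f\<in>K. ball f e)" using assms(2) by (meson UN_I centre_in_ball subsetI)
  then show ?thesis using compactE_image[OF assms(1), of K "\<lambda>f. ball f e"] by (metis open_ball)
qed

text \<open>
  The sphere of radius \<open>n\<close> is covered by finitely many balls of radius 1/4, so every thread
  follows one of countably many lists.  Boundary points whose threads follow the same list are linked
  at all depths.  By Baire's theorem the points that belong to one of these lists are dense in a
  relatively open piece of \<open>T\<close>.  At each depth the links pass to the closure, because nearby boundary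
  points are linked.
\<close>

lemma link_fragment:
  assumes x: "x \<in> bd" "\<And>y. y \<in> bd \<Longrightarrow> properly_homotopic (ray x) (ray y)"
    and T: "closed T" "T \<subseteq> bd" "T \<noteq> {}"
    and \<epsilon>: "\<epsilon> > 0" "\<And>y z::nat \<Rightarrow> 'a. dist y z < \<epsilon> \<Longrightarrow> dist (y n) (z n) < 1"
  shows "\<exists>y\<in>T. \<exists>\<eta>>0. \<forall>z\<in>T. \<forall>w\<in>T. dist y z < \<eta> \<longrightarrow> dist y w < \<eta> \<longrightarrow> (\<forall>m\<ge>n. link n m z w)"
proof -
  have "compact (cball x0 (real n))" using proper by (simp add: proper_metric_def)
  then obtain F where F: "finite F" "cball x0 (real n) \<subseteq> (\<Union>f\<in>F. ball f (1/4))"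
    using compact_finite_net[of "cball x0 (real n)" "1/4"] by auto
  define S where "S L = {y\<in>T. \<exists>\<omega>. thread n x y \<omega> \<and> follows \<omega> L}" for L
  have cover: "\<exists>L\<in>lists F. y \<in> S L" if "y \<in> T" for y
  proof -
    have "y \<in> bd" using T(2) that by blast
    obtain \<omega> where w: "thread n x y \<omega>"
      using thread_exists[OF x(1) \<open>y \<in> bd\<close> x(2)[OF \<open>y \<in> bd\<close>], where n = n] by (elim exE) (rule that)
    have "dist x0 (\<omega> t) = real n" if "t \<in> {0..1}" for t
      using w that unfolding thread_def rad_def by blast
    then have "path_image \<omega> \<subseteq> cball x0 (real n)"
      unfolding path_image_def by (simp add: image_subset_iff)
    then have "path_image \<omega> \<subseteq> (\<Union>f\<in>F. ball f (1/4))" using F(2) by (rule order_trans)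
    moreover have "path \<omega>" using w unfolding thread_def by blast
    ultimately have "\<exists>L\<in>lists F. follows \<omega> L" by (intro follows_exists)
    then show ?thesis using w that unfolding S_def by blast
  qed
  have S_link: "link n m y z" if yz: "y \<in> S L" "z \<in> S L" and "m \<ge> n" for y z L m
  proof -
    obtain \<omega> \<omega>' where w: "thread n x y \<omega>" "follows \<omega> L" "thread n x z \<omega>'" "follows \<omega>' L"
      using yz unfolding S_def by blast
    have "dist (\<omega> t) (\<omega>' t) < 1" if "t \<in> {0..1}" for t
      using w(2,4) that dist_triangle2[of "\<omega> t" "\<omega>' t" "L ! nat \<lfloor>t * (real (length L) - 1)\<rfloor>"]
      unfolding follows_def by fastforce
    then show ?thesis
      using thread_link[OF _ _ w(1,3) \<open>m \<ge> n\<close>] yz T(2) unfolding S_def by blast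
  qed
  let ?X = "top_of_set T"
  have "\<exists>L\<in>lists F. ?X interior_of (closure (S L)) \<noteq> {}"
  proof (rule ccontr)
    assume "\<not> ?thesis"
    then have emp: "?X interior_of (closure (S L)) = {}" if "L \<in> lists F" for L using that by blast
    have sub: "closure (S L) \<subseteq> T" for L using T(1) by (intro closure_minimal) (auto simp: S_def)
    have "?X interior_of \<Union>((\<lambda>L. closure (S L)) ` lists F) = {}"
    proof (rule Baire_category_alt)
      have "compact_space ?X"
        using compact_Int_closed[OF compact_bd T(1)] T(2) by (simp add: compact_space_subtopology inf.absorb2)
      moreover have "metrizable_space ?X" by (simp add: metrizable_space_subtopology metrizable_space_euclidean)
      ultimately show "completely_metrizable_space ?X \<or> locally_compact_space ?X \<and> regular_space ?X"
        by (simp add: compact_imp_locally_compact_space metrizable_imp_regular_space)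
      show "countable ((\<lambda>L. closure (S L)) ` lists F)"
        using F(1) by (simp add: countable_finite countable_lists)
      show "closedin ?X A \<and> ?X interior_of A = {}" if "A \<in> (\<lambda>L. closure (S L)) ` lists F" for A
        using that emp sub by (auto simp: closed_subset)
    qed
    moreover have "\<Union>((\<lambda>L. closure (S L)) ` lists F) = T"
    proof
      show "T \<subseteq> \<Union>((\<lambda>L. closure (S L)) ` lists F)" 
      proof
        fix y assume "y \<in> T"
        then obtain L where "L \<in> lists F" "y \<in> S L" using cover[OF \<open>y \<in> T\<close>] by (elim bexE) (rule that)
        then show "y \<in> \<Union>((\<lambda>L. closure (S L)) ` lists F)"
          by (intro UN_I[of L]) (auto intro: subsetD[OF closure_subset])
      qed
    qed (use sub in blast)
    ultimately show False using T(3) interior_of_topspace[of ?X] by simp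
  qed
  then obtain L y where L: "L \<in> lists F" "y \<in> ?X interior_of (closure (S L))" by blast
  then obtain O' where O': "openin ?X O'" "y \<in> O'" "O' \<subseteq> closure (S L)"
    unfolding interior_of_def by blast
  then obtain W where W: "open W" "O' = T \<inter> W" by (auto simp: openin_open)
  then obtain e where e: "e > 0" "ball y e \<subseteq> W" using O'(2) open_contains_ball by blast
  define \<eta> where "\<eta> = min e (\<epsilon>/8)"
  have \<eta>: "\<eta> > 0" "\<eta> \<le> e" "\<eta> \<le> \<epsilon>/8" using e(1) \<epsilon>(1) by (auto simp: \<eta>_def)
  have "link n m z w" if zw: "z \<in> T" "w \<in> T" "dist y z < \<eta>" "dist y w < \<eta>" "m \<ge> n" for z w m
  proof -
    obtain \<delta> where \<delta>: "\<delta> > 0" "\<And>x y::nat \<Rightarrow> 'a. dist x y < \<delta> \<Longrightarrow> dist (x m) (y m) < 1/2"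
      using dist_fun_imp_component[of "1/2" m] by auto
    have cl: "\<exists>v'\<in>S L. dist v' v < min \<delta> (\<epsilon>/8)" if "v \<in> T" "dist y v < \<eta>" for v
    proof -
      have "v \<in> ball y e" using that(2) \<eta>(2) by simp
      then have "v \<in> closure (S L)" using that(1) e(2) W(2) O'(3) by blast
      then show ?thesis using \<delta>(1) \<epsilon>(1) unfolding closure_approachable
        by (metis min_less_iff_conj zero_less_divide_iff zero_less_numeral)
    qed
    obtain z' where z': "z' \<in> S L" "dist z' z < \<delta>" "dist z' z < \<epsilon>/8" using cl[OF zw(1,3)] by auto
    obtain w' where w': "w' \<in> S L" "dist w' w < \<delta>" "dist w' w < \<epsilon>/8" using cl[OF zw(2,4)] by auto
    have b: "z \<in> bd" "w \<in> bd" "z' \<in> bd" "w' \<in> bd" using zw T(2) z' w' by (auto simp: S_def)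
    have zw'd: "dist z' w' < \<epsilon>"
      using dist_triangle[of z' w' z] dist_triangle[of z w' y] dist_triangle[of y w' w] zw z' w' \<eta> \<epsilon>(1)
      by (simp add: dist_commute)
    have z'wd: "dist z' w < \<epsilon>"
      using dist_triangle[of z' w z] dist_triangle[of z w y] zw z' \<eta> \<epsilon>(1)
      by (simp add: dist_commute)
    have 1: "link n m z z'" by (rule link_near) (use b zw(5) \<delta>(2)[of z z'] z'(2) in \<open>auto simp: dist_commute\<close>)
    have 2: "link n m z' w'" using S_link z'(1) w'(1) zw(5) by blast
    have 3: "link n m w' w" by (rule link_near) (use b zw(5) \<delta>(2)[of w' w] w'(2) in auto)
    have d: "dist (z n) (z' n) < 1" "dist (w' n) (w n) < 1"
      using \<epsilon>(2)[of z z'] \<epsilon>(2)[of w' w] z'(3) w'(3) \<epsilon>(1) by (simp_all add: dist_commute)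
    have 4: "link n m z' w"
      by (rule link_trans[OF b(3,4,2) \<epsilon>(2)[OF zw'd] d(2) 2 3])
    show ?thesis
      by (rule link_trans[OF b(1,3,2) d(1) \<epsilon>(2)[OF z'wd] 1 4])
  qed
  moreover have "y \<in> T" using O' W by blast
  ultimately show ?thesis using \<eta>(1) by blast
qed

end

context one_ended_cat0
begin

theorem link_uniform:
  assumes x: "x \<in> bd" "\<And>y. y \<in> bd \<Longrightarrow> properly_homotopic (ray x) (ray y)"
  shows "\<exists>k\<ge>n. \<exists>\<eta>>0. \<forall>y\<in>bd. \<forall>z\<in>bd. dist (y k) (z k) < \<eta> \<longrightarrow> (\<forall>m\<ge>n. link n m y z)"
proof -
  obtain \<epsilon> where \<epsilon>: "\<epsilon> > 0" "\<And>y z::nat \<Rightarrow> 'a. dist y z < \<epsilon> \<Longrightarrow> dist (y n) (z n) < 1"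
    using dist_fun_imp_component[of 1 n] by auto
  interpret local_equivalence_tower bd "\<lambda>j. link n (n + j)" \<epsilon>
  proof
    show "\<exists>\<delta>>0. \<forall>y\<in>bd. \<forall>z\<in>bd. dist y z < \<delta> \<longrightarrow> link n (n + m) y z" for m
    proof -
      obtain \<delta> where "\<delta> > 0" "\<And>x y::nat \<Rightarrow> 'a. dist x y < \<delta> \<Longrightarrow> dist (x (n + m)) (y (n + m)) < 1/2"
        using dist_fun_imp_component[of "1/2" "n + m"] by auto
      then show ?thesis using link_near[of _ _ n "n + m"] le_add1 by blast
    qed
    show "\<exists>y\<in>T. \<exists>\<eta>>0. \<forall>z\<in>T. \<forall>w\<in>T. dist y z < \<eta> \<longrightarrow> dist y w < \<eta> \<longrightarrow> (\<forall>m. link n (n + m) z w)"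
      if "closed T" "T \<subseteq> bd" "T \<noteq> {}" for T
    proof -
      have "\<exists>y\<in>T. \<exists>\<eta>>0. \<forall>z\<in>T. \<forall>w\<in>T. dist y z < \<eta> \<longrightarrow> dist y w < \<eta> \<longrightarrow> (\<forall>m\<ge>n. link n m z w)"
        by (rule link_fragment[where n = n and x = x and T = T and \<epsilon> = \<epsilon>]) fact+
      then show ?thesis using le_add1[of n] by meson
    qed
    show "link n (n + m) z y" if "y \<in> bd" "z \<in> bd" "dist y z < \<epsilon>" "link n (n + m) y z" for y z m
      using link_sym \<epsilon>(2) that by blast
    show "link n (n + m) y w" if "y \<in> bd" "z \<in> bd" "w \<in> bd" "dist y z < \<epsilon>" "dist z w < \<epsilon>"
      "link n (n + m) y z" "link n (n + m) z w" for y z w m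
      using link_trans \<epsilon>(2) that by blast
    show "link n (n + m) y z" if "y \<in> bd" "z \<in> bd" "link n (n + Suc m) y z" for y z m
      using link_decreasing[OF that(1,2), of n "n + m"] that(3) by simp
  qed (use compact_bd connected_bd \<epsilon> in auto)
  obtain \<delta> where \<delta>: "\<delta> > 0" "\<And>y z m. y \<in> bd \<Longrightarrow> z \<in> bd \<Longrightarrow> dist y z < \<delta> \<Longrightarrow> link n (n + m) y z"
    using stable_Z unfolding stable_def by blast
  obtain k \<eta> where k: "k \<ge> n" "\<eta> > 0" "\<forall>y\<in>bd. \<forall>z\<in>bd. dist (y k) (z k) < \<eta> \<longrightarrow> dist y z < \<delta>"
    using bd_close[OF \<delta>(1), of n] by blast
  have "link n m y z" if "y \<in> bd" "z \<in> bd" "dist (y k) (z k) < \<eta>" "m \<ge> n" for y z m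
    using \<delta>(2)[of y z "m - n"] k(3) that by simp
  then show ?thesis using k(1,2) by blast
qed

end

section \<open>Pushing loops to infinity\<close>

context pointed_cat0
begin

text \<open>
  A path is homotopic to its projection, conjugated by the radial segments at its ends; the segments
  are the same for \<open>P\<close> and \<open>Q\<close>.
\<close>

lemma homotopic_paths_unproject:
  assumes "0 \<le> s" "\<And>t. t \<in> {0..1} \<Longrightarrow> s \<le> rad (P t)" "\<And>t. t \<in> {0..1} \<Longrightarrow> s \<le> rad (Q t)"
    and PQ: "path P" "path Q" "pathstart P = pathstart Q" "pathfinish P = pathfinish Q" and "s' < s"
    and hom: "homotopic_paths (far s') (proj s \<circ> P) (proj s \<circ> Q)"
  shows "homotopic_paths (far s') P Q"
proof -
  \<comment> \<open>the radial segment from \<open>w\<close> to its projection\<close>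
  define track where "track w u = proj ((1 - u) * rad w + u * s) w" for w u
  have *: "homotopic_paths (far s') R (track (pathstart R) +++ ((proj s \<circ> R) +++ reversepath (track (pathfinish R))))
      \<and> homotopic_paths (far s') (track (pathstart R)) (track (pathstart R))
      \<and> homotopic_paths (far s') (track (pathfinish R)) (track (pathfinish R))"
    if R: "path R" "\<And>t. t \<in> {0..1} \<Longrightarrow> s \<le> rad (R t)" for R
  proof -
    let ?h = "\<lambda>p. track (R (snd p)) (fst p)"
    have nn: "s \<le> (1 - u) * rad w + u * s" if "u \<in> {0..1}" "s \<le> rad w" for u w
    proof -
      have "(1 - u) * (rad w - s) \<ge> 0" using that by simp
      then show ?thesis by (simp add: algebra_simps)
    qed
    have c: "continuous_on ({0..1} \<times> {0..1}) (\<lambda>p::real\<times>real. R (snd p))"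
      using R(1) unfolding path_def
      by (auto intro: continuous_on_compose2[OF _ continuous_on_snd[OF continuous_on_id]])
    have cont: "continuous_on ({0..1} \<times> {0..1}) ?h"
      unfolding track_def
    proof (intro continuous_intros c)
      fix p :: "real \<times> real" assume "p \<in> {0..1} \<times> {0..1}"
      then have "s \<le> (1 - fst p) * rad (R (snd p)) + fst p * s" by (intro nn R) auto
      then show "0 \<le> (1 - fst p) * rad (R (snd p)) + fst p * s" using assms(1) by linarith
    qed
    have im: "?h ` ({0..1} \<times> {0..1}) \<subseteq> far s'"
    proof (rule image_subsetI)
      fix p :: "real \<times> real" assume p: "p \<in> {0..1} \<times> {0..1}"
      have "s \<le> (1 - fst p) * rad (R (snd p)) + fst p * s" using p by (intro nn R) auto
      moreover have "s \<le> rad (R (snd p))" using p by (intro R(2)) auto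
      ultimately show "?h p \<in> far s'" unfolding track_def mem_far using assms(1,8) by (simp add: rad_proj)
    qed
    have tr: "path (track (R t))" "path_image (track (R t)) \<subseteq> far s'" if "t \<in> {0..1}" for t
    proof -
      show "path (track (R t))" unfolding path_def
        by (rule continuous_on_compose2[OF cont, of _ "\<lambda>u. (u, t)", simplified])
          (use that in \<open>auto intro!: continuous_intros\<close>)
      show "path_image (track (R t)) \<subseteq> far s'"
        using im that unfolding path_image_def image_subset_iff by (auto simp: Ball_def)
    qed
    have "homotopic_paths (far s') (\<lambda>t. ?h (0, t))
      ((\<lambda>s. ?h (s, 0)) +++ ((\<lambda>t. ?h (1, t)) +++ reversepath (\<lambda>s. ?h (s, 1))))"
      by (rule homotopic_paths_square[OF cont im])
    moreover have "(\<lambda>t. ?h (0, t)) = R" by (auto simp: track_def proj_id)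
    moreover have "(\<lambda>t. ?h (1, t)) = proj s \<circ> R" by (auto simp: track_def)
    moreover have "(\<lambda>s. ?h (s, 0)) = track (pathstart R)" "(\<lambda>s. ?h (s, 1)) = track (pathfinish R)"
      by (auto simp: pathstart_def pathfinish_def)
    ultimately show ?thesis using tr[of 0] tr[of 1] by (simp add: pathstart_def pathfinish_def)
  qed
  let ?a = "track (pathstart P)" and ?b = "reversepath (track (pathfinish P))"
  have P: "homotopic_paths (far s') P (?a +++ ((proj s \<circ> P) +++ ?b))" "homotopic_paths (far s') ?a ?a"
      "homotopic_paths (far s') ?b ?b"
    using *[OF PQ(1) assms(2)] by (simp_all add: homotopic_paths_reversepath)
  have Q: "homotopic_paths (far s') Q (?a +++ ((proj s \<circ> Q) +++ ?b))"
    using *[OF PQ(2) assms(3)] PQ(3,4) by simp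
  have tf: "pathfinish (track w) = proj s w" for w by (simp add: track_def pathfinish_def)
  have "homotopic_paths (far s') (?a +++ ((proj s \<circ> P) +++ ?b)) (?a +++ ((proj s \<circ> Q) +++ ?b))"
    by (intro homotopic_paths_join P(2,3) hom) (simp_all add: tf pathstart_compose pathfinish_compose)
  then show ?thesis
    using P(1) Q homotopic_paths_trans homotopic_paths_sym by metis
qed

text \<open>
  The loop \<open>\<theta>\<close> is cut into \<open>N\<close> short pieces and the division points are shadowed by boundary
  points.  By induction on \<open>j\<close>, the projection of the first \<open>j\<close> pieces, followed by a short geodesic to
  the shadow of the \<open>j\<close>-th division point, is up to homotopy the projection of a path at depth
  \<open>K\<close>.  In each step a link between two successive shadows is appended.  At both ends the shadow is \<open>x\<close>
  itself.
\<close>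

lemma push_outwards:
  assumes "x \<in> bd" "n \<le> k" "k \<le> m" "n \<le> K"
    and \<eta>: "0 < \<eta>" "\<eta> \<le> 1/2"
    and linked: "\<And>y z. y \<in> bd \<Longrightarrow> z \<in> bd \<Longrightarrow> dist (y k) (z k) < \<eta> \<Longrightarrow> link n K y z"
    and shadowed: "\<And>w. real m \<le> rad w \<Longrightarrow> \<exists>y\<in>bd. dist (proj (real k) w) (y k) < \<eta>/4"
    and \<theta>: "path \<theta>" "\<And>t. t \<in> {0..1} \<Longrightarrow> real m \<le> rad (\<theta> t)" "pathstart \<theta> = x i" "pathfinish \<theta> = x i" "m \<le> i"
  shows "\<exists>\<gamma>. path \<gamma> \<and> path_image \<gamma> \<subseteq> far (real K - 1) \<and> pathstart \<gamma> = x K \<and> pathfinish \<gamma> = x K \<and>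
    homotopic_paths (far (real n - 1)) (proj (real n) \<circ> \<gamma>) (proj (real n) \<circ> \<theta>)"
proof -
  let ?F = "far (real n - 1)"
  obtain N where N: "N > 0" "\<And>s t. s \<in> {0..1} \<Longrightarrow> t \<in> {0..1} \<Longrightarrow> \<bar>s - t\<bar> \<le> 1 / real N \<Longrightarrow> dist (\<theta> s) (\<theta> t) < \<eta>/8"
    using exists_uniform_subdivision[OF \<theta>(1), of "\<eta>/8"] \<eta>(1) by (meson divide_pos_pos zero_less_numeral)
  define node where "node j = \<theta> (real j / real N)" for j
  \<comment> \<open>the projection of the first \<open>j\<close> pieces of the loop\<close>
  define \<sigma> where "\<sigma> j s = proj (real n) (\<theta> (s * (real j / real N)))" for j s
  have unit: "real j / real N \<in> {0..1}" if "j \<le> N" for j using that N(1) by simp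
  have unit': "s * (real j / real N) \<in> {0..1}" if "j \<le> N" "s \<in> {0..1}" for j s
  proof -
    have "0 \<le> s * (real j / real N)" "s * (real j / real N) \<le> 1"
      using unit[OF that(1)] that(2) by (intro mult_nonneg_nonneg mult_le_one; simp)+
    then show ?thesis by simp
  qed
  have rad_node: "real m \<le> rad (node j)" if "j \<le> N" for j
    unfolding node_def by (rule \<theta>(2)[OF unit[OF that]])
  have rad\<sigma>: "rad (\<sigma> j s) = real n" if "j \<le> N" "s \<in> {0..1}" for j s
    using \<theta>(2)[OF unit'[OF that]] assms(2,3) unfolding \<sigma>_def by (simp add: rad_proj)
  have path\<sigma>: "path (\<sigma> j)" if "j \<le> N" for j
    unfolding path_def \<sigma>_def
  proof (intro continuous_intros)
    show "continuous_on {0..1} (\<lambda>s. \<theta> (s * (real j / real N)))"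
    proof (rule continuous_on_compose2[OF \<theta>(1)[unfolded path_def]])
      show "(\<lambda>s. s * (real j / real N)) ` {0..1} \<subseteq> {0..1}" by (intro image_subsetI unit'[OF that])
    qed (intro continuous_intros)
  qed simp
  have im\<sigma>: "path_image (\<sigma> j) \<subseteq> ?F" if "j \<le> N" for j
    using rad\<sigma>[OF that] unfolding path_image_def by (simp add: image_subset_iff mem_far)
  have \<sigma>s: "pathstart (\<sigma> j) = x n" for j
    using \<theta>(3) bd_proj[OF assms(1), of n i] assms(2,3) \<theta>(5) by (simp add: \<sigma>_def pathstart_def)
  have \<sigma>f: "pathfinish (\<sigma> j) = proj (real n) (node j)" for j
    by (simp add: \<sigma>_def pathfinish_def node_def)
  have projn: "dist (proj (real n) w) (y n) < 1/4" if "y \<in> bd" "dist (proj (real k) w) (y k) < \<eta>/4" for w y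
  proof -
    have "proj (real n) (proj (real k) w) = proj (real n) w" using assms(2) by (simp add: proj_proj)
    then have "dist (proj (real n) w) (y n) \<le> 2 * dist (proj (real k) w) (y k)"
      using proj_Lipschitz[of "real n" "proj (real k) w" "y k"] bd_proj[OF that(1) assms(2)] by simp
    then show ?thesis using that(2) \<eta>(2) by linarith
  qed
  have claim: "\<exists>\<gamma>. path \<gamma> \<and> path_image \<gamma> \<subseteq> far (real K - 1) \<and> pathstart \<gamma> = x K \<and> pathfinish \<gamma> = y K \<and>
      homotopic_paths ?F (proj (real n) \<circ> \<gamma>) (\<sigma> j +++ geod (proj (real n) (node j)) (y n))"
    if "j \<le> N" "y \<in> bd" "dist (proj (real k) (node j)) (y k) < \<eta>/4" for j y
    using that
  proof (induction j arbitrary: y)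
    case 0
    have n0: "node 0 = x i" using \<theta>(3) by (simp add: node_def pathstart_def)
    have pn: "proj (real n) (x i) = x n" "proj (real k) (x i) = x k"
      using assms(1-3) \<theta>(5) by (simp_all add: bd_proj)
    have "dist (x k) (y k) < \<eta>" using 0(3) n0 pn \<eta>(1) by simp
    then have "link n K x y" using linked assms(1) 0(2) by blast
    then obtain \<gamma> where g: "path \<gamma>" "path_image \<gamma> \<subseteq> far (real K - 1)" "pathstart \<gamma> = x K" "pathfinish \<gamma> = y K"
      "homotopic_paths ?F (proj (real n) \<circ> \<gamma>) (geod (x n) (y n))" by (rule linkE)
    have \<sigma>0: "\<sigma> 0 = (\<lambda>_. x n)" by (rule ext) (use \<theta>(3) pn in \<open>simp add: \<sigma>_def pathstart_def\<close>)
    have const: "homotopic_paths ?F ((\<lambda>_. x n) +++ geod (x n) (y n)) (geod (x n) (y n))"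
      by (rule homotopic_paths_const_join) (use homotopic_paths_imp_subset[OF g(5)] in \<open>auto simp: path_geod\<close>)
    have "homotopic_paths ?F (proj (real n) \<circ> \<gamma>) (\<sigma> 0 +++ geod (proj (real n) (node 0)) (y n))"
      unfolding \<sigma>0 n0 pn by (rule homotopic_paths_trans[OF g(5) homotopic_paths_sym[OF const]])
    then show ?case using g by blast
  next
    case (Suc j y')
    have j: "j \<le> N" using Suc.prems(1) by simp
    obtain y where y: "y \<in> bd" "dist (proj (real k) (node j)) (y k) < \<eta>/4"
      using shadowed[OF rad_node[OF j]] by blast
    obtain \<gamma> where g: "path \<gamma>" "path_image \<gamma> \<subseteq> far (real K - 1)" "pathstart \<gamma> = x K" "pathfinish \<gamma> = y K"
      "homotopic_paths ?F (proj (real n) \<circ> \<gamma>) (\<sigma> j +++ geod (proj (real n) (node j)) (y n))"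
      using Suc.IH[OF j y] by blast
    have step: "\<bar>real j / real N - real (Suc j) / real N\<bar> = 1 / real N"
      using N(1) by (simp add: field_simps)
    have nodes: "dist (node j) (node (Suc j)) < \<eta>/8"
      unfolding node_def by (rule N(2)[OF unit[OF j] unit[OF Suc.prems(1)]]) (simp only: step)
    have pk: "dist (proj (real k) (node j)) (proj (real k) (node (Suc j))) < \<eta>/4"
      using proj_Lipschitz[of "real k" "node j" "node (Suc j)"] nodes by simp
    have "dist (y k) (y' k) < \<eta>"
      using dist_triangle[of "y k" "y' k" "proj (real k) (node j)"]
        dist_triangle[of "proj (real k) (node j)" "y' k" "proj (real k) (node (Suc j))"] y(2) pk Suc.prems(3) \<eta>(1)
      by (simp add: dist_commute)
    then have "link n K y y'" using linked y(1) Suc.prems(2) by blast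
    then obtain \<gamma>' where g': "path \<gamma>'" "path_image \<gamma>' \<subseteq> far (real K - 1)" "pathstart \<gamma>' = y K" "pathfinish \<gamma>' = y' K"
      "homotopic_paths ?F (proj (real n) \<circ> \<gamma>') (geod (y n) (y' n))" by (rule linkE)
    let ?g1 = "geod (proj (real n) (node j)) (y n)" and ?g2 = "geod (y n) (y' n)"
      and ?g3 = "geod (proj (real n) (node (Suc j))) (y' n)"
    have b1: "proj (real n) (node j) \<in> ball (y n) 1" using projn[OF y] by (simp add: dist_commute)
    have pn: "dist (proj (real n) (node j)) (proj (real n) (node (Suc j))) < 1/4"
      using proj_Lipschitz[of "real n" "node j" "node (Suc j)"] nodes \<eta>(2) by simp
    have b3: "proj (real n) (node (Suc j)) \<in> ball (y n) 1"
      using dist_triangle[of "y n" "proj (real n) (node (Suc j))" "proj (real n) (node j)"] pn projn[OF y]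
      by (simp add: dist_commute)
    have b2: "y' n \<in> ball (y n) 1"
      using dist_triangle[of "y n" "y' n" "proj (real n) (node (Suc j))"] projn[OF Suc.prems(2,3)]
        dist_triangle[of "y n" "proj (real n) (node (Suc j))" "proj (real n) (node j)"] pn projn[OF y]
      by (simp add: dist_commute)
    have b0: "y n \<in> ball (y n) 1" by simp
    have Fb: "ball (y n) 1 \<subseteq> ?F" using ball_subset_far[of "real n" "y n"] y(1) by simp
    note i1 = path_image_geod_ball[OF b1 b0] and i2 = path_image_geod_ball[OF b0 b2]
      and i3 = path_image_geod_ball[OF b3 b2]
    have h1: "homotopic_paths ?F ((proj (real n) \<circ> \<gamma>) +++ (proj (real n) \<circ> \<gamma>')) ((\<sigma> j +++ ?g1) +++ ?g2)"
      by (rule homotopic_paths_join[OF g(5) g'(5)]) (use g g' in \<open>simp add: pathstart_compose pathfinish_compose\<close>)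
    have h2: "homotopic_paths ?F ((\<sigma> j +++ ?g1) +++ ?g2) (\<sigma> j +++ (?g1 +++ ?g2))"
      by (rule homotopic_paths_sym, rule homotopic_paths_assoc)
        (use path\<sigma>[OF j] im\<sigma>[OF j] \<sigma>f i1 i2 Fb in \<open>auto simp: path_geod\<close>)
    have h3: "homotopic_paths ?F (\<sigma> j +++ (?g1 +++ ?g2)) (\<sigma> (Suc j) +++ ?g3)"
    proof (rule homotopic_paths_close)
      show "path (\<sigma> j +++ (?g1 +++ ?g2))" "path (\<sigma> (Suc j) +++ ?g3)"
        using path\<sigma>[OF j] path\<sigma>[OF Suc.prems(1)] by (auto intro!: path_join_imp simp: path_geod \<sigma>f)
      show "pathstart (\<sigma> j +++ (?g1 +++ ?g2)) = pathstart (\<sigma> (Suc j) +++ ?g3)" by (simp add: \<sigma>s)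
      show "pathfinish (\<sigma> j +++ (?g1 +++ ?g2)) = pathfinish (\<sigma> (Suc j) +++ ?g3)" by simp
      show "\<exists>c. (\<sigma> j +++ (?g1 +++ ?g2)) t \<in> ball c 1 \<and> (\<sigma> (Suc j) +++ ?g3) t \<in> ball c 1 \<and> ball c 1 \<subseteq> ?F"
        if t: "t \<in> {0..1}" for t
      proof (cases "t \<le> 1/2")
        case True
        then have t2: "2 * t \<in> {0..1}" using t by auto
        have "\<bar>2 * t * (real j / real N) - 2 * t * (real (Suc j) / real N)\<bar> = 2 * t * \<bar>real j / real N - real (Suc j) / real N\<bar>"
          using t2 by (simp only: right_diff_distrib[symmetric] abs_mult) simp
        also have "\<dots> \<le> 1 * (1 / real N)" unfolding step using t2 by (intro mult_right_mono) auto
        finally have "dist (\<theta> (2 * t * (real j / real N))) (\<theta> (2 * t * (real (Suc j) / real N))) < \<eta>/8"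
          by (intro N(2) unit'[OF j t2] unit'[OF Suc.prems(1) t2]) simp
        then have "dist (\<sigma> j (2 * t)) (\<sigma> (Suc j) (2 * t)) < 1"
          using proj_Lipschitz[of "real n" "\<theta> (2 * t * (real j / real N))" "\<theta> (2 * t * (real (Suc j) / real N))"] \<eta>(2)
          unfolding \<sigma>_def by simp
        moreover have "ball (\<sigma> j (2 * t)) 1 \<subseteq> ?F" by (rule ball_subset_far) (simp add: rad\<sigma>[OF j t2])
        ultimately show ?thesis using True by (intro exI[of _ "\<sigma> j (2 * t)"]) (simp add: joinpaths_def)
      next
        case False
        then have t2: "2 * t - 1 \<in> {0..1}" using t by auto
        have "path_image (?g1 +++ ?g2) \<subseteq> ball (y n) 1" using i1 i2 by (simp add: path_image_join)
        then have "(?g1 +++ ?g2) (2 * t - 1) \<in> ball (y n) 1" "?g3 (2 * t - 1) \<in> ball (y n) 1"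
          using t2 i3 unfolding path_image_def by blast+
        then show ?thesis using False Fb by (intro exI[of _ "y n"]) (simp add: joinpaths_def[of "\<sigma> _"])
      qed
    qed
    have "homotopic_paths ?F (proj (real n) \<circ> (\<gamma> +++ \<gamma>')) (\<sigma> (Suc j) +++ ?g3)"
      unfolding path_compose_join by (rule homotopic_paths_trans[OF homotopic_paths_trans[OF h1 h2] h3])
    moreover have "path (\<gamma> +++ \<gamma>')" "path_image (\<gamma> +++ \<gamma>') \<subseteq> far (real K - 1)"
      "pathstart (\<gamma> +++ \<gamma>') = x K" "pathfinish (\<gamma> +++ \<gamma>') = y' K"
      using g g' by (auto simp: path_image_join)
    ultimately show ?case by blast
  qed
  have nodeN: "node N = x i" using \<theta>(4) N(1) by (simp add: node_def pathfinish_def)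
  have pk: "proj (real k) (x i) = x k" "proj (real n) (x i) = x n"
    using assms(1-3) \<theta>(5) by (simp_all add: bd_proj)
  obtain \<gamma> where g: "path \<gamma>" "path_image \<gamma> \<subseteq> far (real K - 1)" "pathstart \<gamma> = x K" "pathfinish \<gamma> = x K"
      "homotopic_paths ?F (proj (real n) \<circ> \<gamma>) (\<sigma> N +++ geod (x n) (x n))"
    using claim[of N x] assms(1) nodeN pk \<eta>(1) by auto
  have \<sigma>N: "\<sigma> N = proj (real n) \<circ> \<theta>" using N(1) by (auto simp: \<sigma>_def)
  have "homotopic_paths ?F (\<sigma> N +++ geod (x n) (x n)) (\<sigma> N +++ (\<lambda>_. x n))"
  proof (rule homotopic_paths_eq)
    show "(\<sigma> N +++ geod (x n) (x n)) t = (\<sigma> N +++ (\<lambda>_. x n)) t" if "t \<in> {0..1}" for t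
      using that by (simp add: joinpaths_def)
  qed (use homotopic_paths_imp_path[OF g(5)] homotopic_paths_imp_subset[OF g(5)] in auto)
  note eq = this
  have const: "homotopic_paths ?F (\<sigma> N +++ (\<lambda>_. x n)) (\<sigma> N)"
    by (rule homotopic_paths_join_const) (use path\<sigma> im\<sigma> \<sigma>f nodeN pk in auto)
  have "homotopic_paths ?F (proj (real n) \<circ> \<gamma>) (proj (real n) \<circ> \<theta>)"
    using homotopic_paths_trans[OF homotopic_paths_trans[OF g(5) eq] const] unfolding \<sigma>N .
  then show ?thesis using g by blast
qed

end

context one_ended_cat0
begin

text \<open>
  The Mittag-Leffler condition at infinity, in the form in which it is used: a loop
  outside the ball of radius \<open>m\<close>, based on the ray of \<open>x\<close>, can be replaced by one at an arbitrary depth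
  \<open>K\<close>, up to homotopies that take place near depth \<open>n\<close> or further out.
\<close>

theorem semistability_of_loops:
  assumes x: "x \<in> bd" "\<And>y. y \<in> bd \<Longrightarrow> properly_homotopic (ray x) (ray y)"
  shows "\<exists>m\<ge>n. \<forall>K\<ge>n. \<forall>\<theta> i. path \<theta> \<longrightarrow> (\<forall>t\<in>{0..1}. real m \<le> rad (\<theta> t)) \<longrightarrow> pathstart \<theta> = x i \<longrightarrow>
      pathfinish \<theta> = x i \<longrightarrow> m \<le> i \<longrightarrow>
      (\<exists>\<gamma>. path \<gamma> \<and> path_image \<gamma> \<subseteq> far (real K - 1) \<and> pathstart \<gamma> = x K \<and> pathfinish \<gamma> = x K \<and>
        homotopic_paths (far (real n - 1)) (proj (real n) \<circ> \<gamma>) (proj (real n) \<circ> \<theta>))"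
proof -
  obtain k \<eta>0 where k: "k \<ge> n" "\<eta>0 > 0"
    "\<And>y z m. y \<in> bd \<Longrightarrow> z \<in> bd \<Longrightarrow> dist (y k) (z k) < \<eta>0 \<Longrightarrow> m \<ge> n \<Longrightarrow> link n m y z"
    using link_uniform[OF x] by metis
  define \<eta> where "\<eta> = min \<eta>0 (1/2)"
  have \<eta>: "0 < \<eta>" "\<eta> \<le> 1/2" "\<eta> \<le> \<eta>0" using k(2) by (auto simp: \<eta>_def)
  obtain m where m: "m \<ge> k" "\<forall>w. real m \<le> rad w \<longrightarrow> (\<exists>y\<in>bd. dist (proj (real k) w) (y k) < \<eta>/4)"
    using shadow[of "\<eta>/4" k] \<eta>(1) by (meson divide_pos_pos zero_less_numeral)
  show ?thesis
  proof (intro exI[of _ m] conjI allI impI)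
    show "n \<le> m" using k m by simp
    fix K \<theta> i
    assume a: "n \<le> K" "path \<theta>" "\<forall>t\<in>{0..1}. real m \<le> rad (\<theta> t)" "pathstart \<theta> = x i" "pathfinish \<theta> = x i" "m \<le> i"
    show "\<exists>\<gamma>. path \<gamma> \<and> path_image \<gamma> \<subseteq> far (real K - 1) \<and> pathstart \<gamma> = x K \<and> pathfinish \<gamma> = x K \<and>
        homotopic_paths (far (real n - 1)) (proj (real n) \<circ> \<gamma>) (proj (real n) \<circ> \<theta>)"
    proof (rule push_outwards[OF x(1) k(1) m(1) a(1) \<eta>(1,2) _ _ a(2) _ a(4,5,6)])
      show "link n K y z" if "y \<in> bd" "z \<in> bd" "dist (y k) (z k) < \<eta>" for y z
        using k(3)[OF that(1,2) _ a(1)] that(3) \<eta>(3) by simp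
    qed (use m(2) a(3) in blast)+
  qed
qed

end

section \<open>Strips and their gluing\<close>

text \<open>
  Homotopies over the intervals from \<open>k\<close> to \<open>k + 1\<close> that agree where they meet are glued along the
  integral part of the first coordinate.
\<close>

lemma continuous_on_glue_strips:
  fixes f :: "nat \<Rightarrow> real \<times> real \<Rightarrow> 'b::metric_space"
  assumes cont: "\<And>k. continuous_on ({0..1} \<times> {0..1}) (f k)"
    and match: "\<And>k v. v \<in> {0..1} \<Longrightarrow> f k (1, v) = f (Suc k) (0, v)"
  shows "continuous_on ({0..} \<times> {0..1}) (\<lambda>p. f (nat \<lfloor>fst p\<rfloor>) (fst p - of_int \<lfloor>fst p\<rfloor>, snd p))"
proof -
  define G where "G p = f (nat \<lfloor>fst p\<rfloor>) (fst p - of_int \<lfloor>fst p\<rfloor>, snd p)" for p :: "real \<times> real"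
  have piece: "continuous_on ({real k..real k + 1} \<times> {0..1}) G" for k
  proof -
    have "continuous_on ({real k..real k + 1} \<times> {0..1}) (\<lambda>p. f k (fst p - real k, snd p))"
      by (rule continuous_on_compose2[OF cont[of k]]) (auto intro!: continuous_intros)
    moreover have "f k (fst p - real k, snd p) = G p" if p: "p \<in> {real k..real k + 1} \<times> {0..1}" for p
    proof (cases "fst p = real k + 1")
      case True
      then have "nat \<lfloor>fst p\<rfloor> = Suc k" "fst p - of_int \<lfloor>fst p\<rfloor> = 0" "fst p - real k = 1" by (auto simp: nat_eq_iff)
      then show ?thesis using match[of "snd p" k] p by (auto simp: G_def)
    next
      case False
      then have "real k \<le> fst p" "fst p < real k + 1" using p by auto
      then have "\<lfloor>fst p\<rfloor> = int k" by linarith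
      then show ?thesis by (simp add: G_def)
    qed
    ultimately show ?thesis using continuous_on_cong by (metis (no_types, lifting))
  qed
  have upto: "continuous_on ({0..real k} \<times> {0..1}) G" for k
  proof (induction k)
    case 0
    have "{0..real 0} \<times> {0..1} \<subseteq> {real 0..real 0 + 1} \<times> {0..1::real}" by auto
    then show ?case by (rule continuous_on_subset[OF piece])
  next
    case (Suc k)
    have "continuous_on ({0..real k} \<times> {0..1} \<union> {real k..real k + 1} \<times> {0..1}) G"
      by (rule continuous_on_closed_Un[OF _ _ Suc piece]) (auto intro!: closed_Times)
    moreover have "{0..real k} \<times> {0..1} \<union> {real k..real k + 1} \<times> {0..1} = {0..real (Suc k)} \<times> {0..1::real}"
      by auto
    ultimately show ?case by simp
  qed
  have "continuous_on ({0..} \<times> {0..1}) G"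
    unfolding continuous_on_iff
  proof (intro ballI allI impI)
    fix p :: "real \<times> real" and e :: real assume p: "p \<in> {0..} \<times> {0..1}" and e: "0 < e"
    obtain k :: nat where k: "fst p + 1 \<le> real k" using real_arch_simple by blast
    have pk: "p \<in> {0..real k} \<times> {0..1}" using p k by auto
    then obtain d where d: "d > 0" "\<And>q. q \<in> {0..real k} \<times> {0..1} \<Longrightarrow> dist q p < d \<Longrightarrow> dist (G q) (G p) < e"
      using upto[of k] e unfolding continuous_on_iff by metis
    show "\<exists>d>0. \<forall>q\<in>{0..} \<times> {0..1}. dist q p < d \<longrightarrow> dist (G q) (G p) < e"
    proof (intro exI[of _ "min d 1"] conjI ballI impI)
      fix q :: "real \<times> real" assume q: "q \<in> {0..} \<times> {0..1}" "dist q p < min d 1"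
      have "dist (fst q) (fst p) \<le> dist q p" by (rule dist_fst_le)
      then have "\<bar>fst q - fst p\<bar> < 1" using q(2) unfolding dist_real_def by linarith
      then have "fst q \<le> real k" using k by linarith
      then have "q \<in> {0..real k} \<times> {0..1}" using q(1) by auto
      then show "dist (G q) (G p) < e" using d(2) q(2) by simp
    qed (use d(1) in simp)
  qed
  then show ?thesis unfolding G_def .
qed

text \<open>
  A homotopy from the path \<open>p\<close> to the path \<open>q\<close> whose ends move along the curves \<open>c\<close> and \<open>a\<close> with the
  common time \<open>\<sigma>\<close>.
\<close>

definition strip ::
  "'b::metric_space set \<Rightarrow> (real \<Rightarrow> 'b) \<Rightarrow> (real \<Rightarrow> 'b) \<Rightarrow> (real \<Rightarrow> real) \<Rightarrow> (real \<Rightarrow> 'b) \<Rightarrow> (real \<Rightarrow> 'b) \<Rightarrow> bool" where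
  "strip S c a \<sigma> p q \<longleftrightarrow> path \<sigma> \<and>
     (\<exists>h. continuous_on ({0..1} \<times> {0..1}) h \<and> h ` ({0..1} \<times> {0..1}) \<subseteq> S \<and>
        (\<forall>v\<in>{0..1}. h (0, v) = p v) \<and> (\<forall>v\<in>{0..1}. h (1, v) = q v) \<and>
        (\<forall>s\<in>{0..1}. h (s, 0) = c (\<sigma> s)) \<and> (\<forall>s\<in>{0..1}. h (s, 1) = a (\<sigma> s)))"

lemma strip_homotopic_paths:
  fixes p q :: "real \<Rightarrow> 'a::metric_space"
  assumes "homotopic_paths S p q" "pathstart p = c \<tau>" "pathfinish p = a \<tau>"
  shows "strip S c a (\<lambda>_. \<tau>) p q"
proof -
  obtain h :: "real \<times> real \<Rightarrow> 'a" where h: "continuous_on ({0..1} \<times> {0..1}) h" "h \<in> {0..1} \<times> {0..1} \<rightarrow> S"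
    "\<forall>v\<in>{0..1}. h (0, v) = p v" "\<forall>v\<in>{0..1}. h (1, v) = q v"
    "\<forall>t\<in>{0..1}. pathstart (h \<circ> Pair t) = pathstart p \<and> pathfinish (h \<circ> Pair t) = pathfinish p"
    using assms(1) unfolding homotopic_paths by blast
  have "path (\<lambda>_::real. \<tau>)" by (simp add: path_def)
  moreover have "\<forall>s\<in>{0..1}. h (s, 0) = c \<tau>" "\<forall>s\<in>{0..1}. h (s, 1) = a \<tau>"
    using h(5) assms(2,3) by (simp_all add: pathstart_def[of "h \<circ> _"] pathfinish_def[of "h \<circ> _"])
  ultimately show ?thesis unfolding strip_def using h(1-4)
    by (intro conjI exI[of _ h]) (auto simp: image_subset_iff_funcset)
qed

lemma strip_join:
  assumes "strip S c a \<sigma> p q" "strip S c a \<sigma>' q r" "pathfinish \<sigma> = pathstart \<sigma>'"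
  shows "strip S c a (\<sigma> +++ \<sigma>') p r"
proof -
  obtain h where h: "path \<sigma>" "continuous_on ({0..1} \<times> {0..1}) h" "h ` ({0..1} \<times> {0..1}) \<subseteq> S"
    "\<forall>v\<in>{0..1}. h (0, v) = p v" "\<forall>v\<in>{0..1}. h (1, v) = q v"
    "\<forall>s\<in>{0..1}. h (s, 0) = c (\<sigma> s)" "\<forall>s\<in>{0..1}. h (s, 1) = a (\<sigma> s)"
    using assms(1) unfolding strip_def by blast
  obtain h' where h': "path \<sigma>'" "continuous_on ({0..1} \<times> {0..1}) h'" "h' ` ({0..1} \<times> {0..1}) \<subseteq> S"
    "\<forall>v\<in>{0..1}. h' (0, v) = q v" "\<forall>v\<in>{0..1}. h' (1, v) = r v"
    "\<forall>s\<in>{0..1}. h' (s, 0) = c (\<sigma>' s)" "\<forall>s\<in>{0..1}. h' (s, 1) = a (\<sigma>' s)"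
    using assms(2) unfolding strip_def by blast
  let ?H = "\<lambda>p. if fst p \<le> 1/2 then h (2 * fst p, snd p) else h' (2 * fst p - 1, snd p)"
  have "continuous_on ({0..1} \<times> {0..1}) ?H"
  proof (rule continuous_on_cases_le)
    show "continuous_on {p \<in> {0..1} \<times> {0..1}. fst p \<le> 1/2} (\<lambda>p. h (2 * fst p, snd p))"
      by (rule continuous_on_compose2[OF h(2)]) (auto intro!: continuous_intros)
    show "continuous_on {p \<in> {0..1} \<times> {0..1}. 1/2 \<le> fst p} (\<lambda>p. h' (2 * fst p - 1, snd p))"
      by (rule continuous_on_compose2[OF h'(2)]) (auto intro!: continuous_intros)
    show "h (2 * fst x, snd x) = h' (2 * fst x - 1, snd x)"
      if "x \<in> {0..1} \<times> {0..1}" "fst x = 1/2" for x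
    proof -
      have "snd x \<in> {0..1}" using that(1) by auto
      moreover have e: "2 * fst x = 1" "2 * fst x - 1 = 0" using that(2) by simp_all
      ultimately show ?thesis unfolding e using h(5) h'(4) by simp
    qed
  qed (intro continuous_intros)
  moreover have "?H ` ({0..1} \<times> {0..1}) \<subseteq> S"
  proof (rule image_subsetI)
    fix x :: "real \<times> real" assume x: "x \<in> {0..1} \<times> {0..1}"
    show "?H x \<in> S"
    proof (cases "fst x \<le> 1/2")
      case True
      then have "(2 * fst x, snd x) \<in> {0..1} \<times> {0..1}" using x by auto
      then show ?thesis using h(3) True by auto
    next
      case False
      then have "(2 * fst x - 1, snd x) \<in> {0..1} \<times> {0..1}" using x by auto
      then show ?thesis using h'(3) False by auto
    qed
  qed
  moreover have "path (\<sigma> +++ \<sigma>')" using h(1) h'(1) assms(3) by simp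
  moreover have "?H (0, v) = p v" "?H (1, v) = r v" if "v \<in> {0..1}" for v
    using h(4) h'(5) that by simp_all
  moreover have "?H (s, 0) = c ((\<sigma> +++ \<sigma>') s)" "?H (s, 1) = a ((\<sigma> +++ \<sigma>') s)" if "s \<in> {0..1}" for s
    using h(6,7) h'(6,7) that by (simp_all add: joinpaths_def)
  ultimately show ?thesis unfolding strip_def by (intro conjI exI[of _ ?H] ballI)
qed

text \<open>
  The ends of \<open>\<beta>\<close> slide along \<open>c\<close> and \<open>a\<close> from time \<open>\<tau>\<close> to time \<open>\<tau>'\<close>; the path keeps the parts of the
  curves behind them as a tail.
\<close>

lemma strip_slide:
  assumes c: "continuous_on {0..} c" and a: "continuous_on {0..} a" and \<beta>: "path \<beta>"
    "pathstart \<beta> = c \<tau>" "pathfinish \<beta> = a \<tau>" "0 \<le> \<tau>" "\<tau> \<le> \<tau>'"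
    and S: "path_image \<beta> \<subseteq> S" "\<And>t. t \<ge> \<tau> \<Longrightarrow> c t \<in> S" "\<And>t. t \<ge> \<tau> \<Longrightarrow> a t \<in> S"
  shows "strip S c a (linepath \<tau> \<tau>') ((\<lambda>_. c \<tau>) +++ (\<beta> +++ (\<lambda>_. a \<tau>)))
    ((c \<circ> linepath \<tau>' \<tau>) +++ (\<beta> +++ (a \<circ> linepath \<tau> \<tau>')))"
proof -
  let ?t = "\<lambda>s v. \<tau> + s * v * (\<tau>' - \<tau>)"
  let ?p = "\<lambda>s v. c (?t s (1 - v))" and ?q = "\<lambda>s v. a (?t s v)"
  let ?H = "\<lambda>x. (?p (fst x) +++ (\<beta> +++ ?q (fst x))) (snd x)"
  have t: "\<tau> \<le> ?t s v" if "s \<in> {0..1}" "v \<in> {0..1}" for s v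
    using that \<beta>(5) by simp
  then have t0: "0 \<le> ?t s v" if "s \<in> {0..1}" "v \<in> {0..1}" for s v
    using that \<beta>(4) order_trans by blast
  have "continuous_on ({0..1} \<times> {0..1}) ?H"
  proof (intro continuous_on_homotopic_join_lemma)
    show "continuous_on ({0..1} \<times> {0..1}) (\<lambda>y::real\<times>real. c (?t (fst y) (1 - snd y)))"
      by (rule continuous_on_compose2[OF c]) (auto intro!: continuous_intros t0)
    show "continuous_on ({0..1} \<times> {0..1}) (\<lambda>y::real\<times>real. a (?t (fst y) (snd y)))"
      by (rule continuous_on_compose2[OF a]) (auto intro!: continuous_intros t0)
    show "continuous_on ({0..1} \<times> {0..1}) (\<lambda>y::real\<times>real. \<beta> (snd y))"
      using \<beta>(1) unfolding path_def
      by (auto intro: continuous_on_compose2[OF _ continuous_on_snd[OF continuous_on_id]])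
  qed (use \<beta> in \<open>auto simp: pathstart_def pathfinish_def joinpaths_def\<close>)
  moreover have "?H ` ({0..1} \<times> {0..1}) \<subseteq> S"
  proof (rule image_subsetI)
    fix x :: "real \<times> real" assume x: "x \<in> {0..1} \<times> {0..1}"
    have "path_image (?p (fst x)) \<subseteq> S" "path_image (?q (fst x)) \<subseteq> S"
      unfolding path_image_def using S(2,3) t x by auto
    then have "path_image (?p (fst x) +++ (\<beta> +++ ?q (fst x))) \<subseteq> S"
      using S(1) by (intro subset_path_image_join)
    then show "?H x \<in> S" using x unfolding path_image_def by auto
  qed
  moreover have "?p 1 = c \<circ> linepath \<tau>' \<tau>" "?q 1 = a \<circ> linepath \<tau> \<tau>'"
    by (auto simp: linepath_def algebra_simps)
  then have "?H (1, v) = ((c \<circ> linepath \<tau>' \<tau>) +++ (\<beta> +++ (a \<circ> linepath \<tau> \<tau>'))) v" for v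
    by (simp only: fst_conv snd_conv)
  moreover have "?H (0, v) = ((\<lambda>_. c \<tau>) +++ (\<beta> +++ (\<lambda>_. a \<tau>))) v" for v by simp
  moreover have "?H (s, 0) = c (linepath \<tau> \<tau>' s)" "?H (s, 1) = a (linepath \<tau> \<tau>' s)" for s
    by (simp_all add: joinpaths_def linepath_def algebra_simps)
  ultimately show ?thesis unfolding strip_def
    by (intro conjI exI[of _ ?H] path_linepath ballI)
qed

section \<open>Proper homotopies of rays\<close>

lemma properly_homotopic_sym:
  assumes "properly_homotopic c c'" shows "properly_homotopic c' (c :: real \<Rightarrow> 'b::metric_space)"
proof -
  obtain H :: "real \<times> real \<Rightarrow> 'b" where H: "proper_continuous_on ({0..} \<times> {0..1}) H"
    "\<forall>t\<ge>0. H (t, 0) = c t" "\<forall>t\<ge>0. H (t, 1) = c' t"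
    using assms unfolding properly_homotopic_def by blast
  let ?f = "\<lambda>p::real\<times>real. (fst p, 1 - snd p)"
  have "proper_continuous_on ({0..} \<times> {0..1}) (H \<circ> ?f)"
    unfolding proper_continuous_on_def
  proof (intro conjI allI impI)
    show "continuous_on ({0..} \<times> {0..1}) (H \<circ> ?f)"
      using H(1) unfolding proper_continuous_on_def
      by (intro continuous_on_compose) (auto intro!: continuous_intros elim: continuous_on_subset)
    fix K :: "'b set" assume "compact K"
    then have "compact {x \<in> {0..} \<times> {0..1}. H x \<in> K}" using H(1) unfolding proper_continuous_on_def by blast
    then have "compact (?f ` {x \<in> {0..} \<times> {0..1}. H x \<in> K})"
      by (intro compact_continuous_image continuous_intros)
    moreover have "?f ` {x \<in> {0..} \<times> {0..1}. H x \<in> K} = {x \<in> {0..} \<times> {0..1}. (H \<circ> ?f) x \<in> K}"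
    proof (intro equalityI subsetI)
      fix x assume x: "x \<in> {x \<in> {0..} \<times> {0..1}. (H \<circ> ?f) x \<in> K}"
      then have "?f x \<in> {x \<in> {0..} \<times> {0..1}. H x \<in> K}" by auto
      moreover have "x = ?f (?f x)" by simp
      ultimately show "x \<in> ?f ` {x \<in> {0..} \<times> {0..1}. H x \<in> K}" by (rule rev_image_eqI)
    qed auto
    ultimately show "compact {x \<in> {0..} \<times> {0..1}. (H \<circ> ?f) x \<in> K}" by simp
  qed
  then show ?thesis unfolding properly_homotopic_def using H(2,3) by (intro exI[of _ "H \<circ> ?f"]) auto
qed

context pointed_cat0
begin

lemma properly_homotopicI:
  fixes H :: "real \<times> real \<Rightarrow> 'a"
  assumes "continuous_on ({0..} \<times> {0..1}) H" "\<And>M. \<exists>T\<ge>0. \<forall>t\<ge>T. \<forall>s\<in>{0..1}. M < rad (H (t, s))"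
    "\<And>t. t \<ge> 0 \<Longrightarrow> H (t, 0) = c t" "\<And>t. t \<ge> 0 \<Longrightarrow> H (t, 1) = c' t"
  shows "properly_homotopic c c'"
  unfolding properly_homotopic_def proper_iff by (intro exI[of _ H] conjI allI impI assms)

lemma properly_homotopicE:
  assumes "properly_homotopic c (c' :: real \<Rightarrow> 'a)"
  obtains H :: "real \<times> real \<Rightarrow> 'a" where "continuous_on ({0..} \<times> {0..1}) H"
    "\<forall>M. \<exists>T\<ge>0. \<forall>t\<ge>T. \<forall>s\<in>{0..1}. M < rad (H (t, s))"
    "\<forall>t\<ge>0. H (t, 0) = c t" "\<forall>t\<ge>0. H (t, 1) = c' t"
  using assms unfolding properly_homotopic_def proper_iff by (elim exE conjE) (rule that)

lemma properly_homotopic_trans: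
  assumes "properly_homotopic c c'" "properly_homotopic c' c''"
  shows "properly_homotopic c (c'' :: real \<Rightarrow> 'a)"
proof -
  obtain H :: "real \<times> real \<Rightarrow> 'a" where H: "continuous_on ({0..} \<times> {0..1}) H"
    "\<forall>M. \<exists>T\<ge>0. \<forall>t\<ge>T. \<forall>s\<in>{0..1}. M < rad (H (t, s))"
    "\<forall>t\<ge>0. H (t, 0) = c t" "\<forall>t\<ge>0. H (t, 1) = c' t" using assms(1) by (rule properly_homotopicE) (rule that)
  obtain H' :: "real \<times> real \<Rightarrow> 'a" where H': "continuous_on ({0..} \<times> {0..1}) H'"
    "\<forall>M. \<exists>T\<ge>0. \<forall>t\<ge>T. \<forall>s\<in>{0..1}. M < rad (H' (t, s))"
    "\<forall>t\<ge>0. H' (t, 0) = c' t" "\<forall>t\<ge>0. H' (t, 1) = c'' t" using assms(2) by (rule properly_homotopicE) (rule that)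
  let ?G = "\<lambda>p::real\<times>real. if snd p \<le> 1/2 then H (fst p, 2 * snd p) else H' (fst p, 2 * snd p - 1)"
  show ?thesis
  proof (rule properly_homotopicI[of ?G])
    show "continuous_on ({0..} \<times> {0..1}) ?G"
    proof (rule continuous_on_cases_le)
      show "continuous_on {p \<in> {0..} \<times> {0..1}. snd p \<le> 1/2} (\<lambda>p. H (fst p, 2 * snd p))"
        by (rule continuous_on_compose2[OF H(1)]) (auto intro!: continuous_intros)
      show "continuous_on {p \<in> {0..} \<times> {0..1}. 1/2 \<le> snd p} (\<lambda>p. H' (fst p, 2 * snd p - 1))"
        by (rule continuous_on_compose2[OF H'(1)]) (auto intro!: continuous_intros)
      show "H (fst x, 2 * snd x) = H' (fst x, 2 * snd x - 1)"
        if "x \<in> {0..} \<times> {0..1}" "snd x = 1/2" for x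
      proof -
        have "fst x \<ge> 0" using that(1) by auto
          moreover have e: "2 * snd x = 1" "2 * snd x - 1 = 0" using that(2) by simp_all
        ultimately show ?thesis unfolding e using H(4) H'(3) by simp
      qed
    qed (intro continuous_intros)
    fix M
    obtain T where T: "T \<ge> 0" "\<forall>t\<ge>T. \<forall>s\<in>{0..1}. M < rad (H (t, s))" using H(2) by blast
    obtain T' where T': "T' \<ge> 0" "\<forall>t\<ge>T'. \<forall>s\<in>{0..1}. M < rad (H' (t, s))" using H'(2) by blast
    have "M < rad (?G (t, s))" if "t \<ge> max T T'" "s \<in> {0..1}" for t s
    proof (cases "s \<le> 1/2")
      case True
      then have "2 * s \<in> {0..1}" using that(2) by auto
      then have "M < rad (H (t, 2 * s))" using T(2) that(1) by (meson max.boundedE)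
      then show ?thesis using True by simp
    next
      case False
      then have "2 * s - 1 \<in> {0..1}" using that(2) by auto
      then have "M < rad (H' (t, 2 * s - 1))" using T'(2) that(1) by (meson max.boundedE)
      then show ?thesis using False by simp
    qed
    then show "\<exists>T\<ge>0. \<forall>t\<ge>T. \<forall>s\<in>{0..1}. M < rad (?G (t, s))"
      using T(1) by (intro exI[of _ "max T T'"]) (meson max.coboundedI1)
  qed (simp_all add: H(3) H'(4))
qed

lemma proper_ray_diverges:
  assumes "proper_ray a"
  shows "\<exists>T\<ge>0. \<forall>t\<ge>T. M < rad (a t)"
proof -
  have "compact {t \<in> {0..}. a t \<in> cball x0 M}"
    using assms proper unfolding proper_ray_def proper_continuous_on_def proper_metric_def by blast
  then obtain B where B: "\<forall>t\<in>{t \<in> {0..}. a t \<in> cball x0 M}. norm t \<le> B"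
    using compact_imp_bounded bounded_iff by blast
  have "M < rad (a t)" if "t \<ge> \<bar>B\<bar> + 1" for t
  proof (rule ccontr)
    assume "\<not> ?thesis"
    then have "t \<in> {t \<in> {0..}. a t \<in> cball x0 M}" using that by (simp add: rad_def)
    then have "norm t \<le> B" using B by blast
    then show False using that by simp
  qed
  then show ?thesis by (intro exI[of _ "\<bar>B\<bar> + 1"]) simp
qed

text \<open>
  The straight-line homotopy between \<open>\<sigma>\<close> and the identity stays above the minimum of \<open>\<sigma> t\<close> and \<open>t\<close>.
\<close>

lemma properly_homotopic_reparametrization:
  assumes a: "continuous_on {0..} (a :: real \<Rightarrow> 'a)" "\<And>M. \<exists>T\<ge>0. \<forall>t\<ge>T. M < rad (a t)"
    and \<sigma>: "continuous_on {0..} \<sigma>" "\<And>t. t \<ge> 0 \<Longrightarrow> \<sigma> t \<ge> 0" "\<And>M. \<exists>T\<ge>0. \<forall>t\<ge>T. M \<le> \<sigma> t"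
  shows "properly_homotopic (a \<circ> \<sigma>) a"
proof (rule properly_homotopicI)
  let ?t = "\<lambda>p::real\<times>real. (1 - snd p) * \<sigma> (fst p) + snd p * fst p"
  let ?H = "\<lambda>p. a (?t p)"
  have c\<sigma>: "continuous_on ({0..} \<times> {0..1}) (\<lambda>p::real\<times>real. \<sigma> (fst p))"
    by (rule continuous_on_compose2[OF \<sigma>(1)]) (auto intro!: continuous_intros)
  show "continuous_on ({0..} \<times> {0..1}) ?H"
  proof (rule continuous_on_compose2[OF a(1)])
    show "continuous_on ({0..} \<times> {0..1}) ?t" by (intro continuous_intros c\<sigma>)
    show "?t ` ({0..} \<times> {0..1}) \<subseteq> {0..}"
    proof (rule image_subsetI)
      fix p :: "real \<times> real" assume "p \<in> {0..} \<times> {0..1}"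
      then have p: "0 \<le> fst p" "0 \<le> snd p" "snd p \<le> 1" by auto
      then have "0 \<le> ?t p" using \<sigma>(2)[OF p(1)] by (intro add_nonneg_nonneg mult_nonneg_nonneg) simp_all
      then show "?t p \<in> {0..}" by simp
    qed
  qed
  fix M
  obtain T where T: "T \<ge> 0" "\<forall>t\<ge>T. M < rad (a t)" using a(2)[of M] by blast
  obtain T' where T': "T' \<ge> 0" "\<forall>t\<ge>T'. T \<le> \<sigma> t" using \<sigma>(3)[of T] by blast
  have "M < rad (?H (t, s))" if "t \<ge> max T T'" "s \<in> {0..1}" for t s
  proof -
    have "T \<le> \<sigma> t" "T \<le> t" using T' that(1) by auto
    then have "(1 - s) * T + s * T \<le> (1 - s) * \<sigma> t + s * t"
      using that(2) by (intro add_mono mult_left_mono) auto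
    then have "T \<le> (1 - s) * \<sigma> t + s * t" by (simp add: algebra_simps)
    then show ?thesis using T(2) by simp
  qed
  then show "\<exists>T\<ge>0. \<forall>t\<ge>T. \<forall>s\<in>{0..1}. M < rad (?H (t, s))"
    using T(1) by (intro exI[of _ "max T T'"]) (meson max.coboundedI1)
qed auto

lemma proper_ray_of_geodesic_ray:
  assumes "geodesic_ray (c :: real \<Rightarrow> 'a)"
  shows "proper_ray c"
proof -
  have d: "dist (c s) (c t) = dist s t" if "s \<ge> 0" "t \<ge> 0" for s t
    using assms that unfolding geodesic_ray_def isometric_on_def by simp
  have cont: "continuous_on {0..} c"
    unfolding continuous_on_iff using d by (metis atLeast_iff)
  have "compact {t \<in> {0..}. c t \<in> K}" if "compact K" for K
  proof -
    have "closed {t \<in> {0..}. c t \<in> K}"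
      using continuous_closed_preimage[OF cont _ compact_imp_closed[OF that]] by (simp add: vimage_def Int_def)
    moreover have "bounded {t \<in> {0..}. c t \<in> K}"
    proof -
      obtain B where B: "\<And>z. z \<in> K \<Longrightarrow> dist (c 0) z \<le> B"
        using compact_imp_bounded[OF \<open>compact K\<close>] bounded_any_center[of K "c 0"] by blast
      have "norm t \<le> B" if "t \<in> {t \<in> {0..}. c t \<in> K}" for t
        using B[of "c t"] d[of 0 t] that by (simp add: dist_real_def)
      then show ?thesis by (meson boundedI)
    qed
    ultimately show ?thesis by (simp add: compact_eq_bounded_closed)
  qed
  then show ?thesis using cont unfolding proper_ray_def proper_continuous_on_def by blast
qed

end

section \<open>Every proper ray is properly homotopic to a geodesic ray\<close>

context one_ended_cat0
begin

text \<open>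
  The tails of both rays lie in the unbounded component of the complement of a ball.
\<close>

lemma exists_connecting_path:
  assumes "x \<in> bd" "0 \<le> m" "m < \<tau>" "proper_ray a" "\<And>t. t \<ge> \<tau> \<Longrightarrow> m < rad (a t)"
  shows "\<exists>\<beta>. path \<beta> \<and> path_image \<beta> \<subseteq> far m \<and> pathstart \<beta> = ray x \<tau> \<and> pathfinish \<beta> = a \<tau>"
proof -
  have "connected (a ` {\<tau>..})"
  proof (rule connected_continuous_image)
    show "continuous_on {\<tau>..} a"
      using assms(2,3,4) unfolding proper_ray_def proper_continuous_on_def
      by (auto elim: continuous_on_subset)
  qed simp
  moreover have "a ` {\<tau>..} \<subseteq> far m" using assms(5) by (auto simp: mem_far)
  moreover have "\<exists>b\<in>a ` {\<tau>..}. R < rad b" for R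
  proof -
    obtain T where "\<forall>t\<ge>T. R < rad (a t)" using proper_ray_diverges[OF assms(4)] by blast
    then have "R < rad (a (max T \<tau>))" by simp
    then show ?thesis by (intro bexI[of _ "a (max T \<tau>)"]) auto
  qed
  ultimately obtain C where C: "connected C" "C \<subseteq> far m" "ray x ` {m<..} \<subseteq> C" "a ` {\<tau>..} \<subseteq> C"
    using unbounded_connected_sets_share_component[OF ray_tail[OF assms(1,2)]] by blast
  then have "path_component (far m) (ray x \<tau>) (a \<tau>)"
    using assms(3) by (intro connected_path_in_open[OF open_far C(1,2)]) auto
  then show ?thesis unfolding path_component_def by blast
qed

text \<open>
  Let \<open>L\<close> be \<open>\<beta>\<close> slid along the two rays.  Together with an arbitrary path \<open>\<beta>'\<close> further out between the
  same points it forms a loop based on the ray of \<open>x\<close>.  This loop is homotopic to a loop \<open>\<gamma>\<close> far out, so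
  \<open>L\<close> is homotopic to \<open>\<gamma>\<close> followed by \<open>\<beta>'\<close>.
\<close>

lemma exists_homotopic_outer_path:
  assumes x: "x \<in> bd" and a: "continuous_on {0..} a"
    and m: "n \<le> m" "\<And>K \<theta> i. \<lbrakk>n \<le> K; path \<theta>; \<forall>t\<in>{0..1}. real m \<le> rad (\<theta> t); pathstart \<theta> = x i; pathfinish \<theta> = x i; m \<le> i\<rbrakk>
      \<Longrightarrow> \<exists>\<gamma>. path \<gamma> \<and> path_image \<gamma> \<subseteq> far (real K - 1) \<and> pathstart \<gamma> = x K \<and> pathfinish \<gamma> = x K \<and>
        homotopic_paths (far (real n - 1)) (proj (real n) \<circ> \<gamma>) (proj (real n) \<circ> \<theta>)"
    and \<beta>: "path \<beta>" "path_image \<beta> \<subseteq> far (real m)" "pathstart \<beta> = ray x (real \<tau>)" "pathfinish \<beta> = a (real \<tau>)"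
    and \<beta>': "path \<beta>'" "path_image \<beta>' \<subseteq> far (real m')" "pathstart \<beta>' = ray x (real \<tau>')" "pathfinish \<beta>' = a (real \<tau>')"
    and \<tau>: "m < \<tau>" "\<tau> \<le> \<tau>'" "m \<le> m'" "m' < \<tau>'" "\<And>t. t \<ge> real \<tau> \<Longrightarrow> real m < rad (a t)"
  defines "L \<equiv> (ray x \<circ> linepath (real \<tau>') (real \<tau>)) +++ (\<beta> +++ (a \<circ> linepath (real \<tau>) (real \<tau>')))"
  shows "\<exists>\<beta>''. path \<beta>'' \<and> path_image \<beta>'' \<subseteq> far (real m') \<and> pathstart \<beta>'' = ray x (real \<tau>') \<and>
    pathfinish \<beta>'' = a (real \<tau>') \<and> homotopic_paths (far (real n - 1)) L \<beta>''"
proof -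
  let ?F = "far (real n - 1)"
  have seg: "path_image (linepath (real \<tau>) (real \<tau>')) \<subseteq> {real \<tau>..}" "path_image (linepath (real \<tau>') (real \<tau>)) \<subseteq> {real \<tau>..}"
    using \<tau>(2) by (auto simp: closed_segment_eq_real_ivl)
  have pc: "path (ray x \<circ> linepath (real \<tau>') (real \<tau>))"
  proof (rule path_continuous_image[OF path_linepath])
    show "continuous_on (path_image (linepath (real \<tau>') (real \<tau>))) (ray x)"
      by (rule continuous_on_subset[OF continuous_on_ray[OF x]]) (use seg(2) in force)
  qed
  have pa: "path (a \<circ> linepath (real \<tau>) (real \<tau>'))"
  proof (rule path_continuous_image[OF path_linepath])
    show "continuous_on (path_image (linepath (real \<tau>) (real \<tau>'))) a"
      by (rule continuous_on_subset[OF a]) (use seg(1) in force)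
  qed
  have ic: "path_image (ray x \<circ> linepath (real \<tau>') (real \<tau>)) \<subseteq> far (real m)"
  proof -
    have "ray x t \<in> far (real m)" if "t \<ge> real \<tau>" for t
    proof -
      have "0 \<le> t" using that by (rule order_trans[rotated]) simp
      then show ?thesis using x that \<tau>(1) by (simp add: mem_far)
    qed
    then show ?thesis using seg(2) unfolding path_image_compose by blast
  qed
  have ia: "path_image (a \<circ> linepath (real \<tau>) (real \<tau>')) \<subseteq> far (real m)"
    using seg(1) \<tau>(5) unfolding path_image_compose by (auto simp: mem_far subset_iff)
  have L: "path L" "path_image L \<subseteq> far (real m)" "pathstart L = ray x (real \<tau>')" "pathfinish L = a (real \<tau>')"
    using pc pa ic ia \<beta> unfolding L_def
    by (auto simp: pathstart_compose pathfinish_compose path_image_join)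
  have mF: "far (real m) \<subseteq> ?F" "far (real m') \<subseteq> ?F" using m(1) \<tau>(3) by (auto intro!: far_mono)
  let ?\<theta> = "L +++ reversepath \<beta>'"
  have \<theta>: "path ?\<theta>" "path_image ?\<theta> \<subseteq> far (real m)" "pathstart ?\<theta> = x \<tau>'" "pathfinish ?\<theta> = x \<tau>'"
    using L \<beta>' x far_mono[of "real m" "real m'"] \<tau>(3) by (auto simp: path_image_join)
  have rad\<theta>: "real m < rad (?\<theta> t)" if "t \<in> {0..1}" for t
    using \<theta>(2) that unfolding path_image_def mem_far[symmetric] by blast
  have "\<forall>t\<in>{0..1}. real m \<le> rad (?\<theta> t)" using rad\<theta> by (meson less_imp_le)
  then obtain \<gamma> where g: "path \<gamma>" "path_image \<gamma> \<subseteq> far (real \<tau>' - 1)" "pathstart \<gamma> = x \<tau>'" "pathfinish \<gamma> = x \<tau>'"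
    "homotopic_paths ?F (proj (real n) \<circ> \<gamma>) (proj (real n) \<circ> ?\<theta>)"
    using m(2)[of \<tau>' ?\<theta> \<tau>'] \<theta> m(1) \<tau> by auto
  have g': "path_image \<gamma> \<subseteq> far (real m')"
    using g(2) far_mono[of "real m'" "real \<tau>' - 1"] \<tau>(4) by auto
  have "homotopic_paths ?F \<gamma> ?\<theta>"
  proof (rule homotopic_paths_unproject[of "real n"])
    show "real n \<le> rad (\<gamma> t)" if "t \<in> {0..1}" for t
    proof -
      have "\<gamma> t \<in> far (real m')" using g' that unfolding path_image_def by blast
      then show ?thesis using m(1) \<tau>(3) by (simp add: mem_far)
    qed
    show "real n \<le> rad (?\<theta> t)" if "t \<in> {0..1}" for t using rad\<theta>[OF that] m(1) by simp
  qed (use g \<theta> in auto)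
  then have h1: "homotopic_paths ?F (\<gamma> +++ \<beta>') (?\<theta> +++ \<beta>')"
    by (rule homotopic_paths_join) (use g \<beta>' x mF in auto)
  have h2: "homotopic_paths ?F (?\<theta> +++ \<beta>') (L +++ (reversepath \<beta>' +++ \<beta>'))"
    by (rule homotopic_paths_sym, rule homotopic_paths_assoc) (use L \<beta>' mF in auto)
  have h3: "homotopic_paths ?F (L +++ (reversepath \<beta>' +++ \<beta>')) (L +++ (\<lambda>_. a (real \<tau>')))"
    by (rule homotopic_paths_join[OF _ homotopic_paths_reversepath_join]) (use L \<beta>' mF in auto)
  have h4: "homotopic_paths ?F (L +++ (\<lambda>_. a (real \<tau>'))) L"
    by (rule homotopic_paths_join_const) (use L mF in auto)
  have "homotopic_paths ?F L (\<gamma> +++ \<beta>')"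
    by (rule homotopic_paths_sym)
      (rule homotopic_paths_trans[OF homotopic_paths_trans[OF homotopic_paths_trans[OF h1 h2] h3] h4])
  moreover have "path (\<gamma> +++ \<beta>')" "path_image (\<gamma> +++ \<beta>') \<subseteq> far (real m')"
    "pathstart (\<gamma> +++ \<beta>') = ray x (real \<tau>')" "pathfinish (\<gamma> +++ \<beta>') = a (real \<tau>')"
    using g g' \<beta>' x by (auto simp: path_image_join)
  ultimately show ?thesis by blast
qed

text \<open>
  Three stages: constant tails are attached to \<open>\<beta>\<close>, its ends slide along \<open>c\<close> and \<open>a\<close>, and the given
  homotopy is performed while the ends rest at time \<open>\<tau>'\<close>.
\<close>

lemma strip_between:
  assumes c: "continuous_on {0..} c" and a: "continuous_on {0..} a" and \<beta>: "path \<beta>" "path_image \<beta> \<subseteq> S"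
    "pathstart \<beta> = c \<tau>" "pathfinish \<beta> = a \<tau>" "0 \<le> \<tau>" "\<tau> \<le> \<tau>'"
    and S: "\<And>t. t \<ge> \<tau> \<Longrightarrow> c t \<in> S" "\<And>t. t \<ge> \<tau> \<Longrightarrow> a t \<in> S"
    and hom: "homotopic_paths S ((c \<circ> linepath \<tau>' \<tau>) +++ (\<beta> +++ (a \<circ> linepath \<tau> \<tau>'))) \<beta>'"
  shows "strip S c (a :: real \<Rightarrow> 'a) (((\<lambda>_. \<tau>) +++ linepath \<tau> \<tau>') +++ (\<lambda>_. \<tau>')) \<beta> \<beta>'"
proof (rule strip_join)
  show "strip S c a ((\<lambda>_. \<tau>) +++ linepath \<tau> \<tau>') \<beta> ((c \<circ> linepath \<tau>' \<tau>) +++ (\<beta> +++ (a \<circ> linepath \<tau> \<tau>')))"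
  proof (rule strip_join)
    have "homotopic_paths S (\<beta> +++ (\<lambda>_. a \<tau>)) \<beta>"
      by (rule homotopic_paths_join_const) (use \<beta> in auto)
    moreover have "homotopic_paths S ((\<lambda>_. c \<tau>) +++ (\<beta> +++ (\<lambda>_. a \<tau>))) (\<beta> +++ (\<lambda>_. a \<tau>))"
      by (rule homotopic_paths_const_join)
        (use \<beta> homotopic_paths_imp_path[OF calculation] homotopic_paths_imp_subset[OF calculation] in auto)
    ultimately have "homotopic_paths S \<beta> ((\<lambda>_. c \<tau>) +++ (\<beta> +++ (\<lambda>_. a \<tau>)))"
      by (meson homotopic_paths_sym homotopic_paths_trans)
    then show "strip S c a (\<lambda>_. \<tau>) \<beta> ((\<lambda>_. c \<tau>) +++ (\<beta> +++ (\<lambda>_. a \<tau>)))"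
      by (rule strip_homotopic_paths) (use \<beta> in auto)
    show "strip S c a (linepath \<tau> \<tau>') ((\<lambda>_. c \<tau>) +++ (\<beta> +++ (\<lambda>_. a \<tau>)))
      ((c \<circ> linepath \<tau>' \<tau>) +++ (\<beta> +++ (a \<circ> linepath \<tau> \<tau>')))"
      by (rule strip_slide[OF c a \<beta>(1,3,4,5,6,2) S])
    show "pathfinish (\<lambda>_. \<tau>) = pathstart (linepath \<tau> \<tau>')" by (simp add: pathfinish_def)
  qed
  show "strip S c a (\<lambda>_. \<tau>') ((c \<circ> linepath \<tau>' \<tau>) +++ (\<beta> +++ (a \<circ> linepath \<tau> \<tau>'))) \<beta>'"
    by (rule strip_homotopic_paths[OF hom]) (simp_all add: pathstart_compose pathfinish_compose)
  show "pathfinish ((\<lambda>_. \<tau>) +++ linepath \<tau> \<tau>') = pathstart (\<lambda>_. \<tau>')" by (simp add: pathstart_def)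
qed

text \<open>
  Gluing the strips gives a proper homotopy between \<open>c \<circ> \<sigma>h\<close> and \<open>a \<circ> \<sigma>h\<close>, where \<open>\<sigma>h\<close> is composed of
  the times \<open>\<sigma> j\<close>; reparametrization removes \<open>\<sigma>h\<close>.
\<close>

lemma properly_homotopic_of_strips:
  assumes c: "continuous_on {0..} c" "\<And>M. \<exists>T\<ge>0. \<forall>t\<ge>T. M < rad (c t)"
    and a: "continuous_on {0..} a" "\<And>M. \<exists>T\<ge>0. \<forall>t\<ge>T. M < rad (a t)"
    and strips: "\<And>j. strip (far (real j - 1)) c a (\<sigma> j) (\<beta> j) (\<beta> (Suc j))"
    and \<sigma>: "\<And>j. pathfinish (\<sigma> j) = pathstart (\<sigma> (Suc j))" "\<And>j s. s \<in> {0..1} \<Longrightarrow> real j \<le> \<sigma> j s"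
  shows "properly_homotopic c (a :: real \<Rightarrow> 'a)"
proof -
  \<comment> \<open>The strips are indexed by the integral part of \<open>t\<close> and run through with its fractional part.\<close>
  define fr where "fr t = t - of_int \<lfloor>t\<rfloor>" for t :: real
  have fr: "fr t \<in> {0..1}" for t unfolding fr_def by (simp add: less_imp_le) linarith
  define \<sigma>h where "\<sigma>h t = \<sigma> (nat \<lfloor>t\<rfloor>) (fr t)" for t
  have path\<sigma>: "path (\<sigma> j)" for j using strips[of j] unfolding strip_def by blast
  have "\<forall>j. \<exists>h. continuous_on ({0..1} \<times> {0..1}) h \<and> h ` ({0..1} \<times> {0..1}) \<subseteq> far (real j - 1) \<and>
        (\<forall>v\<in>{0..1}. h (0, v) = \<beta> j v) \<and> (\<forall>v\<in>{0..1}. h (1, v) = \<beta> (Suc j) v) \<and>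
        (\<forall>s\<in>{0..1}. h (s, 0) = c (\<sigma> j s)) \<and> (\<forall>s\<in>{0..1}. h (s, 1) = a (\<sigma> j s))"
    using strips unfolding strip_def by blast
  then obtain h :: "nat \<Rightarrow> real \<times> real \<Rightarrow> 'a" where h: "\<And>j. continuous_on ({0..1} \<times> {0..1}) (h j)"
    "\<And>j. h j ` ({0..1} \<times> {0..1}) \<subseteq> far (real j - 1)"
    "\<And>j v. v \<in> {0..1} \<Longrightarrow> h j (0, v) = \<beta> j v" "\<And>j v. v \<in> {0..1} \<Longrightarrow> h j (1, v) = \<beta> (Suc j) v"
    "\<And>j s. s \<in> {0..1} \<Longrightarrow> h j (s, 0) = c (\<sigma> j s)" "\<And>j s. s \<in> {0..1} \<Longrightarrow> h j (s, 1) = a (\<sigma> j s)"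
    by metis
  have cont\<sigma>: "continuous_on {0..} \<sigma>h"
  proof -
    have "continuous_on ({0..} \<times> {0..1}) (\<lambda>p. (\<lambda>k p. \<sigma> k (fst p)) (nat \<lfloor>fst p\<rfloor>) (fst p - of_int \<lfloor>fst p\<rfloor>, snd p :: real))"
    proof (rule continuous_on_glue_strips)
      show "continuous_on ({0..1} \<times> {0..1}) (\<lambda>p::real\<times>real. \<sigma> k (fst p))" for k
        using path\<sigma>[of k] unfolding path_def
        by (auto intro: continuous_on_compose2[OF _ continuous_on_fst[OF continuous_on_id]])
      show "\<sigma> k (fst (1, v)) = \<sigma> (Suc k) (fst (0, v))" for k and v :: real
        using \<sigma>(1)[of k] by (simp add: pathstart_def pathfinish_def)
    qed
    then have "continuous_on ({0..} \<times> {0..1}) (\<lambda>p::real\<times>real. \<sigma>h (fst p))" by (simp add: \<sigma>h_def fr_def)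
    then have "continuous_on {0..} (\<lambda>t. (\<lambda>p::real\<times>real. \<sigma>h (fst p)) (t, 0))"
      by (rule continuous_on_compose2) (auto intro!: continuous_intros)
    then show ?thesis by simp
  qed
  have \<sigma>ge: "real (nat \<lfloor>t\<rfloor>) \<le> \<sigma>h t" for t unfolding \<sigma>h_def by (rule \<sigma>(2)[OF fr])
  then have \<sigma>0: "0 \<le> \<sigma>h t" for t by (rule order_trans[rotated]) simp
  have \<sigma>div: "\<exists>T\<ge>0. \<forall>t\<ge>T. M \<le> \<sigma>h t" for M
  proof -
    have "M \<le> \<sigma>h t" if "t \<ge> \<bar>M\<bar> + 1" for t
    proof -
      have "M \<le> real (nat \<lfloor>t\<rfloor>)" using that by linarith
      then show ?thesis using \<sigma>ge[of t] by linarith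
    qed
    then show ?thesis by (intro exI[of _ "\<bar>M\<bar> + 1"]) simp
  qed
  have "properly_homotopic (c \<circ> \<sigma>h) (a \<circ> \<sigma>h)"
  proof (rule properly_homotopicI)
    let ?H = "\<lambda>p. h (nat \<lfloor>fst p\<rfloor>) (fst p - of_int \<lfloor>fst p\<rfloor>, snd p)"
    show "continuous_on ({0..} \<times> {0..1}) ?H"
      by (rule continuous_on_glue_strips[OF h(1)]) (simp add: h(3,4))
    show "?H (t, 0) = (c \<circ> \<sigma>h) t" "?H (t, 1) = (a \<circ> \<sigma>h) t" for t
      using h(5,6)[OF fr[of t]] by (simp_all add: \<sigma>h_def fr_def)
    fix M
    have "M < rad (?H (t, s))" if "t \<ge> \<bar>M\<bar> + 2" "s \<in> {0..1}" for t s
    proof -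
      have "(fr t, s) \<in> {0..1} \<times> {0..1}" using fr that(2) by blast
      then have "h (nat \<lfloor>t\<rfloor>) (fr t, s) \<in> far (real (nat \<lfloor>t\<rfloor>) - 1)" using h(2)[of "nat \<lfloor>t\<rfloor>"] by blast
      moreover have "M \<le> real (nat \<lfloor>t\<rfloor>) - 1" using that(1) by linarith
      ultimately show ?thesis by (simp add: mem_far fr_def)
    qed
    then show "\<exists>T\<ge>0. \<forall>t\<ge>T. \<forall>s\<in>{0..1}. M < rad (?H (t, s))"
      by (intro exI[of _ "\<bar>M\<bar> + 2"]) simp
  qed
  moreover have "properly_homotopic (c \<circ> \<sigma>h) c"
    by (rule properly_homotopic_reparametrization[OF c cont\<sigma> \<sigma>0 \<sigma>div])
  moreover have "properly_homotopic (a \<circ> \<sigma>h) a"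
    by (rule properly_homotopic_reparametrization[OF a cont\<sigma> \<sigma>0 \<sigma>div])
  ultimately show ?thesis
    using properly_homotopic_sym properly_homotopic_trans by meson
qed

text \<open>
  Depths \<open>N j\<close> are chosen such that loops beyond \<open>N (Suc j)\<close> can be pushed to infinity by homotopies
  beyond \<open>N j\<close>, and times \<open>\<tau> j\<close> after which both rays stay beyond \<open>N (Suc j)\<close>.  The paths \<open>\<beta> j\<close> are then
  constructed one after the other, each from its predecessor by \<open>exists_homotopic_outer_path\<close>.
\<close>

theorem proper_ray_homotopic_to_geodesic_ray:
  assumes x: "x \<in> bd" "\<And>y. y \<in> bd \<Longrightarrow> properly_homotopic (ray x) (ray y)"
    and a: "proper_ray a"
  shows "properly_homotopic (ray x) (a :: real \<Rightarrow> 'a)"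
proof -
  have ca: "continuous_on {0..} a" using a unfolding proper_ray_def proper_continuous_on_def by blast
  define push where "push n m \<longleftrightarrow> m \<ge> n \<and> (\<forall>K\<ge>n. \<forall>\<theta> i. path \<theta> \<longrightarrow> (\<forall>t\<in>{0..1}. real m \<le> rad (\<theta> t)) \<longrightarrow> pathstart \<theta> = x i \<longrightarrow>
      pathfinish \<theta> = x i \<longrightarrow> m \<le> i \<longrightarrow>
      (\<exists>\<gamma>. path \<gamma> \<and> path_image \<gamma> \<subseteq> far (real K - 1) \<and> pathstart \<gamma> = x K \<and> pathfinish \<gamma> = x K \<and>
        homotopic_paths (far (real n - 1)) (proj (real n) \<circ> \<gamma>) (proj (real n) \<circ> \<theta>)))" for n m
  have "\<forall>n. \<exists>m. push n m" unfolding push_def using semistability_of_loops[OF x] by blast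
  then obtain M where M: "\<And>n. push n (M n)" by metis
  define N where "N = rec_nat 0 (\<lambda>_ n. Suc (M n))"
  have N: "N 0 = 0" "\<And>j. N (Suc j) = Suc (M (N j))" by (simp_all add: N_def)
  have Mge: "n \<le> M n" for n using M[of n] unfolding push_def by blast
  have Nge: "j \<le> N j" for j
  proof (induction j)
    case (Suc j)
    then show ?case using Mge[of "N j"] N(2)[of j] by simp
  qed simp
  have "\<forall>j. \<exists>T. \<forall>t\<ge>T. real (N (Suc j)) < rad (a t)" using proper_ray_diverges[OF a] by blast
  then obtain T where T: "\<And>j t. t \<ge> T j \<Longrightarrow> real (N (Suc j)) < rad (a t)" by metis
  define \<tau> where "\<tau> j = (\<Sum>i\<le>j. nat \<lceil>T i\<rceil> + N (Suc i) + 1)" for j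
  have \<tau>mono: "\<tau> j \<le> \<tau> (Suc j)" for j by (simp add: \<tau>_def)
  have \<tau>ge: "nat \<lceil>T j\<rceil> + N (Suc j) + 1 \<le> \<tau> j" for j by (cases j) (simp_all add: \<tau>_def)
  have \<tau>N: "N (Suc j) < \<tau> j" "T j \<le> real (\<tau> j)" for j using \<tau>ge[of j] by linarith+
  have arad: "real (N (Suc j)) < rad (a t)" if "t \<ge> real (\<tau> j)" for j t
    using T[of j t] \<tau>N(2)[of j] that by linarith
  define good where "good j \<beta> \<longleftrightarrow> path \<beta> \<and> path_image \<beta> \<subseteq> far (real (N (Suc j))) \<and>
    pathstart \<beta> = ray x (real (\<tau> j)) \<and> pathfinish \<beta> = a (real (\<tau> j))" for j \<beta>
  have good_ex: "\<exists>\<beta>. good j \<beta>" for j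
    unfolding good_def
    by (rule exists_connecting_path[OF x(1) _ _ a]) (use \<tau>N(1) arad in auto)
  define L where "L j \<beta> = (ray x \<circ> linepath (real (\<tau> (Suc j))) (real (\<tau> j))) +++
    (\<beta> +++ (a \<circ> linepath (real (\<tau> j)) (real (\<tau> (Suc j)))))" for j \<beta>
  have step: "\<exists>\<beta>'. good (Suc j) \<beta>' \<and> homotopic_paths (far (real (N j) - 1)) (L j \<beta>) \<beta>'" if "good j \<beta>" for j \<beta>
  proof -
    obtain \<beta>' where \<beta>': "good (Suc j) \<beta>'" using good_ex by blast
    have "\<exists>\<beta>''. path \<beta>'' \<and> path_image \<beta>'' \<subseteq> far (real (N (Suc (Suc j)))) \<and> pathstart \<beta>'' = ray x (real (\<tau> (Suc j))) \<and>
      pathfinish \<beta>'' = a (real (\<tau> (Suc j))) \<and> homotopic_paths (far (real (N j) - 1)) (L j \<beta>) \<beta>''"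
      unfolding L_def
    proof (rule exists_homotopic_outer_path[OF x(1) ca, where m = "M (N j)" and \<beta>' = \<beta>'])
      show "path_image \<beta> \<subseteq> far (real (M (N j)))"
        using that far_mono[of "real (M (N j))" "real (N (Suc j))"] N(2)[of j] unfolding good_def by auto
      show "M (N j) \<le> N (Suc (Suc j))" using N(2) Mge by (metis Suc_leD le_SucI order_trans)
      show "real (M (N j)) < rad (a t)" if "t \<ge> real (\<tau> j)" for t using arad[OF that] N(2)[of j] by simp
      show "M (N j) < \<tau> j" using \<tau>N(1)[of j] N(2)[of j] by simp
      show "\<exists>\<gamma>. path \<gamma> \<and> path_image \<gamma> \<subseteq> far (real K - 1) \<and> pathstart \<gamma> = x K \<and> pathfinish \<gamma> = x K \<and>
          homotopic_paths (far (real (N j) - 1)) (proj (real (N j)) \<circ> \<gamma>) (proj (real (N j)) \<circ> \<theta>)"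
        if "N j \<le> K" "path \<theta>" "\<forall>t\<in>{0..1}. real (M (N j)) \<le> rad (\<theta> t)" "pathstart \<theta> = x i" "pathfinish \<theta> = x i"
          "M (N j) \<le> i" for K \<theta> i
        using M[of "N j"] that unfolding push_def by blast
    qed (use that \<beta>' Mge \<tau>mono \<tau>N(1) in \<open>auto simp: good_def\<close>)
    then show ?thesis unfolding good_def by blast
  qed
  obtain \<beta> where \<beta>: "\<And>j. good j (\<beta> j)" "\<And>j. homotopic_paths (far (real (N j) - 1)) (L j (\<beta> j)) (\<beta> (Suc j))"
    using dependent_nat_choice[of good "\<lambda>j \<beta> \<beta>'. homotopic_paths (far (real (N j) - 1)) (L j \<beta>) \<beta>'"]
      good_ex step by metis
  define \<sigma> where "\<sigma> j = ((\<lambda>_. real (\<tau> j)) +++ linepath (real (\<tau> j)) (real (\<tau> (Suc j)))) +++ (\<lambda>_. real (\<tau> (Suc j)))" for j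
  have S: "far (real (N (Suc j))) \<subseteq> far (real (N j) - 1)" for j
    using Mge[of "N j"] N(2)[of j] by (intro far_mono) simp
  show ?thesis
  proof (rule properly_homotopic_of_strips[where \<sigma> = \<sigma> and \<beta> = \<beta>])
    show "continuous_on {0..} (ray x)" by (rule continuous_on_ray[OF x(1)])
    show "\<exists>T\<ge>0. \<forall>t\<ge>T. R < rad (ray x t)" for R
      using x(1) by (intro exI[of _ "max 0 (R + 1)"]) simp
    show "strip (far (real j - 1)) (ray x) a (\<sigma> j) (\<beta> j) (\<beta> (Suc j))" for j
    proof -
      have "strip (far (real (N j) - 1)) (ray x) a (\<sigma> j) (\<beta> j) (\<beta> (Suc j))"
        unfolding \<sigma>_def
      proof (rule strip_between[OF continuous_on_ray[OF x(1)] ca])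
        show "ray x t \<in> far (real (N j) - 1)" if "t \<ge> real (\<tau> j)" for t
        proof -
          have "0 \<le> t" using that by (rule order_trans[rotated]) simp
          then have "ray x t \<in> far (real (N (Suc j)))" using x(1) that \<tau>N(1)[of j] by (simp add: mem_far)
          then show ?thesis using S by blast
        qed
        show "a t \<in> far (real (N j) - 1)" if "t \<ge> real (\<tau> j)" for t
          using arad[OF that] S[of j] by (meson mem_far subsetD)
        show "path_image (\<beta> j) \<subseteq> far (real (N j) - 1)" using \<beta>(1)[of j] S[of j] unfolding good_def by blast
      qed (use \<beta>[of j] \<tau>mono[of j] in \<open>auto simp: good_def L_def\<close>)
      moreover have "far (real (N j) - 1) \<subseteq> far (real j - 1)" using Nge[of j] by (intro far_mono) simp
      ultimately show ?thesis unfolding strip_def by (meson order_trans)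
    qed
    show "pathfinish (\<sigma> j) = pathstart (\<sigma> (Suc j))" for j
      by (simp add: \<sigma>_def) (simp add: pathstart_def pathfinish_def)
    show "real j \<le> \<sigma> j s" if "s \<in> {0..1}" for j s
    proof -
      have "real (\<tau> j) \<le> linepath (real (\<tau> j)) (real (\<tau> (Suc j))) u" if "u \<in> {0..1}" for u
      proof -
        have "0 \<le> u * (real (\<tau> (Suc j)) - real (\<tau> j))" using that \<tau>mono[of j] by simp
        then show ?thesis by (simp add: linepath_def algebra_simps)
      qed
      then have "real (\<tau> j) \<le> \<sigma> j s" using that \<tau>mono[of j] by (auto simp: \<sigma>_def joinpaths_def)
      moreover have "j \<le> \<tau> j" using Nge[of "Suc j"] \<tau>N(1)[of j] by simp
      ultimately show ?thesis by linarith
    qed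
    show "continuous_on {0..} a" by (rule ca)
    show "\<exists>T\<ge>0. \<forall>t\<ge>T. R < rad (a t)" for R by (rule proper_ray_diverges[OF a])
  qed
qed

end

theorem theorem1p1:
  assumes "proper_metric TYPE('a::metric_space)"
    and "CAT0 TYPE('a)"
    and "one_ended TYPE('a)"
  shows "semistable_at_infinity TYPE('a) \<longleftrightarrow>
    (\<forall>c c' :: real \<Rightarrow> 'a. geodesic_ray c \<and> geodesic_ray c' \<longrightarrow> properly_homotopic c c')"
proof -
  fix x0 :: 'a
  interpret one_ended_cat0 x0
    by unfold_locales (use assms in auto)
  show ?thesis
  proof
    assume "semistable_at_infinity TYPE('a)"
    then show "\<forall>c c' :: real \<Rightarrow> 'a. geodesic_ray c \<and> geodesic_ray c' \<longrightarrow> properly_homotopic c c'"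
      unfolding semistable_at_infinity_def using proper_ray_of_geodesic_ray by blast
  next
    assume geo: "\<forall>c c' :: real \<Rightarrow> 'a. geodesic_ray c \<and> geodesic_ray c' \<longrightarrow> properly_homotopic c c'"
    obtain x where x: "x \<in> bd" using bd_nonempty by blast
    have "properly_homotopic (ray x) (ray y)" if "y \<in> bd" for y
      using geo geodesic_ray_ray[OF x] geodesic_ray_ray[OF that] by blast
    then have to_x: "properly_homotopic (ray x) a" if "proper_ray a" for a
      using proper_ray_homotopic_to_geodesic_ray[OF x _ that] by blast
    show "semistable_at_infinity TYPE('a)"
      unfolding semistable_at_infinity_def
    proof (intro allI impI, elim conjE)
      fix c c' :: "real \<Rightarrow> 'a" assume "proper_ray c" "proper_ray c'"
      then show "properly_homotopic c c'"
        by (intro properly_homotopic_trans[OF properly_homotopic_sym[OF to_x] to_x])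
    qed
  qed
qed

end
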